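(* Let $\{\eta(t)\}_{t\ge 0}$ be a process on $S^{\mathbb T_N}$ with generator $L=\sum_{x\in\mathbb T_N}L_{x,x+1}$ satisfying the basic assumptions (A1)–(A5) and the degree-preserving assumptions (A6.1)–(A6.2) listed in the context, and let $\mathsf a,\mathsf b,\mathsf c,\mathsf d\in\mathbb R$ be the constants in (A6.2), so that $L_{0,1}(\eta_0\eta_1)=\mathsf a(\eta_0^2+\eta_1^2)+\mathsf b\,\eta_0\eta_1+\mathsf c(\eta_0+\eta_1)+\mathsf d$. Then $\mathsf a\neq 0$, and there exist constants $v_0,v_1,v_2\in\mathbb R$ such that $$\mathrm{Var}_{\nu_\rho}[\eta_0]=v_2\rho^2+v_1\rho+v_0\qquad\text{for every }\rho\in\overline\rho(I^{o}),$$ and they satisfy $$v_2=-\frac{\mathsf b}{2\mathsf a}-1,\qquad v_1=-\frac{\mathsf c}{\mathsf a},\qquad v_0=-\frac{\mathsf d}{2\mathsf a}.$$ Moreover, up to constant shifts and scaling (that is, up to replacing $\eta_0$ by an affine transformation $A\eta_0+B$ with constants $A\ne 0$ and $B$), the marginal distribution of $\eta_0$ is either normal, Poisson, gamma, binomial, negative-binomial or generalized hyperbolic secant, where the parameters $(v_2,v_1,v_0)$ are respectively given by $(0,0,1)$, $(0,1,0)$, $(s,0,0)$, $(-1/\kappa,1,0)$, $(s,1,0)$ or $(s,0,1)$, with $s>0$ and $\kappa\in\mathbb N$.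
   Context: Setting. $\mathbb T_N=\mathbb Z/N\mathbb Z$; $S\subseteq\mathbb R$ is measurable and locally compact; $\mathscr X_N=S^{\mathbb T_N}$ with elements $\eta=(\eta_x)_{x\in\mathbb T_N}$. $C(\mathscr X_N)$ is the space of real continuous functions on $\mathscr X_N$ (vanishing at infinity if $\mathscr X_N$ is not compact) with the sup norm. Shifts: $(\tau_x\eta)_z=\eta_{z+x}$, $\tau_xf(\eta)=f(\tau_x\eta)$. $L=\sum_{x\in\mathbb T_N}L_{x,x+1}$ is an operator with domain $\mathcal D(L)$, where $L_{x,x+1}=\tau_xL_{0,1}\tau_{-x}$, $L_{0,1}$ is a linear operator, and all $L_{x,x+1}$ have domain $\mathcal D(L)$. $\{\eta(t)\}_{t\ge0}$ is a Feller process on $\mathscr X_N$ with generator $L$. $\mathcal P_k$ is the space of polynomials in $(\eta_x)_{x\in\mathbb T_N}$ of degree at most $k$. Natural exponential family: $\{\overline\mu_\lambda\}_{\lambda\in I}$ on $S$ with $\overline\mu_\lambda(ds)=Z_\lambda^{-1}e^{\lambda s}\mu^0(ds)$, where $\mu^0$ is a non-Dirac probability measure on $S$, $Z_\lambda=\int_Se^{\lambda s}\mu^0(ds)$ and $I=\{\lambda\in\mathbb R:Z_\lambda<\infty\}$, which is required not to be a singleton (so it is an interval with non-empty interior $I^o$). Basic assumptions: (A1) $L_{0,1}1=0$. (A2) $L_{0,1}(FG)=F\,L_{0,1}G$ if $F,G,FG\in\mathcal D(L)$ and $F$ is a function of $\{\eta_y\}_{y\ne0,1}$ and $\eta_0+\eta_1$.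 (A3) $L_{0,1}F=\sigma_{0,1}(L_{0,1}\sigma_{0,1}F)$ for $F\in\mathcal D(L)$, where $\sigma_{0,1}F(\eta)=F(\sigma_{0,1}\eta)$ and $\sigma_{0,1}\eta$ is $\eta$ with $\eta_0$ and $\eta_1$ exchanged. (A4) The product measures $\overline\nu_\lambda(d\eta)=\prod_{x\in\mathbb T_N}\overline\mu_\lambda(d\eta_x)$, $\lambda\in I$, are invariant for the process, where $\{\overline\mu_\lambda\}_{\lambda\in I}$ is a natural exponential family on $S$. (A5) $E_{\overline\nu_\lambda}[F(-LF)]\ge0$ for $F\in\mathcal D(L)$. Degree-preserving assumptions: $L_{0,1}$ can act also on polynomials in $\mathcal P_2$ (and (A1)–(A3), the invariance identity $E_{\overline\nu_\lambda}[Lf]=0$, and (A5), for $\lambda\in I^o$, are understood to hold also for polynomials in $\mathcal P_2$). For a polynomial $f$ put $M_f(t)=f(\eta(t))-f(\eta(0))-\int_0^tLf(\eta(s))ds$ and $N_f(t)=M_f(t)^2-\int_0^t\big(L(f^2)-2fLf\big)(\eta(s))ds$. (A6.1) $L_{0,1}\eta_0=\mathsf p\eta_0+\mathsf q\eta_1+\mathsf r$ for some $\mathsf p,\mathsf q,\mathsf r\in\mathbb R$, $L_{0,1}\eta_0\not\equiv0$, and for $f\in\mathcal P_1$ the processes $M_f$ and $N_f$ are martingales in the natural filtration. (A6.2) $L_{0,1}(\eta_0\eta_1)=\mathsf a(\eta_0^2+\eta_1^2)+\mathsf b\,\eta_0\eta_1+\mathsf c(\eta_0+\eta_1)+\mathsf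 d$ for some $\mathsf a,\mathsf b,\mathsf c,\mathsf d\in\mathbb R$, $L_{0,1}(\eta_0\eta_1)\not\equiv0$, and for $f\in\mathcal P_2\setminus\mathcal P_1$ the process $M_f$ is a martingale. Parametrization by the mean: $\overline\rho(\lambda)=E_{\overline\nu_\lambda}[\eta_0]$ is strictly increasing on $I^o$; for $\rho\in\overline\rho(I^o)$ let $\lambda(\rho)$ be the unique $\lambda\in I^o$ with $\overline\rho(\lambda)=\rho$, and $\nu_\rho=\overline\nu_{\lambda(\rho)}$. The generalized hyperbolic secant (GHS) distribution with parameters $r>0$, $\theta\in(-\pi/2,\pi/2)$ has density on $\mathbb R$ given by $e^{\theta\eta+r\log\cos\theta}\frac{2^{r-2}}{\pi\Gamma(r)}\left|\Gamma\left(\frac r2+i\frac\eta2\right)\right|^2$. *)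

theory Defs
  imports "HOL-Probability.Probability" "HOL-Combinatorics.Transposition"
begin

section \<open>Configurations on the discrete torus\<close>

text \<open>
  The torus $\mathbb{Z}/N\mathbb{Z}$ is represented by the residues $0,\dots,N-1$; a configuration is
  an extensional function on it.  All site arithmetic is modulo \<open>N\<close>, so the neighbour of \<open>0\<close> is
  the site \<open>1 mod int N\<close> (which is \<open>1\<close> as soon as \<open>N > 1\<close>).
  Real functions on \<open>configs N S\<close> are represented by total functions, of which only the values on
  \<open>configs N S\<close> are meaningful.
\<close>

type_synonym config = "int \<Rightarrow> real"

definition sites :: "nat \<Rightarrow> int set" where
  "sites N = {0..<int N}"

definition configs :: "nat \<Rightarrow> real set \<Rightarrow> config set" where
  "configs N S = sites N \<rightarrow>\<^sub>E S"

definition config_space :: "nat \<Rightarrow> real set \<Rightarrow> config measure" where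
  "config_space N S = PiM (sites N) (\<lambda>_. restrict_space borel S)"

definition shift :: "nat \<Rightarrow> int \<Rightarrow> config \<Rightarrow> config" where
  "shift N x \<eta> = restrict (\<lambda>z. \<eta> ((z + x) mod int N)) (sites N)"

definition tau :: "nat \<Rightarrow> int \<Rightarrow> (config \<Rightarrow> real) \<Rightarrow> (config \<Rightarrow> real)" where
  "tau N x f = (\<lambda>\<eta>. f (shift N x \<eta>))"

definition exchange :: "nat \<Rightarrow> (config \<Rightarrow> real) \<Rightarrow> (config \<Rightarrow> real)" where
  "exchange N f = (\<lambda>\<eta>. f (\<eta> \<circ> Transposition.transpose 0 (1 mod int N)))"

text \<open>
  Real continuous functions vanishing at infinity (all continuous functions if \<open>configs N S\<close> is
  compact: take \<open>K = configs N S\<close>).  The topology is the product topology.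
\<close>

definition C0 :: "nat \<Rightarrow> real set \<Rightarrow> (config \<Rightarrow> real) set" where
  "C0 N S = {f. continuous_on (configs N S) f \<and>
     (\<forall>\<epsilon>>0. \<exists>K. compact K \<and> K \<subseteq> configs N S \<and> (\<forall>\<eta>\<in>configs N S - K. \<bar>f \<eta>\<bar> < \<epsilon>))}"

definition polys :: "nat \<Rightarrow> real set \<Rightarrow> nat \<Rightarrow> (config \<Rightarrow> real) set" where
  "polys N S k = {f. \<exists>c. \<forall>\<eta>\<in>configs N S. f \<eta> =
     (\<Sum>\<alpha> | \<alpha> \<in> sites N \<rightarrow>\<^sub>E {..k} \<and> (\<Sum>x\<in>sites N. \<alpha> x) \<le> k.
        c \<alpha> * (\<Prod>x\<in>sites N. \<eta> x ^ \<alpha> x))}"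

section \<open>Operators\<close>

text \<open>
  A linear operator with domain \<open>D\<close>.  The first conjunct says that \<open>D\<close> and \<open>A\<close> only see the values
  of functions on \<open>X\<close>.
\<close>

definition linear_operator_on ::
    "config set \<Rightarrow> (config \<Rightarrow> real) set \<Rightarrow> ((config \<Rightarrow> real) \<Rightarrow> (config \<Rightarrow> real)) \<Rightarrow> bool" where
  "linear_operator_on X D A \<longleftrightarrow>
     (\<forall>f\<in>D. \<forall>g. (\<forall>\<eta>\<in>X. f \<eta> = g \<eta>) \<longrightarrow> g \<in> D \<and> (\<forall>\<eta>\<in>X. A f \<eta> = A g \<eta>)) \<and>
     (\<lambda>_. 0) \<in> D \<and>
     (\<forall>f\<in>D. \<forall>g\<in>D. \<forall>u v. (\<lambda>\<eta>. u * f \<eta> + v * g \<eta>) \<in> D \<and>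
        (\<forall>\<eta>\<in>X. A (\<lambda>\<eta>. u * f \<eta> + v * g \<eta>) \<eta> = u * A f \<eta> + v * A g \<eta>))"

definition bond_op :: "nat \<Rightarrow> ((config \<Rightarrow> real) \<Rightarrow> (config \<Rightarrow> real)) \<Rightarrow>
    int \<Rightarrow> (config \<Rightarrow> real) \<Rightarrow> (config \<Rightarrow> real)" where
  "bond_op N L01 x f = tau N x (L01 (tau N (- x) f))"

definition full_op :: "nat \<Rightarrow> ((config \<Rightarrow> real) \<Rightarrow> (config \<Rightarrow> real)) \<Rightarrow>
    (config \<Rightarrow> real) \<Rightarrow> (config \<Rightarrow> real)" where
  "full_op N L01 f = (\<lambda>\<eta>. \<Sum>x\<in>sites N. bond_op N L01 x f \<eta>)"

text \<open>
  \<open>L01\<close> is a linear operator on \<open>C0 N S\<close> with domain \<open>D\<close>, and all its translates have the same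
  domain \<open>D\<close>; in addition \<open>L01\<close> acts linearly on polynomials of degree at most \<open>2\<close>.
\<close>

definition local_operator :: "nat \<Rightarrow> real set \<Rightarrow> (config \<Rightarrow> real) set \<Rightarrow>
    ((config \<Rightarrow> real) \<Rightarrow> (config \<Rightarrow> real)) \<Rightarrow> bool" where
  "local_operator N S D L01 \<longleftrightarrow>
     D \<subseteq> C0 N S \<and> L01 ` D \<subseteq> C0 N S \<and>
     linear_operator_on (configs N S) D L01 \<and>
     (\<forall>x\<in>sites N. \<forall>f. tau N (- x) f \<in> D \<longleftrightarrow> f \<in> D) \<and>
     linear_operator_on (configs N S) (polys N S 2) L01"

section \<open>Feller processes\<close>

text \<open>
  The process is given by a measurable space \<open>\<Omega>\<close>, random configurations \<open>Y t\<close> (only \<open>t \<ge> 0\<close>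
  matters) and, for each initial configuration \<open>\<eta>\<close>, a law \<open>P \<eta>\<close> on \<open>\<Omega>\<close>.
\<close>

definition natural_filtration :: "'w measure \<Rightarrow> 'c measure \<Rightarrow> (real \<Rightarrow> 'w \<Rightarrow> 'c) \<Rightarrow> real \<Rightarrow> 'w measure" where
  "natural_filtration \<Omega> E Y t =
     sigma (space \<Omega>) {Y s -` A \<inter> space \<Omega> | s A. 0 \<le> s \<and> s \<le> t \<and> A \<in> sets E}"

definition martingale :: "'w measure \<Rightarrow> (real \<Rightarrow> 'w measure) \<Rightarrow> (real \<Rightarrow> 'w \<Rightarrow> real) \<Rightarrow> bool" where
  "martingale M F Z \<longleftrightarrow>
     (\<forall>t\<ge>0. Z t \<in> borel_measurable (F t) \<and> integrable M (Z t)) \<and>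
     (\<forall>s t. 0 \<le> s \<and> s \<le> t \<longrightarrow> (AE \<omega> in M. real_cond_exp M (F s) (Z t) \<omega> = Z s \<omega>))"

definition semigroup :: "(config \<Rightarrow> 'w measure) \<Rightarrow> (real \<Rightarrow> 'w \<Rightarrow> config) \<Rightarrow>
    real \<Rightarrow> (config \<Rightarrow> real) \<Rightarrow> (config \<Rightarrow> real)" where
  "semigroup P Y t f = (\<lambda>\<eta>. \<integral>\<omega>. f (Y t \<omega>) \<partial>P \<eta>)"

definition feller_process :: "nat \<Rightarrow> real set \<Rightarrow> 'w measure \<Rightarrow> (config \<Rightarrow> 'w measure) \<Rightarrow>
    (real \<Rightarrow> 'w \<Rightarrow> config) \<Rightarrow> bool" where
  "feller_process N S \<Omega> P Y \<longleftrightarrow>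
     (\<forall>\<eta>\<in>configs N S. prob_space (P \<eta>) \<and> sets (P \<eta>) = sets \<Omega> \<and> (AE \<omega> in P \<eta>. Y 0 \<omega> = \<eta>)) \<and>
     (\<forall>t\<ge>0. Y t \<in> \<Omega> \<rightarrow>\<^sub>M config_space N S) \<and>
     \<comment> \<open>right-continuous paths with left limits\<close>
     (\<forall>\<omega>\<in>space \<Omega>.
        (\<forall>t\<ge>0. ((\<lambda>s. Y s \<omega>) \<longlongrightarrow> Y t \<omega>) (at_right t)) \<and>
        (\<forall>t>0. \<exists>\<zeta>\<in>configs N S. ((\<lambda>s. Y s \<omega>) \<longlongrightarrow> \<zeta>) (at_left t))) \<and>
     \<comment> \<open>Markov property\<close>
     (\<forall>\<eta>\<in>configs N S. \<forall>f\<in>C0 N S. \<forall>s\<ge>0. \<forall>t\<ge>0. AE \<omega> in P \<eta>.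
        real_cond_exp (P \<eta>) (natural_filtration \<Omega> (config_space N S) Y s)
          (\<lambda>\<omega>. f (Y (s + t) \<omega>)) \<omega> = semigroup P Y t f (Y s \<omega>)) \<and>
     \<comment> \<open>Feller property and strong continuity\<close>
     (\<forall>f\<in>C0 N S. \<forall>t\<ge>0. semigroup P Y t f \<in> C0 N S) \<and>
     (\<forall>f\<in>C0 N S. uniform_limit (configs N S) (\<lambda>t. semigroup P Y t f) f (at_right 0))"

definition has_generator :: "nat \<Rightarrow> real set \<Rightarrow> (config \<Rightarrow> 'w measure) \<Rightarrow> (real \<Rightarrow> 'w \<Rightarrow> config) \<Rightarrow>
    (config \<Rightarrow> real) set \<Rightarrow> ((config \<Rightarrow> real) \<Rightarrow> (config \<Rightarrow> real)) \<Rightarrow> bool" where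
  "has_generator N S P Y D L \<longleftrightarrow>
     (let lim = (\<lambda>f g. uniform_limit (configs N S)
                   (\<lambda>t \<eta>. (semigroup P Y t f \<eta> - f \<eta>) / t) g (at_right 0))
      in D = {f \<in> C0 N S. \<exists>g\<in>C0 N S. lim f g} \<and> (\<forall>f\<in>D. L f \<in> C0 N S \<and> lim f (L f)))"

section \<open>Natural exponential families\<close>

definition nef_dom :: "real measure \<Rightarrow> real set" where
  "nef_dom \<mu>0 = {l. (\<integral>\<^sup>+s. ennreal (exp (l * s)) \<partial>\<mu>0) < \<infinity>}"

definition nef_Z :: "real measure \<Rightarrow> real \<Rightarrow> real" where
  "nef_Z \<mu>0 l = (\<integral>s. exp (l * s) \<partial>\<mu>0)"

definition nef :: "real measure \<Rightarrow> real \<Rightarrow> real measure" where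
  "nef \<mu>0 l = density \<mu>0 (\<lambda>s. ennreal (exp (l * s) / nef_Z \<mu>0 l))"

definition nef_base :: "real set \<Rightarrow> real measure \<Rightarrow> bool" where
  "nef_base S \<mu>0 \<longleftrightarrow>
     prob_space \<mu>0 \<and> sets \<mu>0 = sets (restrict_space borel S) \<and>
     (\<forall>s\<in>S. \<mu>0 \<noteq> return (restrict_space borel S) s) \<and>
     \<not> is_singleton (nef_dom \<mu>0)"

definition nu_bar :: "nat \<Rightarrow> real measure \<Rightarrow> real \<Rightarrow> config measure" where
  "nu_bar N \<mu>0 l = PiM (sites N) (\<lambda>_. nef \<mu>0 l)"

definition rho_bar :: "nat \<Rightarrow> real measure \<Rightarrow> real \<Rightarrow> real" where
  "rho_bar N \<mu>0 l = (\<integral>\<eta>. \<eta> 0 \<partial>nu_bar N \<mu>0 l)"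

definition lambda_of :: "nat \<Rightarrow> real measure \<Rightarrow> real \<Rightarrow> real" where
  "lambda_of N \<mu>0 \<rho> = (THE l. l \<in> interior (nef_dom \<mu>0) \<and> rho_bar N \<mu>0 l = \<rho>)"

definition nu :: "nat \<Rightarrow> real measure \<Rightarrow> real \<Rightarrow> config measure" where
  "nu N \<mu>0 \<rho> = nu_bar N \<mu>0 (lambda_of N \<mu>0 \<rho>)"

definition mean_dom :: "nat \<Rightarrow> real measure \<Rightarrow> real set" where
  "mean_dom N \<mu>0 = rho_bar N \<mu>0 ` interior (nef_dom \<mu>0)"

section \<open>Basic assumptions\<close>

text \<open>
  \<open>A2\<close> and \<open>A3\<close> are relative to a class \<open>V\<close> of functions, to be used for the domain of the
  generator and for polynomials of degree at most \<open>2\<close>.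
\<close>

definition A1 :: "nat \<Rightarrow> real set \<Rightarrow> ((config \<Rightarrow> real) \<Rightarrow> (config \<Rightarrow> real)) \<Rightarrow> bool" where
  "A1 N S L01 \<longleftrightarrow> (\<forall>\<eta>\<in>configs N S. L01 (\<lambda>_. 1) \<eta> = 0)"

text \<open>\<open>F\<close> is a function of the values at the sites other than \<open>0, 1\<close> and of the sum over \<open>0, 1\<close>.\<close>

definition depends_on_sum01 :: "nat \<Rightarrow> real set \<Rightarrow> (config \<Rightarrow> real) \<Rightarrow> bool" where
  "depends_on_sum01 N S F \<longleftrightarrow>
     (\<forall>\<eta>\<in>configs N S. \<forall>\<zeta>\<in>configs N S.
        (\<forall>y\<in>sites N - {0, 1 mod int N}. \<eta> y = \<zeta> y) \<and>
        \<eta> 0 + \<eta> (1 mod int N) = \<zeta> 0 + \<zeta> (1 mod int N) \<longrightarrow> F \<eta> = F \<zeta>)"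

definition A2 :: "nat \<Rightarrow> real set \<Rightarrow> (config \<Rightarrow> real) set \<Rightarrow>
    ((config \<Rightarrow> real) \<Rightarrow> (config \<Rightarrow> real)) \<Rightarrow> bool" where
  "A2 N S V L01 \<longleftrightarrow>
     (\<forall>F\<in>V. \<forall>G\<in>V. (\<lambda>\<eta>. F \<eta> * G \<eta>) \<in> V \<and> depends_on_sum01 N S F \<longrightarrow>
        (\<forall>\<eta>\<in>configs N S. L01 (\<lambda>\<eta>. F \<eta> * G \<eta>) \<eta> = F \<eta> * L01 G \<eta>))"

definition A3 :: "nat \<Rightarrow> real set \<Rightarrow> (config \<Rightarrow> real) set \<Rightarrow>
    ((config \<Rightarrow> real) \<Rightarrow> (config \<Rightarrow> real)) \<Rightarrow> bool" where
  "A3 N S V L01 \<longleftrightarrow>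
     (\<forall>F\<in>V. exchange N F \<in> V \<and>
        (\<forall>\<eta>\<in>configs N S. L01 F \<eta> = exchange N (L01 (exchange N F)) \<eta>))"

definition A4 :: "nat \<Rightarrow> real set \<Rightarrow> real measure \<Rightarrow> (config \<Rightarrow> 'w measure) \<Rightarrow>
    (real \<Rightarrow> 'w \<Rightarrow> config) \<Rightarrow> bool" where
  "A4 N S \<mu>0 P Y \<longleftrightarrow> nef_base S \<mu>0 \<and>
     (\<forall>l\<in>nef_dom \<mu>0. \<forall>f\<in>C0 N S. \<forall>t\<ge>0.
        (\<integral>\<eta>. semigroup P Y t f \<eta> \<partial>nu_bar N \<mu>0 l) = (\<integral>\<eta>. f \<eta> \<partial>nu_bar N \<mu>0 l))"

definition A5 :: "nat \<Rightarrow> real measure \<Rightarrow> real set \<Rightarrow> (config \<Rightarrow> real) set \<Rightarrow>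
    ((config \<Rightarrow> real) \<Rightarrow> (config \<Rightarrow> real)) \<Rightarrow> bool" where
  "A5 N \<mu>0 \<Lambda> V L01 \<longleftrightarrow>
     (\<forall>l\<in>\<Lambda>. \<forall>F\<in>V. (\<integral>\<eta>. F \<eta> * (- full_op N L01 F \<eta>) \<partial>nu_bar N \<mu>0 l) \<ge> 0)"

definition basic_assumptions :: "nat \<Rightarrow> real set \<Rightarrow> real measure \<Rightarrow> (config \<Rightarrow> real) set \<Rightarrow>
    ((config \<Rightarrow> real) \<Rightarrow> (config \<Rightarrow> real)) \<Rightarrow>
    (config \<Rightarrow> 'w measure) \<Rightarrow> (real \<Rightarrow> 'w \<Rightarrow> config) \<Rightarrow> bool" where
  "basic_assumptions N S \<mu>0 D L01 P Y \<longleftrightarrow>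
     A1 N S L01 \<and> A2 N S D L01 \<and> A3 N S D L01 \<and> A4 N S \<mu>0 P Y \<and>
     A5 N \<mu>0 (nef_dom \<mu>0) D L01"

text \<open>The same properties for polynomials of degree at most \<open>2\<close>.\<close>

definition basic_assumptions_polys :: "nat \<Rightarrow> real set \<Rightarrow> real measure \<Rightarrow>
    ((config \<Rightarrow> real) \<Rightarrow> (config \<Rightarrow> real)) \<Rightarrow> bool" where
  "basic_assumptions_polys N S \<mu>0 L01 \<longleftrightarrow>
     A1 N S L01 \<and> A2 N S (polys N S 2) L01 \<and> A3 N S (polys N S 2) L01 \<and>
     (\<forall>l\<in>interior (nef_dom \<mu>0). \<forall>f\<in>polys N S 2.
        (\<integral>\<eta>. full_op N L01 f \<eta> \<partial>nu_bar N \<mu>0 l) = 0) \<and>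
     A5 N \<mu>0 (interior (nef_dom \<mu>0)) (polys N S 2) L01"

section \<open>Degree-preserving assumptions\<close>

definition mart_M :: "((config \<Rightarrow> real) \<Rightarrow> (config \<Rightarrow> real)) \<Rightarrow> (real \<Rightarrow> 'w \<Rightarrow> config) \<Rightarrow>
    (config \<Rightarrow> real) \<Rightarrow> real \<Rightarrow> 'w \<Rightarrow> real" where
  "mart_M L Y f t \<omega> = f (Y t \<omega>) - f (Y 0 \<omega>) - (LINT s:{0..t}|lborel. L f (Y s \<omega>))"

definition mart_N :: "((config \<Rightarrow> real) \<Rightarrow> (config \<Rightarrow> real)) \<Rightarrow> (real \<Rightarrow> 'w \<Rightarrow> config) \<Rightarrow>
    (config \<Rightarrow> real) \<Rightarrow> real \<Rightarrow> 'w \<Rightarrow> real" where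
  "mart_N L Y f t \<omega> = (mart_M L Y f t \<omega>)\<^sup>2 -
     (LINT s:{0..t}|lborel. L (\<lambda>\<eta>. (f \<eta>)\<^sup>2) (Y s \<omega>) - 2 * f (Y s \<omega>) * L f (Y s \<omega>))"

definition A6_1 :: "nat \<Rightarrow> real set \<Rightarrow> ((config \<Rightarrow> real) \<Rightarrow> (config \<Rightarrow> real)) \<Rightarrow>
    'w measure \<Rightarrow> (config \<Rightarrow> 'w measure) \<Rightarrow> (real \<Rightarrow> 'w \<Rightarrow> config) \<Rightarrow>
    real \<Rightarrow> real \<Rightarrow> real \<Rightarrow> bool" where
  "A6_1 N S L01 \<Omega> P Y p q r \<longleftrightarrow>
     (\<forall>\<eta>\<in>configs N S. L01 (\<lambda>\<eta>. \<eta> 0) \<eta> = p * \<eta> 0 + q * \<eta> (1 mod int N) + r) \<and>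
     (\<exists>\<eta>\<in>configs N S. L01 (\<lambda>\<eta>. \<eta> 0) \<eta> \<noteq> 0) \<and>
     (\<forall>f\<in>polys N S 1. \<forall>\<eta>\<in>configs N S.
        martingale (P \<eta>) (natural_filtration \<Omega> (config_space N S) Y) (mart_M (full_op N L01) Y f) \<and>
        martingale (P \<eta>) (natural_filtration \<Omega> (config_space N S) Y) (mart_N (full_op N L01) Y f))"

definition A6_2 :: "nat \<Rightarrow> real set \<Rightarrow> ((config \<Rightarrow> real) \<Rightarrow> (config \<Rightarrow> real)) \<Rightarrow>
    'w measure \<Rightarrow> (config \<Rightarrow> 'w measure) \<Rightarrow> (real \<Rightarrow> 'w \<Rightarrow> config) \<Rightarrow>
    real \<Rightarrow> real \<Rightarrow> real \<Rightarrow> real \<Rightarrow> bool" where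
  "A6_2 N S L01 \<Omega> P Y a b c d \<longleftrightarrow>
     (\<forall>\<eta>\<in>configs N S. L01 (\<lambda>\<eta>. \<eta> 0 * \<eta> (1 mod int N)) \<eta> =
        a * ((\<eta> 0)\<^sup>2 + (\<eta> (1 mod int N))\<^sup>2) + b * (\<eta> 0 * \<eta> (1 mod int N)) +
        c * (\<eta> 0 + \<eta> (1 mod int N)) + d) \<and>
     (\<exists>\<eta>\<in>configs N S. L01 (\<lambda>\<eta>. \<eta> 0 * \<eta> (1 mod int N)) \<eta> \<noteq> 0) \<and>
     (\<forall>f\<in>polys N S 2 - polys N S 1. \<forall>\<eta>\<in>configs N S.
        martingale (P \<eta>) (natural_filtration \<Omega> (config_space N S) Y) (mart_M (full_op N L01) Y f))"

section \<open>The six families of distributions\<close>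

definition normal_law :: "real \<Rightarrow> real \<Rightarrow> real measure" where
  "normal_law m \<sigma> = density lborel (\<lambda>x. ennreal (normal_density m \<sigma> x))"

definition poisson_law :: "real \<Rightarrow> real measure" where
  "poisson_law m = distr (measure_pmf (poisson_pmf m)) borel real"

text \<open>Shape \<open>k\<close> and rate \<open>\<beta>\<close>.\<close>

definition gamma_law :: "real \<Rightarrow> real \<Rightarrow> real measure" where
  "gamma_law k \<beta> = density lborel (\<lambda>x. ennreal
     (if x > 0 then \<beta> powr k / Gamma k * x powr (k - 1) * exp (- \<beta> * x) else 0))"

definition binomial_law :: "nat \<Rightarrow> real \<Rightarrow> real measure" where
  "binomial_law \<kappa> p = distr (measure_pmf (binomial_pmf \<kappa> p)) borel real"

text \<open>
  The number of failures before the \<open>r\<close>-th success, with success probability \<open>p\<close>, for an arbitrary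
  real \<open>r > 0\<close> (the library's \<open>neg_binomial_pmf\<close> has integer \<open>r\<close> only).
\<close>

definition neg_binomial_law :: "real \<Rightarrow> real \<Rightarrow> real measure" where
  "neg_binomial_law r p = distr
     (density (count_space (UNIV :: nat set))
        (\<lambda>k. ennreal (((real k + r - 1) gchoose k) * p powr r * (1 - p) ^ k))) borel real"

definition ghs_density :: "real \<Rightarrow> real \<Rightarrow> real \<Rightarrow> real" where
  "ghs_density r \<theta> x = exp (\<theta> * x + r * ln (cos \<theta>)) * (2 powr (r - 2) / (pi * Gamma r)) *
     (cmod (Gamma (Complex (r / 2) (x / 2))))\<^sup>2"

definition ghs_law :: "real \<Rightarrow> real \<Rightarrow> real measure" where
  "ghs_law r \<theta> = density lborel (\<lambda>x. ennreal (ghs_density r \<theta> x))"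

text \<open>The law of \<open>A * \<eta> 0 + B\<close> under \<open>nu N \<mu>0 \<rho>\<close>.\<close>

definition affine_marginal :: "nat \<Rightarrow> real measure \<Rightarrow> real \<Rightarrow> real \<Rightarrow> real \<Rightarrow> real measure" where
  "affine_marginal N \<mu>0 A B \<rho> = distr (nu N \<mu>0 \<rho>) borel (\<lambda>\<eta>. A * \<eta> 0 + B)"

text \<open>
  The variance of a member of the family of laws \<open>M\<close>, indexed by \<open>R\<close>, is the quadratic polynomial
  with coefficients \<open>w2, w1, w0\<close> of its mean.
\<close>

definition quadratic_variance :: "real set \<Rightarrow> (real \<Rightarrow> real measure) \<Rightarrow>
    real \<Rightarrow> real \<Rightarrow> real \<Rightarrow> bool" where
  "quadratic_variance R M w2 w1 w0 \<longleftrightarrow>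
     (\<forall>\<rho>\<in>R. prob_space.variance (M \<rho>) (\<lambda>x. x) =
        w2 * (prob_space.expectation (M \<rho>) (\<lambda>x. x))\<^sup>2 +
        w1 * prob_space.expectation (M \<rho>) (\<lambda>x. x) + w0)"

text \<open>
  \<open>six_families R M w2 w1 w0\<close>: all laws \<open>M \<rho>\<close>, \<open>\<rho> \<in> R\<close>, belong to the same one of the six types,
  with \<open>(w2, w1, w0)\<close> the corresponding triple.

  The distribution \<open>ghs_law r \<theta>\<close> has mean \<open>r * tan \<theta>\<close> and variance \<open>r + m\<^sup>2 / r\<close> in terms of the
  mean \<open>m\<close>, so that the triple \<open>(s, 0, 1)\<close> belongs to its image, for \<open>r = 1 / s\<close>, under the
  scaling by \<open>sqrt s\<close>.
\<close>

definition six_families :: "real set \<Rightarrow> (real \<Rightarrow> real measure) \<Rightarrow> real \<Rightarrow> real \<Rightarrow> real \<Rightarrow> bool" where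
  "six_families R M w2 w1 w0 \<longleftrightarrow>
     ((w2, w1, w0) = (0, 0, 1) \<and> (\<forall>\<rho>\<in>R. \<exists>m. M \<rho> = normal_law m 1)) \<or>
     ((w2, w1, w0) = (0, 1, 0) \<and> (\<forall>\<rho>\<in>R. \<exists>m>0. M \<rho> = poisson_law m)) \<or>
     (\<exists>s>0. (w2, w1, w0) = (s, 0, 0) \<and> (\<forall>\<rho>\<in>R. \<exists>\<beta>>0. M \<rho> = gamma_law (1 / s) \<beta>)) \<or>
     (\<exists>\<kappa>::nat. \<kappa> \<ge> 1 \<and> (w2, w1, w0) = (- 1 / real \<kappa>, 1, 0) \<and>
        (\<forall>\<rho>\<in>R. \<exists>p. 0 < p \<and> p < 1 \<and> M \<rho> = binomial_law \<kappa> p)) \<or>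
     (\<exists>s>0. (w2, w1, w0) = (s, 1, 0) \<and>
        (\<forall>\<rho>\<in>R. \<exists>p. 0 < p \<and> p < 1 \<and> M \<rho> = neg_binomial_law (1 / s) p)) \<or>
     (\<exists>s>0. (w2, w1, w0) = (s, 0, 1) \<and>
        (\<forall>\<rho>\<in>R. \<exists>\<theta>. - pi / 2 < \<theta> \<and> \<theta> < pi / 2 \<and>
           M \<rho> = distr (ghs_law (1 / s) \<theta>) borel (\<lambda>x. sqrt s * x)))"

end

theory Submission
  imports Defs "HOL-Complex_Analysis.Complex_Analysis"
begin

text \<open>
  Apply the generator to the shift invariant polynomial \<open>f = (\<Sum>x. (\<eta> x)\<^sup>2)\<close>.  By (A2) every bond
  contributes a translate of \<open>- 2 * L01 (\<eta> 0 * \<eta> 1)\<close>, so invariance gives \<open>2 * a * E[(\<eta> 0)\<^sup>2] + b * \<rho>\<^sup>2 +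
  2 * c * \<rho> + d = 0\<close>.  The mean takes infinitely many values, hence \<open>a \<noteq> 0\<close>, and the variance is a
  quadratic polynomial of the mean.  The classification is Morris's theorem on natural exponential
  families with quadratic variance function: the cumulant generating function \<open>K\<close> satisfies
  \<open>K'' = w2 * (K')\<^sup>2 + w1 * K' + w0\<close>, which together with \<open>K' 0\<close> determines the law, and after an affine
  change of variable one of the six families solves the equation.  Two points need more work:
  the Laplace transform of the generalized hyperbolic secant density (Fourier inversion of a power of
  the hyperbolic secant), and the integrality of \<open>- 1 / w2\<close> when \<open>w2 < 0\<close> (a positivity argument).
\<close>

section \<open>Laplace transforms and quadratic cumulant equations\<close>

text \<open>Laws given by densities and laws given by weights become comparable through the cumulant
  equation, which is autonomous: coefficients and mean fix the solution, so it is enough to exhibit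
  one law per coefficient triple and mean. For \<open>w2 < 0\<close> with \<open>- 1 / w2\<close>
  not an integer no such law exists; uniqueness then has nothing to compare with, and the case must
  be refuted instead. For the hyperbolic secant a law exists, but its density is a squared modulus
  of Gamma, whose Laplace integral resists direct evaluation. The opposite direction is easy: the
  product of Gamma at conjugate points is a Beta integral, which on the logit scale is a Fourier
  transform. Turning it around requires integrability of the weight, hence decay of Gamma on
  vertical lines at every exponential rate below \<open>pi\<close>; halved by the scaling of the
  argument, this is also the source of the strip of width \<open>pi\<close>. Finally a single affine
  map has to serve the whole family, so all its means must lie in one of the intervals cut out by
  the zeros of the variance; positivity of the variance and connectedness of the set of means give
  this.\<close>

lemma norm_exp_minus_one_le:
  fixes z :: "'a::{real_normed_field,banach}"
  shows "norm (exp z - 1) \<le> norm z * exp (norm z)"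
  using Taylor_exp_field[of z 0] by (simp add: mult.commute)

lemma power_le_exp:
  fixes t \<delta> :: real
  assumes "\<delta> > 0" "t \<ge> 0"
  shows "t ^ n \<le> fact n / \<delta> ^ n * exp (\<delta> * t)"
proof -
  have "(\<delta> * t) ^ n /\<^sub>R fact n \<le> (\<Sum>k. (\<delta> * t) ^ k /\<^sub>R fact k)"
    using assms sum_le_suminf[OF summable_exp_generic[of "\<delta> * t"], of "{n}"] by simp
  also have "\<dots> = exp (\<delta> * t)" by (simp add: exp_def)
  finally show ?thesis using assms by (simp add: field_simps power_mult_distrib)
qed

text \<open>Stated over a normed field so that one proof yields both the real derivatives of the
  moments and the holomorphy of the Laplace transform. Half of the exponential reserve
  \<open>\<delta>\<close> pays for moving the parameter, the other half for the powers of
  \<open>X\<close>.\<close>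

lemma laplace_moment_derivative:
  fixes z :: "'a::{real_normed_field,banach,second_countable_topology}" and X :: "'b \<Rightarrow> real"
  assumes X[measurable]: "X \<in> borel_measurable M" and \<delta>: "\<delta> > 0"
    and int: "integrable M (\<lambda>x. exp (\<delta> * \<bar>X x\<bar>) * norm (exp (z * of_real (X x))))"
  shows laplace_moment_integrable: "integrable M (\<lambda>x. of_real (X x) ^ n * exp (z * of_real (X x)))"
    and "((\<lambda>w. \<integral>x. of_real (X x) ^ n * exp (w * of_real (X x)) \<partial>M) has_field_derivative
           (\<integral>x. of_real (X x) ^ Suc n * exp (z * of_real (X x)) \<partial>M)) (at z)"
proof -
  have [measurable]: "(\<lambda>x. exp (w * of_real (X x))) \<in> borel_measurable M" for w :: 'a
    by (rule borel_measurable_continuous_on[of "\<lambda>t. exp (w * of_real t)", OF _ X])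
       (intro continuous_intros)
  have [measurable]: "(\<lambda>x. (of_real (X x) :: 'a) ^ n) \<in> borel_measurable M" for n
    by (rule borel_measurable_continuous_on[of "\<lambda>t. of_real t ^ n", OF _ X]) (intro continuous_intros)
  define E where "E = (\<lambda>x. exp (\<delta> * \<bar>X x\<bar>) * norm (exp (z * of_real (X x))))"
  have intE: "integrable M E" using int by (simp add: E_def)
  have bnd: "\<bar>X x\<bar> ^ m * exp (\<eta> * \<bar>X x\<bar>) * norm (exp (z * of_real (X x))) \<le> fact m / (\<delta>/2) ^ m * E x"
    if "\<eta> \<le> \<delta> / 2" for m x \<eta>
  proof -
    have "\<bar>X x\<bar> ^ m * exp (\<eta> * \<bar>X x\<bar>) \<le> fact m / (\<delta>/2) ^ m * exp (\<delta>/2 * \<bar>X x\<bar>) * exp (\<delta>/2 * \<bar>X x\<bar>)"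
      using \<delta> mult_right_mono[OF that, of "\<bar>X x\<bar>"] by (intro mult_mono power_le_exp) auto
    also have "\<dots> = fact m / (\<delta>/2) ^ m * exp (\<delta> * \<bar>X x\<bar>)"
      by (simp add: exp_add[symmetric] mult.assoc)
    finally show ?thesis unfolding E_def by (metis (no_types, lifting) mult.assoc mult_right_mono norm_ge_zero)
  qed
  have I: "integrable M (\<lambda>x. of_real (X x) ^ n * exp (w * of_real (X x)))" if "norm (w - z) \<le> \<delta>/2" for w n
  proof (rule Bochner_Integration.integrable_bound[OF integrable_mult_right[OF intE, of "fact n / (\<delta>/2) ^ n"]])
    show "AE x in M. norm (of_real (X x) ^ n * exp (w * of_real (X x))) \<le> norm (fact n / (\<delta>/2) ^ n * E x)"
    proof (rule AE_I2)
      fix x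
      have "exp (w * of_real (X x)) = exp ((w - z) * of_real (X x)) * exp (z * of_real (X x))"
        by (simp add: exp_add[symmetric] algebra_simps)
      then have "norm (exp (w * of_real (X x))) \<le> exp (norm (w - z) * \<bar>X x\<bar>) * norm (exp (z * of_real (X x)))"
        using norm_exp[of "(w - z) * of_real (X x)"] by (simp add: norm_mult mult_right_mono)
      then have "norm (of_real (X x) ^ n * exp (w * of_real (X x))) \<le>
          \<bar>X x\<bar> ^ n * (exp (norm (w - z) * \<bar>X x\<bar>) * norm (exp (z * of_real (X x))))"
        by (simp add: norm_mult norm_power mult_left_mono)
      also have "\<dots> \<le> fact n / (\<delta>/2) ^ n * E x" using bnd[OF that] by (simp add: mult.assoc)
      also have "\<dots> \<le> norm (fact n / (\<delta>/2) ^ n * E x)" by (simp only: real_norm_def abs_ge_self)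
      finally show "norm (of_real (X x) ^ n * exp (w * of_real (X x))) \<le> norm (fact n / (\<delta>/2) ^ n * E x)" .
    qed
  qed simp
  show "integrable M (\<lambda>x. of_real (X x) ^ n * exp (z * of_real (X x)))"
    using I[of z] \<delta> by simp
  let ?F = "\<lambda>w. \<integral>x. of_real (X x) ^ n * exp (w * of_real (X x)) \<partial>M"
  let ?D = "\<integral>x. of_real (X x) ^ Suc n * exp (z * of_real (X x)) \<partial>M"
  \<comment> \<open>Inside the ball every increment has norm at most \<open>\<delta> / 2\<close>, so
    one integrable bound serves all sequences; the ball is open, so the restriction is dropped at
    the end.\<close>
  have "((\<lambda>h. (?F (z + h) - ?F z) / h) \<longlongrightarrow> ?D) (at 0 within ball 0 (\<delta>/2))"
    unfolding tendsto_at_iff_sequentially comp_def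
  proof (intro allI impI)
    fix h :: "nat \<Rightarrow> 'a" assume h: "\<forall>i. h i \<in> ball 0 (\<delta>/2) - {0}" and h0: "h \<longlonglongrightarrow> 0"
    have hn: "norm (h i) \<le> \<delta>/2" "h i \<noteq> 0" for i using h by (auto simp: less_imp_le)
    have eq: "(?F (z + h i) - ?F z) / h i =
      (\<integral>x. of_real (X x) ^ n * exp (z * of_real (X x)) * ((exp (h i * of_real (X x)) - 1) / h i) \<partial>M)" for i
    proof -
      have "(?F (z + h i) - ?F z) / h i =
         (\<integral>x. (of_real (X x) ^ n * exp ((z + h i) * of_real (X x)) - of_real (X x) ^ n * exp (z * of_real (X x))) / h i \<partial>M)"
        using I[of "z + h i" n] I[of z n] hn \<delta> by simp
      then show ?thesis
        by (simp add: exp_add[symmetric] algebra_simps diff_divide_distrib)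
    qed
    show "(\<lambda>i. (?F (z + h i) - ?F z) / h i) \<longlonglongrightarrow> ?D" unfolding eq
    proof (rule integral_dominated_convergence[where w = "\<lambda>x. fact (Suc n) / (\<delta>/2) ^ Suc n * E x"])
      show "integrable M (\<lambda>x. fact (Suc n) / (\<delta>/2) ^ Suc n * E x)" using intE by simp
      show "AE x in M. (\<lambda>i. of_real (X x) ^ n * exp (z * of_real (X x)) * ((exp (h i * of_real (X x)) - 1) / h i))
            \<longlonglongrightarrow> of_real (X x) ^ Suc n * exp (z * of_real (X x))"
      proof (rule AE_I2)
        fix x
        have "((\<lambda>w. exp (w * of_real (X x))) has_field_derivative of_real (X x)) (at (0::'a))"
          by (auto intro!: derivative_eq_intros)
        then have "((\<lambda>k. (exp (k * of_real (X x)) - 1) / k) \<longlongrightarrow> of_real (X x)) (at (0::'a))"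
          by (simp add: DERIV_def)
        then have "(\<lambda>i. (exp (h i * of_real (X x)) - 1) / h i) \<longlonglongrightarrow> of_real (X x)"
          using h0 hn(2) by (auto simp: tendsto_at_iff_sequentially comp_def)
        from tendsto_mult[OF tendsto_const[of "of_real (X x) ^ n * exp (z * of_real (X x))"] this]
        show "(\<lambda>i. of_real (X x) ^ n * exp (z * of_real (X x)) * ((exp (h i * of_real (X x)) - 1) / h i))
            \<longlonglongrightarrow> of_real (X x) ^ Suc n * exp (z * of_real (X x))" 
          by (simp add: mult_ac)
      qed
      show "AE x in M. norm (of_real (X x) ^ n * exp (z * of_real (X x)) * ((exp (h i * of_real (X x)) - 1) / h i))
          \<le> fact (Suc n) / (\<delta>/2) ^ Suc n * E x" for i
      proof (rule AE_I2)
        fix x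
        have "norm (exp (h i * of_real (X x)) - 1) \<le> norm (h i) * (\<bar>X x\<bar> * exp (norm (h i) * \<bar>X x\<bar>))"
          using norm_exp_minus_one_le[of "h i * of_real (X x)"] by (simp add: norm_mult mult.assoc)
        then have "norm ((exp (h i * of_real (X x)) - 1) / h i) \<le> \<bar>X x\<bar> * exp (norm (h i) * \<bar>X x\<bar>)"
          using hn by (simp add: norm_divide field_simps)
        from mult_left_mono[OF this norm_ge_zero[of "of_real (X x) ^ n * exp (z * of_real (X x))"]]
        have "norm (of_real (X x) ^ n * exp (z * of_real (X x)) * ((exp (h i * of_real (X x)) - 1) / h i))
          \<le> \<bar>X x\<bar> ^ n * norm (exp (z * of_real (X x))) * (\<bar>X x\<bar> * exp (norm (h i) * \<bar>X x\<bar>))"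
          by (simp only: norm_mult norm_power norm_of_real)
        also have "\<dots> \<le> fact (Suc n) / (\<delta>/2) ^ Suc n * E x"
          using bnd[OF hn(1), of x "Suc n"] by (simp add: mult_ac)
        finally show "norm (of_real (X x) ^ n * exp (z * of_real (X x)) * ((exp (h i * of_real (X x)) - 1) / h i))
          \<le> fact (Suc n) / (\<delta>/2) ^ Suc n * E x" .
      qed
      show "(\<lambda>x. of_real (X x) ^ Suc n * exp (z * of_real (X x))) \<in> borel_measurable M"
        by (rule borel_measurable_continuous_on[of "\<lambda>t. of_real t ^ Suc n * exp (z * of_real t)", OF _ X])
           (intro continuous_intros)
      show "(\<lambda>x. of_real (X x) ^ n * exp (z * of_real (X x)) * ((exp (h i * of_real (X x)) - 1) / h i))
          \<in> borel_measurable M" for i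
        by (rule borel_measurable_continuous_on[of "\<lambda>t. of_real t ^ n * exp (z * of_real t) *
              ((exp (h i * of_real t) - 1) / h i)", OF _ X])
           (use hn in \<open>intro continuous_intros, auto\<close>)
    qed
  qed
  then have "((\<lambda>h. (?F (z + h) - ?F z) / h) \<longlongrightarrow> ?D) (at 0)"
    using at_within_open[of 0 "ball (0::'a) (\<delta>/2)"] \<delta> by simp
  then show "(?F has_field_derivative ?D) (at z)" by (simp add: DERIV_def)
qed

section \<open>Holomorphy on strips and uniqueness of laws\<close>

lemma exp_abs_mult_le:
  fixes \<delta> h x :: real
  assumes "\<delta> \<ge> 0"
  shows "exp (\<delta> * \<bar>x\<bar>) * exp (h * x) \<le> exp ((h + \<delta>) * x) + exp ((h - \<delta>) * x)"
  by (cases "x \<ge> 0") (simp_all add: exp_add[symmetric] algebra_simps)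

lemma integrable_exp_abs:
  fixes X :: "'b \<Rightarrow> real"
  assumes [measurable]: "X \<in> borel_measurable M" and "\<delta> \<ge> 0"
    and "integrable M (\<lambda>x. exp ((h + \<delta>) * X x))" "integrable M (\<lambda>x. exp ((h - \<delta>) * X x))"
  shows "integrable M (\<lambda>x. exp (\<delta> * \<bar>X x\<bar>) * exp (h * X x))"
  by (rule Bochner_Integration.integrable_bound[OF Bochner_Integration.integrable_add[OF assms(3,4)]])
     (auto intro!: AE_I2 order.trans[OF exp_abs_mult_le[OF assms(2)]])

lemma laplace_holomorphic_on_strip:
  fixes X :: "'b \<Rightarrow> real"
  assumes X[measurable]: "X \<in> borel_measurable M"
    and int: "\<And>h. \<alpha> < h \<Longrightarrow> h < \<beta> \<Longrightarrow> integrable M (\<lambda>x. exp (h * X x))"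
  shows "(\<lambda>z. \<integral>x. exp (z * of_real (X x)) \<partial>M) holomorphic_on {z. \<alpha> < Re z \<and> Re z < \<beta>}"
proof (rule holomorphic_onI)
  fix z assume "z \<in> {z. \<alpha> < Re z \<and> Re z < \<beta>}"
  then have z: "\<alpha> < Re z" "Re z < \<beta>" by auto
  define \<delta> where "\<delta> = min (Re z - \<alpha>) (\<beta> - Re z) / 2"
  have d: "\<delta> > 0" "\<alpha> < Re z - \<delta>" "Re z + \<delta> < \<beta>" using z by (auto simp: \<delta>_def min_def field_simps)
  have "integrable M (\<lambda>x. exp (\<delta> * \<bar>X x\<bar>) * exp (Re z * X x))"
    by (rule integrable_exp_abs) (use d int in auto)
  then have "integrable M (\<lambda>x. exp (\<delta> * \<bar>X x\<bar>) * norm (exp (z * of_real (X x))))"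
    by simp
  from laplace_moment_derivative(2)[OF X d(1) this, of 0]
  show "(\<lambda>z. \<integral>x. exp (z * of_real (X x)) \<partial>M) field_differentiable at z within {z. \<alpha> < Re z \<and> Re z < \<beta>}"
    unfolding field_differentiable_def by (auto intro: has_field_derivative_at_within)
qed

lemma open_strip: "open {z. \<alpha> < Re z \<and> Re z < \<beta>}"
  by (intro open_Collect_conj open_Collect_less continuous_intros)

lemma connected_strip: "connected {z. \<alpha> < Re z \<and> Re z < \<beta>}"
proof -
  have "{z. \<alpha> < Re z \<and> Re z < \<beta>} = {z. \<alpha> < Re z} \<inter> {z. Re z < \<beta>}" by auto
  then show ?thesis
    using convex_Int[OF convex_halfspace_Re_gt convex_halfspace_Re_lt] convex_connected by metis
qed

text \<open>Provides the accumulation point that the identity theorem demands of the set of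
  agreement.\<close>

lemma real_line_islimpt:
  assumes "\<alpha> < 0" "0 < \<beta>"
  shows "(0::complex) islimpt of_real ` {\<alpha><..<\<beta>}" 
proof (rule islimptI)
  fix T :: "complex set" assume T: "0 \<in> T" "open T"
  then obtain e where e: "e > 0" "ball 0 e \<subseteq> T" by (auto simp: open_contains_ball)
  let ?t = "min e \<beta> / 2"
  have "of_real ?t \<in> ball (0::complex) e" using e assms by (auto simp: norm_of_real min_def)
  then have "of_real ?t \<in> T" using e by auto
  moreover have "?t \<in> {\<alpha><..<\<beta>}" "?t \<noteq> 0" using e assms by (auto simp: min_def)
  ultimately show "\<exists>y\<in>complex_of_real ` {\<alpha><..<\<beta>}. y \<in> T \<and> y \<noteq> 0" by (metis image_eqI of_real_eq_0_iff)
qed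

text \<open>The difference of the two transforms is holomorphic on a strip and vanishes on a real
  segment, hence also on the imaginary axis, where the transforms are the characteristic
  functions.\<close>

lemma measure_eq_if_mgf_eq:
  fixes M N :: "real measure"
  assumes M: "real_distribution M" and N: "real_distribution N" and \<delta>: "\<delta> > 0"
    and int: "\<And>h. \<bar>h\<bar> < \<delta> \<Longrightarrow> integrable M (\<lambda>x. exp (h * x))" "\<And>h. \<bar>h\<bar> < \<delta> \<Longrightarrow> integrable N (\<lambda>x. exp (h * x))"
    and eq: "\<And>h. \<bar>h\<bar> < \<delta> \<Longrightarrow> (\<integral>x. exp (h * x) \<partial>M) = (\<integral>x. exp (h * x) \<partial>N)"
  shows "M = N"
proof (rule Levy_uniqueness[OF M N], rule ext)
  interpret M: real_distribution M by fact
  interpret N: real_distribution N by fact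
  fix t
  let ?S = "{z. -\<delta> < Re z \<and> Re z < \<delta>}"
  define F where "F = (\<lambda>z::complex. (\<integral>x. exp (z * of_real x) \<partial>M) - (\<integral>x. exp (z * of_real x) \<partial>N))"
  have hol: "F holomorphic_on ?S" unfolding F_def
    by (intro holomorphic_intros laplace_holomorphic_on_strip) (use int in auto)
  have "F (\<i> * of_real t) = 0"
  proof (rule analytic_continuation[OF hol open_strip connected_strip, of "of_real ` {-\<delta><..<\<delta>}" 0])
    show "complex_of_real ` {- \<delta><..<\<delta>} \<subseteq> ?S" by auto
    show "0 islimpt complex_of_real ` {- \<delta><..<\<delta>}" using real_line_islimpt \<delta> by simp
    show "F z = 0" if z: "z \<in> complex_of_real ` {- \<delta><..<\<delta>}" for z
    proof -
      obtain h where h: "z = of_real h" "\<bar>h\<bar> < \<delta>" using z by auto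
      have *: "exp (z * of_real x) = of_real (exp (h * x))" for x by (simp add: h exp_of_real[symmetric])
      show ?thesis unfolding F_def * using eq[OF h(2)] by simp
    qed
  qed (use \<delta> in auto)
  then show "char M t = char N t" by (simp add: F_def char_def mult_ac)
qed

text \<open>\<open>K\<close> is the cumulant generating function and \<open>k\<close> its
  derivative, so \<open>m\<close> is the mean and the last clause ties the variances of all nearby
  tilted laws to their means. Everything is local at 0, which is enough to determine a law; total
  mass 1 forces \<open>K 0 = 0\<close>.\<close>

definition quad_cumulant :: "real measure \<Rightarrow> real \<Rightarrow> real \<Rightarrow> real \<Rightarrow> real \<Rightarrow> bool" where
  "quad_cumulant M w2 w1 w0 m \<longleftrightarrow> real_distribution M \<and>
     (\<exists>\<delta>>0. \<exists>K k. k 0 = m \<and> (\<forall>h. \<bar>h\<bar> < \<delta> \<longrightarrow>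
        integrable M (\<lambda>x. exp (h * x)) \<and> (\<integral>x. exp (h * x) \<partial>M) = exp (K h) \<and>
        (K has_real_derivative k h) (at h) \<and>
        (k has_real_derivative w2 * (k h)\<^sup>2 + w1 * k h + w0) (at h)))"

text \<open>The difference \<open>k - l\<close> solves a linear homogeneous equation whose coefficient
  \<open>w2 * (k + l) + w1\<close> has the antiderivative \<open>w2 * (K + L) + w1 * h\<close>.\<close>

lemma quadratic_ode_unique:
  fixes K L k l :: "real \<Rightarrow> real"
  assumes \<delta>: "\<delta> > 0" and 0: "k 0 = l 0"
    and K: "\<And>h. \<bar>h\<bar> < \<delta> \<Longrightarrow> (K has_real_derivative k h) (at h)"
    and k: "\<And>h. \<bar>h\<bar> < \<delta> \<Longrightarrow> (k has_real_derivative w2 * (k h)\<^sup>2 + w1 * k h + w0) (at h)"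
    and L: "\<And>h. \<bar>h\<bar> < \<delta> \<Longrightarrow> (L has_real_derivative l h) (at h)"
    and l: "\<And>h. \<bar>h\<bar> < \<delta> \<Longrightarrow> (l has_real_derivative w2 * (l h)\<^sup>2 + w1 * l h + w0) (at h)"
    and h: "\<bar>h\<bar> < \<delta>"
  shows "K h - K 0 = L h - L 0"
proof -
  have S: "convex {-\<delta><..<\<delta>}" "0 \<in> {-\<delta><..<\<delta>}" using \<delta> by auto
  define u where "u = (\<lambda>h. (k h - l h) * exp (- (w2 * (K h + L h) + w1 * h)))"
  have "(u has_real_derivative 0) (at h within {-\<delta><..<\<delta>})" if "h \<in> {-\<delta><..<\<delta>}" for h
  proof -
    have h: "\<bar>h\<bar> < \<delta>" using that by auto
    show ?thesis unfolding u_def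
      by (rule has_field_derivative_at_within)
         (rule derivative_eq_intros K[OF h] k[OF h] L[OF h] l[OF h] refl |
          simp add: algebra_simps power2_eq_square)+
  qed
  then obtain c where c: "\<And>h. h \<in> {-\<delta><..<\<delta>} \<Longrightarrow> u h = c"
    using has_field_derivative_zero_constant[OF S(1)] by metis
  have eq: "k h = l h" if "\<bar>h\<bar> < \<delta>" for h
    using c[OF S(2)] c[of h] that 0 by (auto simp: u_def abs_less_iff)
  have "((\<lambda>h. K h - L h) has_real_derivative 0) (at h within {-\<delta><..<\<delta>})" if "h \<in> {-\<delta><..<\<delta>}" for h
    by (rule has_field_derivative_at_within) (use that DERIV_diff[OF K[of h] L[of h]] eq[of h] in auto)
  then obtain c' where c: "\<And>h. h \<in> {-\<delta><..<\<delta>} \<Longrightarrow> K h - L h = c'"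
    using has_field_derivative_zero_constant[OF S(1), of "\<lambda>h. K h - L h"] by metis
  from c[OF S(2)] c[of h] h show ?thesis by (auto simp: abs_less_iff)
qed

lemma (in prob_space) mgf_0: "(\<integral>x. exp (0 * X x) \<partial>M) = (1::real)"
  by (simp add: prob_space)

text \<open>Reduces every identification of a law to producing a member of a known family with the
  same coefficients and the same mean.\<close>

lemma quad_cumulant_unique:
  assumes M: "quad_cumulant M w2 w1 w0 m" and N: "quad_cumulant N w2 w1 w0 m"
  shows "M = N"
proof -
  from M obtain d1 K k where M': "real_distribution M" "d1 > 0" "k 0 = m" and
    K: "\<And>h. \<bar>h\<bar> < d1 \<Longrightarrow> integrable M (\<lambda>x. exp (h * x)) \<and> (\<integral>x. exp (h * x) \<partial>M) = exp (K h) \<and>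
        (K has_real_derivative k h) (at h) \<and>
        (k has_real_derivative w2 * (k h)\<^sup>2 + w1 * k h + w0) (at h)"
    unfolding quad_cumulant_def by metis
  from N obtain d2 L l where N': "real_distribution N" "d2 > 0" "l 0 = m" and
    L: "\<And>h. \<bar>h\<bar> < d2 \<Longrightarrow> integrable N (\<lambda>x. exp (h * x)) \<and> (\<integral>x. exp (h * x) \<partial>N) = exp (L h) \<and>
        (L has_real_derivative l h) (at h) \<and>
        (l has_real_derivative w2 * (l h)\<^sup>2 + w1 * l h + w0) (at h)"
    unfolding quad_cumulant_def by metis
  interpret M: real_distribution M by fact
  interpret N: real_distribution N by fact
  define d where "d = min d1 d2"
  have d: "d > 0" "d \<le> d1" "d \<le> d2" using M' N' by (auto simp: d_def)
  have K0: "K 0 = 0" "L 0 = 0" using K[of 0] L[of 0] M'(2) N'(2) M.mgf_0[of "\<lambda>x. x"] N.mgf_0[of "\<lambda>x. x"] by auto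
  show ?thesis
  proof (rule measure_eq_if_mgf_eq[OF M'(1) N'(1) d(1)])
    fix h assume h: "\<bar>h\<bar> < d"
    show "integrable M (\<lambda>x. exp (h * x))" "integrable N (\<lambda>x. exp (h * x))" using K[of h] L[of h] d h by auto
    have "K h - K 0 = L h - L 0"
      by (rule quadratic_ode_unique[OF d(1), of k l K w2 w1 w0]) (use K L d h M' N' in auto)
    then show "(\<integral>x. exp (h * x) \<partial>M) = (\<integral>x. exp (h * x) \<partial>N)"
      using K[of h] L[of h] d h K0 by auto
  qed
qed

text \<open>The new cumulant function is \<open>h * B + K (A * h)\<close>; \<open>u1\<close> and
  \<open>u0\<close> come from rewriting the equation in terms of \<open>A * k + B\<close>. The
  leading coefficient is unchanged and the discriminant is multiplied by \<open>A\<^sup>2\<close>,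
  so their signs are the invariants that tell the families apart.\<close>

lemma quad_cumulant_affine:
  assumes M: "quad_cumulant M w2 w1 w0 m" and A: "A \<noteq> 0"
    and u1: "u1 = A * w1 - 2 * w2 * B" and u0: "u0 = A\<^sup>2 * w0 - A * w1 * B + w2 * B\<^sup>2"
  shows "quad_cumulant (distr M borel (\<lambda>x. A * x + B)) w2 u1 u0 (A * m + B)"
proof -
  from M obtain d K k where M': "real_distribution M" "d > 0" "k 0 = m" and
    K: "\<And>h. \<bar>h\<bar> < d \<Longrightarrow> integrable M (\<lambda>x. exp (h * x)) \<and> (\<integral>x. exp (h * x) \<partial>M) = exp (K h) \<and>
        (K has_real_derivative k h) (at h) \<and>
        (k has_real_derivative w2 * (k h)\<^sup>2 + w1 * k h + w0) (at h)"
    unfolding quad_cumulant_def by metis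
  interpret M: real_distribution M by fact
  show ?thesis unfolding quad_cumulant_def
  proof (intro conjI exI allI impI)
    show "real_distribution (distr M borel (\<lambda>x. A * x + B))" by simp
    show "d / \<bar>A\<bar> > 0" using M' A by simp
    show "(\<lambda>h. A * k (A * h) + B) 0 = A * m + B" using M' by simp
    fix h assume "\<bar>h\<bar> < d / \<bar>A\<bar>"
    then have h: "\<bar>A * h\<bar> < d" using A by (simp add: abs_mult field_simps)
    note K = K[OF h]
    have e: "exp (h * (A * x + B)) = exp (h * B) * exp (A * h * x)" for x
      by (simp add: exp_add[symmetric] algebra_simps)
    show "integrable (distr M borel (\<lambda>x. A * x + B)) (\<lambda>x. exp (h * x))"
      using K by (simp add: integrable_distr_eq e)
    show "(\<integral>x. exp (h * x) \<partial>distr M borel (\<lambda>x. A * x + B)) = exp ((\<lambda>h. h * B + K (A * h)) h)"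
      using K by (simp add: integral_distr e exp_add)
    have dA: "((\<lambda>h. A * h) has_real_derivative A) (at h)" by (auto intro!: derivative_eq_intros)
    show "((\<lambda>h. h * B + K (A * h)) has_real_derivative A * k (A * h) + B) (at h)"
      using DERIV_chain2[of K "k (A * h)" "\<lambda>h. A * h" h A] K dA
      by (auto intro!: derivative_eq_intros)
    have "((\<lambda>h. k (A * h)) has_real_derivative (w2 * (k (A * h))\<^sup>2 + w1 * k (A * h) + w0) * A) (at h)"
      using DERIV_chain2[of k _ "\<lambda>h. A * h" h A] K dA by blast
    then show "((\<lambda>h. A * k (A * h) + B) has_real_derivative
        w2 * (A * k (A * h) + B)\<^sup>2 + u1 * (A * k (A * h) + B) + u0) (at h)"
      by (auto intro!: derivative_eq_intros simp: u1 u0 algebra_simps power2_eq_square)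
  qed
qed

section \<open>Cumulants of the elementary families\<close>

lemma real_distribution_density:
  assumes [measurable]: "f \<in> borel_measurable borel" and "\<And>x. f x \<ge> 0"
    and "integrable lborel f" "(\<integral>x. f x \<partial>lborel) = 1"
  shows "real_distribution (density lborel (\<lambda>x. ennreal (f x)))"
proof -
  have "(\<integral>\<^sup>+x. ennreal (f x) \<partial>lborel) = 1"
    using assms by (subst nn_integral_eq_integral) auto
  then have "prob_space (density lborel (\<lambda>x. ennreal (f x)))"
    by (intro prob_spaceI) (simp add: emeasure_density)
  then show ?thesis by (simp add: real_distribution_def real_distribution_axioms_def)
qed

lemma quad_cumulant_density:
  fixes f :: "real \<Rightarrow> real"
  assumes f[measurable]: "f \<in> borel_measurable borel" and nn: "\<And>x. f x \<ge> 0" and \<delta>: "\<delta> > 0"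
    and int: "\<And>h. \<bar>h\<bar> < \<delta> \<Longrightarrow> has_bochner_integral lborel (\<lambda>x. f x * exp (h * x)) (exp (K h))"
    and K0: "K 0 = 0"
    and K: "\<And>h. \<bar>h\<bar> < \<delta> \<Longrightarrow> (K has_real_derivative k h) (at h)"
    and k: "\<And>h. \<bar>h\<bar> < \<delta> \<Longrightarrow> (k has_real_derivative w2 * (k h)\<^sup>2 + w1 * k h + w0) (at h)"
  shows "quad_cumulant (density lborel (\<lambda>x. ennreal (f x))) w2 w1 w0 (k 0)"
  unfolding quad_cumulant_def
proof (intro conjI exI allI impI)
  \<comment> \<open>At \<open>h = 0\<close> the hypothesis \<open>K 0 = 0\<close> turns the integral
    formula into total mass 1.\<close>
  show "real_distribution (density lborel (\<lambda>x. ennreal (f x)))"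
    using int[of 0] \<delta> K0 by (intro real_distribution_density f nn) (auto simp: has_bochner_integral_iff)
  fix h :: real assume h: "\<bar>h\<bar> < \<delta>"
  show "integrable (density lborel (\<lambda>x. ennreal (f x))) (\<lambda>x. exp (h * x))"
    using int[OF h] nn by (subst integrable_density) (auto simp: has_bochner_integral_iff)
  show "(\<integral>x. exp (h * x) \<partial>density lborel (\<lambda>x. ennreal (f x))) = exp (K h)"
    using int[OF h] nn by (subst integral_density) (auto simp: has_bochner_integral_iff)
qed (use \<delta> K k in auto)

lemma quad_cumulant_discrete:
  fixes w :: "nat \<Rightarrow> real"
  assumes nn: "\<And>n. w n \<ge> 0" and \<delta>: "\<delta> > 0"
    and sums: "\<And>h. \<bar>h\<bar> < \<delta> \<Longrightarrow> (\<lambda>n. w n * exp (h * real n)) sums exp (K h)"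
    and K0: "K 0 = 0"
    and K: "\<And>h. \<bar>h\<bar> < \<delta> \<Longrightarrow> (K has_real_derivative k h) (at h)"
    and k: "\<And>h. \<bar>h\<bar> < \<delta> \<Longrightarrow> (k has_real_derivative w2 * (k h)\<^sup>2 + w1 * k h + w0) (at h)"
  shows "quad_cumulant (distr (density (count_space UNIV) (\<lambda>n. ennreal (w n))) borel real) w2 w1 w0 (k 0)"
  unfolding quad_cumulant_def
proof (intro conjI exI allI impI)
  let ?D = "density (count_space UNIV) (\<lambda>n. ennreal (w n))"
  have m: "real \<in> measurable ?D borel" by simp
  have "(\<lambda>n. w n) sums 1" using sums[of 0] \<delta> K0 by simp
  then have "emeasure ?D (space ?D) = 1"
    using nn by (simp add: emeasure_density nn_integral_count_space_nat suminf_ennreal2 sums_iff)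
  then interpret D: prob_space ?D by (rule prob_spaceI)
  show "real_distribution (distr ?D borel real)" by (rule D.real_distribution_distr[OF m])
  fix h :: real assume h: "\<bar>h\<bar> < \<delta>"
  have I: "integrable (count_space UNIV) (\<lambda>n. w n * exp (h * real n))"
    unfolding integrable_count_space_nat_iff using sums[OF h] nn by (simp add: sums_iff)
  show "integrable (distr ?D borel real) (\<lambda>x. exp (h * x))"
    using I nn by (subst integrable_distr_eq[OF m]) (simp_all add: integrable_density)
  have "(\<integral>x. exp (h * x) \<partial>distr ?D borel real) = (\<integral>n. exp (h * real n) \<partial>?D)"
    by (rule integral_distr[OF m]) simp
  also have "\<dots> = (\<integral>n. w n * exp (h * real n) \<partial>count_space UNIV)"
    using nn by (subst integral_density) simp_all
  also have "\<dots> = exp (K h)"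
    using sums_unique2[OF sums_integral_count_space_nat[OF I] sums[OF h]] .
  finally show "(\<integral>x. exp (h * x) \<partial>distr ?D borel real) = exp (K h)" .
qed (use \<delta> K k in auto)

lemma quad_cumulant_normal: "quad_cumulant (normal_law m 1) 0 0 1 m"
proof -
  have "quad_cumulant (normal_law m 1) 0 0 1 ((\<lambda>h. m + h) 0)"
    unfolding normal_law_def
  proof (rule quad_cumulant_density[where \<delta> = 1 and K = "\<lambda>h. m * h + h\<^sup>2 / 2"])
    fix h :: real
    \<comment> \<open>Completing the square: the tilt by \<open>h\<close> is the normal density with
      mean shifted by \<open>h\<close>, times the moment generating function.\<close>
    have "normal_density m 1 x * exp (h * x) = exp (m * h + h\<^sup>2 / 2) * normal_density (m + h) 1 x" for x
      unfolding normal_density_def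
      by (simp add: exp_add[symmetric] mult.left_commute) (simp add: power2_eq_square field_simps)
    then show "has_bochner_integral lborel (\<lambda>x. normal_density m 1 x * exp (h * x)) (exp (m * h + h\<^sup>2 / 2))"
      by (simp add: has_bochner_integral_iff)
  qed (auto intro!: derivative_eq_intros)
  then show ?thesis by simp
qed

lemma quad_cumulant_poisson:
  assumes "m > 0"
  shows "quad_cumulant (poisson_law m) 0 1 0 m"
proof -
  have "poisson_law m = distr (density (count_space UNIV) (\<lambda>n. ennreal (m ^ n / fact n * exp (- m)))) borel real"
    using assms by (simp add: poisson_law_def measure_pmf_eq_density)
  moreover have "quad_cumulant \<dots> 0 1 0 ((\<lambda>h. m * exp h) 0)"
  proof (rule quad_cumulant_discrete[where \<delta> = 1 and K = "\<lambda>h. m * exp h - m"])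
    fix h :: real
    have "(\<lambda>n. exp (- m) * ((m * exp h) ^ n /\<^sub>R fact n)) sums (exp (- m) * exp (m * exp h))"
      by (intro sums_mult exp_converges)
    then show "(\<lambda>n. m ^ n / fact n * exp (- m) * exp (h * real n)) sums exp (m * exp h - m)"
      by (simp add: exp_add[symmetric] power_mult_distrib exp_of_nat_mult[symmetric] divide_inverse mult_ac)
  qed (use assms in \<open>auto intro!: derivative_eq_intros\<close>)
  ultimately show ?thesis by simp
qed

lemma quad_cumulant_binomial:
  assumes n: "n \<ge> 1" and p: "0 < p" "p < 1"
  shows "quad_cumulant (binomial_law n p) (- 1 / real n) 1 0 (real n * p)"
proof -
  have "binomial_law n p = distr (density (count_space UNIV)
      (\<lambda>k. ennreal (real (n choose k) * p ^ k * (1 - p) ^ (n - k)))) borel real"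
    using p by (simp add: binomial_law_def measure_pmf_eq_density)
  moreover have "quad_cumulant \<dots> (- 1 / real n) 1 0 ((\<lambda>h. real n * (p * exp h) / (1 - p + p * exp h)) 0)"
  proof (rule quad_cumulant_discrete[where \<delta> = 1 and K = "\<lambda>h. real n * ln (1 - p + p * exp h)"])
    fix h :: real
    have pos: "1 - p + p * exp h > 0" using p by (simp add: add_pos_pos)
    have "(\<lambda>k. real (n choose k) * p ^ k * (1 - p) ^ (n - k) * exp (h * real k)) sums
      (\<Sum>k\<le>n. real (n choose k) * p ^ k * (1 - p) ^ (n - k) * exp (h * real k))"
      by (rule sums_finite) auto
    also have "(\<Sum>k\<le>n. real (n choose k) * p ^ k * (1 - p) ^ (n - k) * exp (h * real k)) = (p * exp h + (1 - p)) ^ n"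
      unfolding binomial_ring
      by (intro sum.cong refl) (simp add: power_mult_distrib exp_of_nat_mult[symmetric] mult_ac)
    also have "\<dots> = exp (real n * ln (1 - p + p * exp h))"
      using pos by (simp add: exp_of_nat_mult add.commute)
    finally show "(\<lambda>k. real (n choose k) * p ^ k * (1 - p) ^ (n - k) * exp (h * real k)) sums
        exp (real n * ln (1 - p + p * exp h))" .
    show "((\<lambda>h. real n * ln (1 - p + p * exp h)) has_real_derivative
        real n * (p * exp h) / (1 - p + p * exp h)) (at h)"
      using pos by (auto intro!: derivative_eq_intros)
    define u where "u = p * exp h"
    define v where "v = 1 - p + u"
    have v: "v > 0" "u + (1 - p) = v" using pos by (auto simp: u_def v_def)
    have "((\<lambda>h. real n * (p * exp h) / (1 - p + p * exp h)) has_real_derivative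
        (real n * u * v - real n * u * u) / (v * v)) (at h)"
      using pos by (auto intro!: derivative_eq_intros simp: u_def v_def)
    also have "(real n * u * v - real n * u * u) / (v * v) =
        - 1 / real n * (real n * u / v)\<^sup>2 + 1 * (real n * u / v) + 0"
      using v(1) n by (simp add: field_simps power2_eq_square)
    finally show "((\<lambda>h. real n * (p * exp h) / (1 - p + p * exp h)) has_real_derivative
        - 1 / real n * (real n * (p * exp h) / (1 - p + p * exp h))\<^sup>2 +
          1 * (real n * (p * exp h) / (1 - p + p * exp h)) + 0) (at h)"
      unfolding u_def v_def .
  qed (use p in auto)
  ultimately show ?thesis by simp
qed

lemma quad_cumulant_neg_binomial:
  assumes s: "s > 0" and p: "0 < p" "p < 1"
  shows "quad_cumulant (neg_binomial_law (1 / s) p) s 1 0 ((1 - p) / (s * p))"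
proof -
  define r where "r = 1 / s"
  have r: "r > 0" "s = 1 / r" using s by (auto simp: r_def)
  have "quad_cumulant (neg_binomial_law r p) (1 / r) 1 0 ((\<lambda>h. r * ((1 - p) * exp h) / (1 - (1 - p) * exp h)) 0)"
    unfolding neg_binomial_law_def
  \<comment> \<open>The generating series converges for \<open>(1 - p) * exp h < 1\<close>, that is
    for \<open>h < - ln (1 - p)\<close>.\<close>
  proof (rule quad_cumulant_discrete[where \<delta> = "- ln (1 - p)"
        and K = "\<lambda>h. r * ln p - r * ln (1 - (1 - p) * exp h)"])
    \<comment> \<open>Upper negation turns the weights into the coefficients of the binomial series
      with exponent \<open>- r\<close>.\<close>
    have 0: "((real k + r - 1) gchoose k) = (-1) ^ k * (- r gchoose k)" for k
      using gbinomial_minus[of r k] by (simp add: add.commute)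
    show "0 \<le> ((real k + r - 1) gchoose k) * p powr r * (1 - p) ^ k" for k
    proof -
      have "((real k + r - 1) gchoose k) = pochhammer r k / fact k" by (simp add: gbinomial_pochhammer')
      then show ?thesis using r p by (simp add: pochhammer_nonneg)
    qed
    fix h :: real assume h: "\<bar>h\<bar> < - ln (1 - p)"
    have "exp h < exp (- ln (1 - p))" using h by auto
    then have lt: "(1 - p) * exp h < 1" using p by (simp add: exp_minus field_simps)
    then have pos: "1 - (1 - p) * exp h > 0" by simp
    have "(\<lambda>k. p powr r * ((- r gchoose k) * (- ((1 - p) * exp h)) ^ k)) sums
        (p powr r * (1 + - ((1 - p) * exp h)) powr (- r))"
      using lt p by (intro sums_mult gen_binomial_real) (auto simp: abs_mult)
    also have "p powr r * (1 + - ((1 - p) * exp h)) powr (- r) = exp (r * ln p - r * ln (1 - (1 - p) * exp h))"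
      using p pos by (simp add: powr_def exp_add[symmetric])
    also have "(\<lambda>k. p powr r * ((- r gchoose k) * (- ((1 - p) * exp h)) ^ k)) =
        (\<lambda>k. ((real k + r - 1) gchoose k) * p powr r * (1 - p) ^ k * exp (h * real k))"
      unfolding 0 by (rule ext)
        (simp add: power_mult_distrib exp_of_nat_mult[symmetric] power_minus[of "exp h * (1 - p)"] mult_ac)
    finally show "(\<lambda>k. ((real k + r - 1) gchoose k) * p powr r * (1 - p) ^ k * exp (h * real k)) sums
        exp (r * ln p - r * ln (1 - (1 - p) * exp h))" .
    show "((\<lambda>h. r * ln p - r * ln (1 - (1 - p) * exp h)) has_real_derivative
        r * ((1 - p) * exp h) / (1 - (1 - p) * exp h)) (at h)"
      using pos by (auto intro!: derivative_eq_intros)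
    define u where "u = (1 - p) * exp h"
    define v where "v = 1 - u"
    have v: "v > 0" "u + v = 1" using pos by (auto simp: u_def v_def)
    have "((\<lambda>h. r * ((1 - p) * exp h) / (1 - (1 - p) * exp h)) has_real_derivative
        (r * u * v + r * u * u) / (v * v)) (at h)"
      using pos by (auto intro!: derivative_eq_intros simp: u_def v_def)
    also have "(r * u * v + r * u * u) / (v * v) = 1 / r * (r * u / v)\<^sup>2 + 1 * (r * u / v) + 0"
      using v(1) r by (simp add: field_simps power2_eq_square)
    finally show "((\<lambda>h. r * ((1 - p) * exp h) / (1 - (1 - p) * exp h)) has_real_derivative
        1 / r * (r * ((1 - p) * exp h) / (1 - (1 - p) * exp h))\<^sup>2 +
          1 * (r * ((1 - p) * exp h) / (1 - (1 - p) * exp h)) + 0) (at h)"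
      unfolding u_def v_def .
  qed (use p in auto)
  then show ?thesis using r(2) by (simp add: mult.commute)
qed

lemma has_bochner_integral_gamma_kernel:
  assumes k: "k > 0" and \<beta>: "\<beta> > (0::real)"
  shows "has_bochner_integral lborel (\<lambda>x. if x > 0 then x powr (k - 1) * exp (- \<beta> * x) else 0)
     (Gamma k / \<beta> powr k)"
proof -
  let ?f = "\<lambda>t. indicator {0..} t * t powr (k - 1) / exp t"
  have "integrable lborel ?f" "(\<integral>t. ?f t \<partial>lborel) = Gamma k"
    using nn_integral_eq_integrable[of ?f lborel "Gamma k"] Gamma_conv_nn_integral_real[OF k] Gamma_real_pos[OF k]
    by auto
  then have "has_bochner_integral lborel ?f (Gamma k)" by (simp add: has_bochner_integral_iff)
  from lborel_has_bochner_integral_real_affine_iff[of \<beta> ?f "Gamma k" 0, THEN iffD1, OF _ this] \<beta>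
  have 1: "has_bochner_integral lborel (\<lambda>x. ?f (\<beta> * x)) (Gamma k / \<beta>)" by (simp add: divide_inverse_commute)
  have "has_bochner_integral lborel (\<lambda>x. ?f (\<beta> * x) / \<beta> powr (k - 1)) (Gamma k / \<beta> / \<beta> powr (k - 1))"
    by (rule has_bochner_integral_divide_zero[OF 1])
  moreover have "?f (\<beta> * x) / \<beta> powr (k - 1) = (if x > 0 then x powr (k - 1) * exp (- \<beta> * x) else 0)" for x
    using \<beta> by (cases x "0 :: real" rule: linorder_cases)
      (auto simp: powr_mult exp_minus field_simps indicator_def zero_le_mult_iff)
  moreover have "\<beta> * \<beta> powr (k - 1) = \<beta> powr k"
    using \<beta> powr_mult_base[of \<beta> "k - 1"] by simp
  ultimately show ?thesis by simp
qed

lemma quad_cumulant_gamma: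
  assumes s: "s > 0" and \<beta>: "\<beta> > 0"
  shows "quad_cumulant (gamma_law (1 / s) \<beta>) s 0 0 (1 / (s * \<beta>))"
proof -
  define k where "k = 1 / s"
  have k: "k > 0" "s = 1 / k" using s by (auto simp: k_def)
  have "quad_cumulant (gamma_law k \<beta>) (1 / k) 0 0 ((\<lambda>h. k / (\<beta> - h)) 0)"
    unfolding gamma_law_def
  proof (rule quad_cumulant_density[where \<delta> = \<beta> and K = "\<lambda>h. k * ln \<beta> - k * ln (\<beta> - h)"])
    fix h :: real assume "\<bar>h\<bar> < \<beta>"
    then have h: "\<beta> - h > 0" by auto
    have "has_bochner_integral lborel (\<lambda>x. \<beta> powr k / Gamma k * (if x > 0 then x powr (k - 1) * exp (- (\<beta> - h) * x) else 0))
       (\<beta> powr k / Gamma k * (Gamma k / (\<beta> - h) powr k))"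
      by (intro has_bochner_integral_mult_right has_bochner_integral_gamma_kernel k h)
    moreover have "\<beta> powr k / Gamma k * (Gamma k / (\<beta> - h) powr k) = exp (k * ln \<beta> - k * ln (\<beta> - h))"
      using h \<beta> Gamma_real_pos[OF k(1)] by (simp add: powr_def exp_diff)
    moreover have "\<beta> powr k / Gamma k * (if x > 0 then x powr (k - 1) * exp (- (\<beta> - h) * x) else 0) =
      (if x > 0 then \<beta> powr k / Gamma k * x powr (k - 1) * exp (- \<beta> * x) else 0) * exp (h * x)" for x
      by (simp add: exp_add[symmetric] algebra_simps)
    ultimately show "has_bochner_integral lborel (\<lambda>x. (if x > 0 then \<beta> powr k / Gamma k * x powr (k - 1) * exp (- \<beta> * x) else 0) * exp (h * x))
      (exp (k * ln \<beta> - k * ln (\<beta> - h)))" by simp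
    show "((\<lambda>h. k * ln \<beta> - k * ln (\<beta> - h)) has_real_derivative k / (\<beta> - h)) (at h)"
      using h by (auto intro!: derivative_eq_intros)
    show "((\<lambda>h. k / (\<beta> - h)) has_real_derivative 1 / k * (k / (\<beta> - h))\<^sup>2 + 0 * (k / (\<beta> - h)) + 0) (at h)"
      using h k by (auto intro!: derivative_eq_intros simp: power2_eq_square field_simps)
  qed (use \<beta> Gamma_real_pos[OF k(1)] in auto)
  then show ?thesis using k by simp
qed

section \<open>Generalized hyperbolic secant distributions\<close>

lemma Gamma_integral_log:
  fixes a :: complex
  assumes a: "Re a > 0"
  shows "has_bochner_integral lborel (\<lambda>s. exp (a * of_real s - of_real (exp s))) (Gamma a)"
proof -
  let ?f = "\<lambda>t. complex_of_real t powr (a - 1) / of_real (exp t)"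
  let ?g = "\<lambda>s. exp (a * of_real s - complex_of_real (exp s))"
  \<comment> \<open>The substitution \<open>t = exp s\<close> puts Euler's integral on the whole
    line, where multiplying \<open>t\<close> by a constant becomes a translation of
    \<open>s\<close>.\<close>
  have eq: "\<bar>exp s\<bar> *\<^sub>R ?f (exp s) = ?g s" for s :: real
  proof -
    have "complex_of_real (exp s) powr (a - 1) = exp ((a - 1) * of_real s)"
      by (simp add: powr_def exp_of_real[symmetric] Ln_of_real)
    then show ?thesis
      by (simp add: scaleR_conv_of_real exp_of_real[symmetric] exp_diff exp_add left_diff_distrib)
  qed
  have "integral {0<..} ?f = Gamma a" using Gamma_integral_complex'[OF a] by (rule integral_unique)
  moreover have "?f absolutely_integrable_on {0<..}" by (rule absolutely_integrable_Gamma_integral'[OF a])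
  moreover have "range exp = {0::real<..}" by (auto simp: image_iff) (metis exp_ln)
  ultimately have "(\<lambda>s. \<bar>exp s\<bar> *\<^sub>R ?f (exp s)) absolutely_integrable_on UNIV \<and>
      integral UNIV (\<lambda>s. \<bar>exp s\<bar> *\<^sub>R ?f (exp s)) = Gamma a"
    by (subst has_absolute_integral_change_of_variables_real) (auto intro!: derivative_eq_intros simp: inj_on_def)
  then have g: "?g absolutely_integrable_on UNIV" "integral UNIV ?g = Gamma a" unfolding eq by auto
  have "?g \<in> borel_measurable lborel"
    by simp
  then have "integrable lborel ?g"
    using g(1) by (simp add: set_integrable_def integrable_completion)
  then show ?thesis
    using integral_lborel[of ?g] g(2) by (simp add: has_bochner_integral_iff)
qed

lemma Gamma_integral_log_real:
  fixes a c :: real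
  assumes a: "a > 0" and c: "c > 0"
  shows "has_bochner_integral lborel (\<lambda>s. exp (a * s - c * exp s)) (Gamma a / c powr a)"
proof -
  have "has_bochner_integral lborel (\<lambda>s. Re (exp (of_real a * of_real s - of_real (exp s)))) (Re (Gamma (of_real a)))"
    using Gamma_integral_log[of "of_real a"] a by (intro has_bochner_integral_Re) simp
  moreover have "Re (exp (of_real a * of_real s - of_real (exp s))) = exp (a * s - exp s)" for s
    by (simp add: Re_exp)
  ultimately have 1: "has_bochner_integral lborel (\<lambda>s. exp (a * s - exp s)) (Gamma a)"
    by (simp add: Gamma_complex_of_real)
  from 1 have "has_bochner_integral lborel (\<lambda>s. exp (a * (ln c + 1 * s) - exp (ln c + 1 * s))) (Gamma a /\<^sub>R \<bar>1\<bar>)"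
    by (subst (asm) lborel_has_bochner_integral_real_affine_iff[of 1 _ _ "ln c"]) simp_all
  then have "has_bochner_integral lborel (\<lambda>s. exp (a * (ln c + s) - exp (ln c + s)) / c powr a) (Gamma a / c powr a)"
    by (intro has_bochner_integral_divide_zero) simp
  moreover have "exp (a * (ln c + s) - exp (ln c + s)) / c powr a = exp (a * s - c * exp s)" for s
    using c by (simp add: powr_def exp_diff[symmetric] exp_add distrib_left)
  ultimately show ?thesis by simp
qed

text \<open>Integrand of the Beta integral with both parameters \<open>r / 2\<close> after the logit
  substitution; at \<open>y = 2 * v\<close> it is a power of the hyperbolic secant.\<close>

definition logistic_kernel :: "real \<Rightarrow> real \<Rightarrow> real" where
  "logistic_kernel r y = exp (r / 2 * y) / (1 + exp y) powr r"

text \<open>The Beta integral for the conjugate pair \<open>a\<close>, \<open>cnj a\<close>, whose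
  sum is the real number \<open>r\<close>: the product of two Gamma integrals is a double integral,
  and integrating in the other order leaves a Gamma integral with exponent \<open>r\<close>.\<close>

lemma Gamma_mult_cnj_integral:
  fixes x r :: real
  assumes r: "r > 0"
  defines "a \<equiv> Complex (r / 2) (x / 2)"
  shows "integrable lborel (logistic_kernel r)"
    and "of_real ((cmod (Gamma a))\<^sup>2) = of_real (Gamma r) * (\<integral>y. exp (\<i> * of_real (x / 2 * y)) * of_real (logistic_kernel r y) \<partial>lborel)"
proof -
  let ?b = "cnj a"
  have Re: "Re a = r / 2" "Re ?b = r / 2" and ab: "a + ?b = of_real r" by (auto simp: a_def complex_eq_iff)
  \<comment> \<open>The product of the two integrands, with \<open>t\<close> as variable of the
    factor for \<open>cnj a\<close> and \<open>t + y\<close> as variable of the factor for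
    \<open>a\<close>.\<close>
  define F where "F = (\<lambda>t y. exp (a * of_real y + of_real (r * t - (1 + exp y) * exp t)))"
  have Fm: "case_prod F \<in> borel_measurable (lborel \<Otimes>\<^sub>M lborel)"
    unfolding F_def by (simp add: lborel_prod, intro borel_measurable_continuous_onI) (auto simp: case_prod_beta intro!: continuous_intros)
  have Fn: "norm (F t y) = exp (r / 2 * y + (r * t - (1 + exp y) * exp t))" for t y
    by (simp add: F_def Re)
  have Ft: "has_bochner_integral lborel (F t) (exp (?b * of_real t - of_real (exp t)) * Gamma a)" for t
  proof -
    have "has_bochner_integral lborel (\<lambda>y. exp (a * of_real (t + 1 * y) - of_real (exp (t + 1 * y)))) (Gamma a /\<^sub>R \<bar>1\<bar>)"
      using Re r by (intro lborel_has_bochner_integral_real_affine_iff[THEN iffD1] Gamma_integral_log) auto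
    then have "has_bochner_integral lborel (\<lambda>y. exp (?b * of_real t - of_real (exp t)) * exp (a * of_real (t + y) - of_real (exp (t + y))))
      (exp (?b * of_real t - of_real (exp t)) * Gamma a)"
      by (intro has_bochner_integral_mult_right) simp
    moreover have "exp (?b * of_real t - of_real (exp t)) * exp (a * of_real (t + y) - of_real (exp (t + y))) = F t y" for y
    proof -
      have "(?b * of_real t - of_real (exp t)) + (a * of_real (t + y) - of_real (exp (t + y))) =
         a * of_real y + ((a + ?b) * of_real t - of_real ((1 + exp y) * exp t))"
        by (simp add: algebra_simps exp_add)
      then show ?thesis unfolding F_def exp_add[symmetric] by (simp add: ab)
    qed
    ultimately show ?thesis by (simp add: F_def)
  qed
  \<comment> \<open>Taking norms replaces \<open>a\<close> and \<open>cnj a\<close> by the real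
    number \<open>r / 2\<close>, so absolute integrability is the same computation with real
    exponents.\<close>
  have Fnt: "has_bochner_integral lborel (\<lambda>y. norm (F t y)) (exp (r / 2 * t - exp t) * Gamma (r / 2))" for t
  proof -
    have "has_bochner_integral lborel (\<lambda>y. exp (r / 2 * (t + 1 * y) - 1 * exp (t + 1 * y))) (Gamma (r / 2) / 1 powr (r / 2) /\<^sub>R \<bar>1\<bar>)"
      using r by (intro lborel_has_bochner_integral_real_affine_iff[THEN iffD1] Gamma_integral_log_real) auto
    then have "has_bochner_integral lborel (\<lambda>y. exp (r / 2 * t - exp t) * exp (r / 2 * (t + y) - exp (t + y)))
      (exp (r / 2 * t - exp t) * Gamma (r / 2))"
      by (intro has_bochner_integral_mult_right) simp
    moreover have "exp (r / 2 * t - exp t) * exp (r / 2 * (t + y) - exp (t + y)) = norm (F t y)" for y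
      unfolding Fn exp_add[symmetric] by (simp add: field_simps exp_add)
    ultimately show ?thesis by simp
  qed
  have int: "integrable (lborel \<Otimes>\<^sub>M lborel) (case_prod F)"
  proof (rule lborel_pair.Fubini_integrable[OF Fm])
    show "integrable lborel (\<lambda>x. \<integral>y. norm (case (x, y) of (x, y) \<Rightarrow> F x y) \<partial>lborel)"
      using Gamma_integral_log_real[of "r / 2" 1] r Fnt by (simp add: has_bochner_integral_iff)
    show "AE x in lborel. integrable lborel (\<lambda>y. case (x, y) of (x, y) \<Rightarrow> F x y)"
      using Ft by (simp add: has_bochner_integral_iff)
  qed
  have Fy: "(\<integral>t. F t y \<partial>lborel) = of_real (Gamma r) * (exp (\<i> * of_real (x / 2 * y)) * of_real (logistic_kernel r y))" for y
  proof -
    have c: "1 + exp y > 0" by (simp add: add_pos_pos)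
    have "(\<integral>t. F t y \<partial>lborel) = (\<integral>t. exp (a * of_real y) * of_real (exp (r * t - (1 + exp y) * exp t)) \<partial>lborel)"
      by (simp only: F_def exp_add exp_of_real)
    also have "\<dots> = exp (a * of_real y) * of_real (Gamma r / (1 + exp y) powr r)"
      using Gamma_integral_log_real[OF r c]
      by (simp only: integral_mult_right_zero integral_complex_of_real has_bochner_integral_iff)
    also have "exp (a * of_real y) = exp (\<i> * of_real (x / 2 * y)) * of_real (exp (r / 2 * y))"
      unfolding exp_of_real[symmetric] exp_add[symmetric] by (rule arg_cong[of _ _ exp]) (simp add: a_def complex_eq_iff)
    finally show ?thesis by (simp add: logistic_kernel_def)
  qed
  have Gr: "Gamma r > 0" using r by simp
  \<comment> \<open>Fubini delivers integrability of the kernel as well: the oscillating factor of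
    the inner integral has modulus 1.\<close>
  have "integrable lborel (\<lambda>y. \<integral>t. F t y \<partial>lborel)" by (rule lborel_pair.integrable_snd[OF int])
  then have "integrable lborel (\<lambda>y. norm (of_real (Gamma r) * (exp (\<i> * of_real (x / 2 * y)) * of_real (logistic_kernel r y))))"
    unfolding Fy by (rule integrable_norm)
  then have "integrable lborel (\<lambda>y. Gamma r * logistic_kernel r y)"
    using Gr by (simp only: norm_mult norm_exp_i_times norm_of_real) (simp add: logistic_kernel_def)
  then show "integrable lborel (logistic_kernel r)" using Gr by simp
  have "of_real ((cmod (Gamma a))\<^sup>2) = Gamma ?b * Gamma a"
    unfolding complex_norm_square cnj_Gamma by (rule mult.commute)
  also have "Gamma ?b * Gamma a = (\<integral>t. exp (?b * of_real t - of_real (exp t)) * Gamma a \<partial>lborel)"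
    using Gamma_integral_log[of ?b] Re r by (simp add: has_bochner_integral_iff)
  also have "\<dots> = (\<integral>t. (\<integral>y. F t y \<partial>lborel) \<partial>lborel)"
    using Ft by (simp add: has_bochner_integral_iff)
  also have "\<dots> = (\<integral>y. (\<integral>t. F t y \<partial>lborel) \<partial>lborel)"
    by (rule lborel_pair.Fubini_integral[OF int, symmetric])
  also have "\<dots> = of_real (Gamma r) * (\<integral>y. exp (\<i> * of_real (x / 2 * y)) * of_real (logistic_kernel r y) \<partial>lborel)"
    unfolding Fy by simp
  finally show "of_real ((cmod (Gamma a))\<^sup>2) = of_real (Gamma r) * (\<integral>y. exp (\<i> * of_real (x / 2 * y)) * of_real (logistic_kernel r y) \<partial>lborel)" .
qed

section \<open>Exponential decay of Gamma on vertical lines\<close>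

lemma cmod_pochhammer_ratio_mono:
  fixes u v t :: real
  assumes "0 < u" "u \<le> v"
  shows "cmod (pochhammer (Complex v t) n) * cmod (pochhammer (of_real u) n) \<le>
         cmod (pochhammer (Complex u t) n) * cmod (pochhammer (of_real v) n)"
proof -
  \<comment> \<open>Each factor separately: for fixed \<open>t\<close>, the quotient
    \<open>sqrt (b\<^sup>2 + t\<^sup>2) / b\<close> decreases in \<open>b\<close>.\<close>
  have f: "cmod (Complex v t + of_nat i) * cmod (of_real u + of_nat i) \<le> cmod (Complex u t + of_nat i) * cmod (of_real v + of_nat i)" for i
  proof -
    define a b where "a = u + real i" and "b = v + real i"
    have ab: "0 < a" "a \<le> b" using assms by (auto simp: a_def b_def)
    have "a\<^sup>2 * t\<^sup>2 \<le> b\<^sup>2 * t\<^sup>2" using ab by (intro mult_right_mono power_mono) auto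
    then have "(b\<^sup>2 + t\<^sup>2) * a\<^sup>2 \<le> (a\<^sup>2 + t\<^sup>2) * b\<^sup>2" by (simp add: algebra_simps)
    then have "sqrt (b\<^sup>2 + t\<^sup>2) * a \<le> sqrt (a\<^sup>2 + t\<^sup>2) * b"
      using ab real_sqrt_le_mono[of "(b\<^sup>2 + t\<^sup>2) * a\<^sup>2" "(a\<^sup>2 + t\<^sup>2) * b\<^sup>2"] by (simp add: real_sqrt_mult)
    moreover have "cmod (Complex v t + of_nat i) = sqrt (b\<^sup>2 + t\<^sup>2)" "cmod (Complex u t + of_nat i) = sqrt (a\<^sup>2 + t\<^sup>2)"
      by (simp_all add: a_def b_def cmod_def)
    moreover have "cmod (of_real u + of_nat i) = a" "cmod (of_real v + of_nat i) = b"
      using assms norm_of_real[of "u + real i", where 'a = complex] norm_of_real[of "v + real i", where 'a = complex]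
      by (simp_all add: a_def b_def)
    ultimately show ?thesis by simp
  qed
  show ?thesis
    unfolding pochhammer_prod prod_norm[symmetric] prod.distrib[symmetric]
    by (intro prod_mono conjI f) auto
qed

text \<open>Passing to the limit in \<open>Gamma_series\<close> reduces this to Pochhammer symbols.
  It serves to carry decay from integer real parts to arbitrary smaller ones.\<close>

lemma cmod_Gamma_ratio_mono:
  fixes u v t :: real
  assumes uv: "0 < u" "u \<le> v"
  shows "cmod (Gamma (Complex u t)) * Gamma v \<le> cmod (Gamma (Complex v t)) * Gamma u"
proof -
  have "cmod (Gamma (Complex u t)) * cmod (Gamma (of_real v)) \<le> cmod (Gamma (Complex v t)) * cmod (Gamma (of_real u))"
  proof (rule LIMSEQ_le)
    show "(\<lambda>n. cmod (Gamma_series (Complex u t) n) * cmod (Gamma_series (of_real v) n)) \<longlonglongrightarrow>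
        cmod (Gamma (Complex u t)) * cmod (Gamma (of_real v))"
      "(\<lambda>n. cmod (Gamma_series (Complex v t) n) * cmod (Gamma_series (of_real u) n)) \<longlonglongrightarrow>
        cmod (Gamma (Complex v t)) * cmod (Gamma (of_real u))"
      by (intro tendsto_intros)+
    show "\<exists>N. \<forall>n\<ge>N. cmod (Gamma_series (Complex u t) n) * cmod (Gamma_series (of_real v) n) \<le>
        cmod (Gamma_series (Complex v t) n) * cmod (Gamma_series (of_real u) n)"
    proof (intro exI allI impI)
      fix n
      \<comment> \<open>On both sides the exponents of \<open>n\<close> add up to
        \<open>u + v\<close>, so the numerators agree and only the Pochhammer symbols
        differ.\<close>
      define E where "E = (fact n)\<^sup>2 * exp ((u + v) * ln (real n))"
      define P where "P = (\<lambda>z::complex. cmod (pochhammer z (n + 1)))"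
      have e: "cmod (Gamma_series w n) * cmod (Gamma_series z n) = E / (P w * P z)" if "Re w + Re z = u + v" for w z
      proof -
        have "cmod (Gamma_series w n) * cmod (Gamma_series z n) =
            (fact n)\<^sup>2 * (exp (Re w * ln (real n)) * exp (Re z * ln (real n))) / (P w * P z)"
          by (simp add: Gamma_series_def norm_mult norm_divide P_def power2_eq_square norm_power)
        then show ?thesis unfolding exp_add[symmetric] distrib_right[symmetric] that E_def .
      qed
      have pos: "P w > 0" if "Re w > 0" for w
      proof -
        have "w \<noteq> - of_nat k" for k using that by auto
        then show ?thesis by (auto simp: P_def pochhammer_eq_0_iff)
      qed
      have "P (Complex v t) * P (of_real u) \<le> P (Complex u t) * P (of_real v)"
        unfolding P_def by (rule cmod_pochhammer_ratio_mono[OF uv])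
      then have "E / (P (Complex u t) * P (of_real v)) \<le> E / (P (Complex v t) * P (of_real u))"
        using uv pos[of "Complex v t"] pos[of "of_real u"] pos[of "Complex u t"] pos[of "of_real v"]
        by (intro divide_left_mono mult_pos_pos) (auto simp: E_def)
      then show "cmod (Gamma_series (Complex u t) n) * cmod (Gamma_series (of_real v) n) \<le>
          cmod (Gamma_series (Complex v t) n) * cmod (Gamma_series (of_real u) n)"
        by (simp add: e)
    qed
  qed
  then show ?thesis using uv by (simp add: Gamma_complex_of_real)
qed

text \<open>By the reflection formula the left side is \<open>pi * t / sinh (pi * t)\<close> for
  nonzero \<open>t\<close>; this is where the rate \<open>pi\<close> comes from.\<close>

lemma cmod_Gamma_1_bound:
  fixes t :: real
  shows "(cmod (Gamma (Complex 1 t)))\<^sup>2 \<le> 2 * pi * (1 + \<bar>t\<bar>) * exp (- pi * \<bar>t\<bar>)"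
proof (cases "t = 0")
  case True
  have "Complex 1 0 = 1" by (simp add: complex_eq_iff)
  then show ?thesis using True pi_gt3 by simp
next
  case False
  define w where "w = \<i> * of_real t"
  have z: "Complex 1 t = w + 1" "cnj (Complex 1 t) = 1 - w" by (auto simp: w_def complex_eq_iff)
  have wn: "w \<notin> \<int>\<^sub>\<le>\<^sub>0" using False by (auto simp: w_def complex_eq_iff elim!: nonpos_Ints_cases)
  have s: "sin (of_real pi * w) = \<i> * of_real (sinh (pi * t))"
  proof -
    have "sin (of_real pi * w) = sin (\<i> * of_real (pi * t))" by (simp add: w_def mult_ac)
    also have "\<dots> = \<i> * ((exp (of_real (pi * t)) - inverse (exp (of_real (pi * t)))) / 2)" by (rule sin_i_times)
    also have "\<dots> = \<i> * of_real (sinh (pi * t))" by (simp only: exp_of_real sinh_field_def exp_minus of_real_diff of_real_divide of_real_inverse) simp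
    finally show ?thesis .
  qed
  have "of_real ((cmod (Gamma (Complex 1 t)))\<^sup>2) = Gamma (Complex 1 t) * Gamma (cnj (Complex 1 t))"
    unfolding complex_norm_square cnj_Gamma ..
  also have "\<dots> = Gamma (w + 1) * Gamma (1 - w)" by (simp only: z(2)) (simp only: z(1))
  also have "\<dots> = w * (Gamma w * Gamma (1 - w))" using wn by (simp add: Gamma_plus1)
  also have "\<dots> = w * (of_real pi / sin (of_real pi * w))" unfolding Gamma_reflection_complex ..
  also have "\<dots> = of_real (pi * t / sinh (pi * t))" unfolding s by (simp add: w_def)
  finally have eq: "(cmod (Gamma (Complex 1 t)))\<^sup>2 = pi * t / sinh (pi * t)" by (simp only: of_real_eq_iff)
  also have "\<dots> = pi * \<bar>t\<bar> / sinh (pi * \<bar>t\<bar>)" by (cases "t \<ge> 0") auto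
  also have "\<dots> \<le> 2 * pi * (1 + \<bar>t\<bar>) * exp (- pi * \<bar>t\<bar>)"
  proof -
    define x where "x = pi * \<bar>t\<bar>"
    have x: "x > 0" using False by (simp add: x_def)
    \<comment> \<open>Multiplied by \<open>exp (- x)\<close>, this rearranges to the bound of
      \<open>x / sinh x\<close> by \<open>(1 + 2 * x) * exp (- x)\<close>.\<close>
    have "1 + 2 * x \<le> exp (2 * x)" by (rule exp_ge_add_one_self)
    then have "2 * x * exp x \<le> (1 + 2 * x) * (exp x - exp (- x))"
    proof -
      assume "1 + 2 * x \<le> exp (2 * x)"
      then have "(1 + 2 * x) * exp (- x) \<le> exp (2 * x) * exp (- x)" by (rule mult_right_mono) simp
      also have "\<dots> = exp x" by (simp add: exp_add[symmetric])
      finally show ?thesis by (simp add: algebra_simps)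
    qed
    then have "x / sinh x \<le> (1 + 2 * x) * exp (- x)"
      using x by (simp add: sinh_field_def exp_minus field_simps)
    also have "\<dots> \<le> (2 * pi * (1 + \<bar>t\<bar>)) * exp (- x)"
      using pi_gt3 by (intro mult_right_mono) (auto simp: x_def algebra_simps)
    finally show ?thesis by (simp add: x_def)
  qed
  finally show ?thesis .
qed

lemma cmod_Gamma_nat_bound:
  "\<exists>C m. C \<ge> 0 \<and> (\<forall>t. (cmod (Gamma (Complex (real (Suc k)) t)))\<^sup>2 \<le> C * (1 + \<bar>t\<bar>) ^ m * exp (- pi * \<bar>t\<bar>))"
proof (induction k)
  case 0
  show ?case using cmod_Gamma_1_bound by (intro exI[of _ "2 * pi"] exI[of _ "1::nat"]) auto
next
  case (Suc k)
  then obtain C m where C: "C \<ge> 0" "\<And>t. (cmod (Gamma (Complex (real (Suc k)) t)))\<^sup>2 \<le> C * (1 + \<bar>t\<bar>) ^ m * exp (- pi * \<bar>t\<bar>)"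
    by blast
  show ?case
  proof (intro exI[of _ "(real (Suc k))\<^sup>2 * C"] exI[of _ "m + 2"] conjI allI)
    fix t :: real
    let ?z = "Complex (real (Suc k)) t"
    \<comment> \<open>One application of the functional equation costs two powers of
      \<open>1 + \<bar>t\<bar>\<close>, since the squared modulus of \<open>?z\<close> is quadratic
      in \<open>t\<close>.\<close>
    have "Complex (real (Suc (Suc k))) t = ?z + 1" by (simp add: complex_eq_iff)
    moreover have "?z \<notin> \<int>\<^sub>\<le>\<^sub>0" by (auto simp: complex_eq_iff elim!: nonpos_Ints_cases)
    ultimately have "(cmod (Gamma (Complex (real (Suc (Suc k))) t)))\<^sup>2 = (cmod ?z)\<^sup>2 * (cmod (Gamma ?z))\<^sup>2"
      by (simp add: Gamma_plus1 norm_mult power_mult_distrib)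
    also have "\<dots> \<le> ((real (Suc k))\<^sup>2 * (1 + \<bar>t\<bar>)\<^sup>2) * (C * (1 + \<bar>t\<bar>) ^ m * exp (- pi * \<bar>t\<bar>))"
    proof (rule mult_mono)
      have "1 * t\<^sup>2 \<le> (real (Suc k))\<^sup>2 * t\<^sup>2" by (intro mult_right_mono) auto
      then have "1 * t\<^sup>2 + 0 \<le> (real (Suc k))\<^sup>2 * t\<^sup>2 + (real (Suc k))\<^sup>2 * (2 * \<bar>t\<bar>)"
        by (rule add_mono) simp
      then show "(cmod ?z)\<^sup>2 \<le> (real (Suc k))\<^sup>2 * (1 + \<bar>t\<bar>)\<^sup>2"
        unfolding cmod_power2 by (simp add: power2_sum distrib_left del: of_nat_Suc)
    qed (use C in auto)
    finally show "(cmod (Gamma (Complex (real (Suc (Suc k))) t)))\<^sup>2 \<le>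
        (real (Suc k))\<^sup>2 * C * (1 + \<bar>t\<bar>) ^ (m + 2) * exp (- pi * \<bar>t\<bar>)"
      by (simp only: power_add mult_ac)
  qed (use C in auto)
qed

text \<open>The gap between \<open>\<eta>\<close> and \<open>pi\<close> absorbs the polynomial
  factor that integer real parts leave behind.\<close>

lemma cmod_Gamma_exponential_decay:
  fixes \<sigma> :: real
  assumes \<sigma>: "\<sigma> > 0" and \<eta>: "\<eta> < pi"
  shows "\<exists>C. \<forall>t. (cmod (Gamma (Complex \<sigma> t)))\<^sup>2 \<le> C * exp (- \<eta> * \<bar>t\<bar>)"
proof -
  obtain k where "\<sigma> \<le> real k" using real_arch_simple by blast
  then have k: "\<sigma> \<le> real (Suc k)" by simp
  obtain C m where C: "C \<ge> 0" "\<And>t. (cmod (Gamma (Complex (real (Suc k)) t)))\<^sup>2 \<le> C * (1 + \<bar>t\<bar>) ^ m * exp (- pi * \<bar>t\<bar>)"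
    using cmod_Gamma_nat_bound by metis
  define \<epsilon> where "\<epsilon> = pi - \<eta>"
  have \<epsilon>: "\<epsilon> > 0" using \<eta> by (simp add: \<epsilon>_def)
  define R where "R = Gamma \<sigma> / Gamma (real (Suc k))"
  have G: "Gamma (real (Suc k)) > 0" "Gamma \<sigma> > 0" using \<sigma> by auto
  have R: "R \<ge> 0" using G by (simp add: R_def)
  show ?thesis
  proof (intro exI allI)
    fix t :: real
    have "cmod (Gamma (Complex \<sigma> t)) \<le> R * cmod (Gamma (Complex (real (Suc k)) t))"
      using cmod_Gamma_ratio_mono[OF \<sigma> k, of t] G by (simp add: R_def field_simps)
    then have "(cmod (Gamma (Complex \<sigma> t)))\<^sup>2 \<le> (R * cmod (Gamma (Complex (real (Suc k)) t)))\<^sup>2"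
      by (intro power_mono) auto
    also have "\<dots> \<le> R\<^sup>2 * (C * (1 + \<bar>t\<bar>) ^ m * exp (- pi * \<bar>t\<bar>))"
      unfolding power_mult_distrib by (intro mult_left_mono C) auto
    also have "\<dots> \<le> R\<^sup>2 * (C * (fact m / \<epsilon> ^ m * exp (\<epsilon> * (1 + \<bar>t\<bar>))) * exp (- pi * \<bar>t\<bar>))"
      using C \<epsilon> by (intro mult_left_mono mult_right_mono power_le_exp) auto
    also have "\<dots> = R\<^sup>2 * C * (fact m / \<epsilon> ^ m) * (exp (\<epsilon> * (1 + \<bar>t\<bar>)) * exp (- pi * \<bar>t\<bar>))" by (simp only: mult_ac)
    also have "exp (\<epsilon> * (1 + \<bar>t\<bar>)) * exp (- pi * \<bar>t\<bar>) = exp \<epsilon> * exp (- \<eta> * \<bar>t\<bar>)"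
      unfolding exp_add[symmetric] by (simp add: \<epsilon>_def algebra_simps)
    finally show "(cmod (Gamma (Complex \<sigma> t)))\<^sup>2 \<le> (R\<^sup>2 * C * (fact m / \<epsilon> ^ m) * exp \<epsilon>) * exp (- \<eta> * \<bar>t\<bar>)"
      by (simp only: mult_ac)
  qed
qed

section \<open>Gaussian integrals and Fourier inversion\<close>

lemma integral_cis_gaussian:
  fixes \<sigma> w :: real
  assumes \<sigma>: "\<sigma> > 0"
  shows "has_bochner_integral lborel (\<lambda>x. exp (\<i> * of_real (x * w)) * of_real (exp (- (\<sigma> * x)\<^sup>2 / 2)))
    (of_real (sqrt (2 * pi) / \<sigma> * exp (- (w / \<sigma>)\<^sup>2 / 2)))"
proof -
  have I: "integrable lborel (\<lambda>x. exp (\<i> * of_real (x * (w / \<sigma>))) * of_real (std_normal_density x))"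
  proof (rule Bochner_Integration.integrable_bound)
    show "integrable lborel std_normal_density" by simp
  qed (auto simp: norm_mult)
  have "char std_normal_distribution (w / \<sigma>) = (\<integral>x. std_normal_density x *\<^sub>R exp (\<i> * of_real (w / \<sigma> * x)) \<partial>lborel)"
    unfolding char_def by (subst integral_density) auto
  then have "(\<integral>x. exp (\<i> * of_real (x * (w / \<sigma>))) * of_real (std_normal_density x) \<partial>lborel) = of_real (exp (- (w / \<sigma>)\<^sup>2 / 2))"
    unfolding char_std_normal_distribution by (simp add: scaleR_conv_of_real mult_ac)
  with I have "has_bochner_integral lborel (\<lambda>x. exp (\<i> * of_real (x * (w / \<sigma>))) * of_real (std_normal_density x)) (of_real (exp (- (w / \<sigma>)\<^sup>2 / 2)))"
    by (simp add: has_bochner_integral_iff)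
  then have "has_bochner_integral lborel (\<lambda>x. exp (\<i> * of_real ((0 + \<sigma> * x) * (w / \<sigma>))) * of_real (std_normal_density (0 + \<sigma> * x)))
     (of_real (exp (- (w / \<sigma>)\<^sup>2 / 2)) /\<^sub>R \<bar>\<sigma>\<bar>)"
    using \<sigma> by (subst (asm) lborel_has_bochner_integral_real_affine_iff[of \<sigma> _ _ 0]) simp_all
  from has_bochner_integral_mult_right[OF this, of "of_real (sqrt (2 * pi))"]
  have "has_bochner_integral lborel (\<lambda>x. of_real (sqrt (2 * pi)) * (exp (\<i> * of_real ((0 + \<sigma> * x) * (w / \<sigma>))) * of_real (std_normal_density (0 + \<sigma> * x))))
     (of_real (sqrt (2 * pi)) * (of_real (exp (- (w / \<sigma>)\<^sup>2 / 2)) /\<^sub>R \<bar>\<sigma>\<bar>))" by simp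
  moreover have "of_real (sqrt (2 * pi)) * (exp (\<i> * of_real ((0 + \<sigma> * x) * (w / \<sigma>))) * of_real (std_normal_density (0 + \<sigma> * x))) =
     exp (\<i> * of_real (x * w)) * of_real (exp (- (\<sigma> * x)\<^sup>2 / 2))" for x
    using \<sigma> by (simp add: std_normal_density_def field_simps)
  moreover have "complex_of_real (sqrt (2 * pi)) * (of_real (exp (- (w / \<sigma>)\<^sup>2 / 2)) /\<^sub>R \<bar>\<sigma>\<bar>) =
     of_real (sqrt (2 * pi) / \<sigma> * exp (- (w / \<sigma>)\<^sup>2 / 2))"
    using \<sigma> by (simp only: scaleR_conv_of_real of_real_mult[symmetric] of_real_eq_iff) (simp add: field_simps)
  ultimately show ?thesis by (simp only:)
qed

text \<open>Gaussian regularisation: both sides are limits of the integral with the extra factor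
  \<open>exp (- (\<sigma> * x)\<^sup>2 / 2)\<close>.\<close>

lemma fourier_inversion:
  fixes Q :: "real \<Rightarrow> real" and \<phi> :: "real \<Rightarrow> complex"
  assumes Q: "continuous_on UNIV Q" "\<And>x. \<bar>Q x\<bar> \<le> B" "integrable lborel Q"
    and \<phi>: "\<And>x. \<phi> x = (\<integral>v. exp (\<i> * of_real (x * v)) * of_real (Q v) \<partial>lborel)"
    and I: "integrable lborel \<phi>"
  shows "(\<integral>x. \<phi> x * exp (- \<i> * of_real (x * u)) \<partial>lborel) = of_real (2 * pi * Q u)"
proof -
  have Qm[measurable]: "Q \<in> borel_measurable borel" using Q(1) by (rule borel_measurable_continuous_onI)
  have \<phi>m[measurable]: "\<phi> \<in> borel_measurable borel" using I by simp
  define \<sigma> where "\<sigma> n = 1 / real (Suc n)" for n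
  have \<sigma>: "\<sigma> n > 0" for n by (simp add: \<sigma>_def)
  have \<sigma>0: "\<sigma> \<longlonglongrightarrow> 0" unfolding \<sigma>_def by (rule LIMSEQ_Suc) (rule lim_1_over_n)
  define J where "J n = (\<integral>x. \<phi> x * exp (- \<i> * of_real (x * u)) * of_real (exp (- (\<sigma> n * x)\<^sup>2 / 2)) \<partial>lborel)" for n
  have L1: "J \<longlonglongrightarrow> (\<integral>x. \<phi> x * exp (- \<i> * of_real (x * u)) * of_real (exp (- (0 * x)\<^sup>2 / 2)) \<partial>lborel)"
    unfolding J_def
  proof (rule integral_dominated_convergence[where w = "\<lambda>x. norm (\<phi> x)"])
    show "AE x in lborel. (\<lambda>n. \<phi> x * exp (- \<i> * of_real (x * u)) * of_real (exp (- (\<sigma> n * x)\<^sup>2 / 2))) \<longlonglongrightarrow>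
        \<phi> x * exp (- \<i> * of_real (x * u)) * of_real (exp (- (0 * x)\<^sup>2 / 2))"
      by (intro AE_I2 tendsto_intros \<sigma>0) auto
    show "AE x in lborel. norm (\<phi> x * exp (- \<i> * of_real (x * u)) * of_real (exp (- (\<sigma> n * x)\<^sup>2 / 2))) \<le> norm (\<phi> x)" for n
      by (intro AE_I2) (simp add: norm_mult mult_left_le)
  qed (use I in auto)
  have J: "J n = of_real (sqrt (2 * pi)) * (\<integral>y. of_real (Q (u + \<sigma> n * y) * exp (- y\<^sup>2 / 2)) \<partial>lborel)" for n
  proof -
    define F where "F = (\<lambda>x v. exp (\<i> * of_real (x * (v - u))) * of_real (Q v) * complex_of_real (exp (- (\<sigma> n * x)\<^sup>2 / 2)))"
    have G: "has_bochner_integral lborel (\<lambda>x. exp (- (\<sigma> n * x)\<^sup>2 / 2)) (sqrt (2 * pi) / \<sigma> n)"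
    proof -
      have "has_bochner_integral lborel (\<lambda>x. Re (of_real (exp (- (\<sigma> n * x)\<^sup>2 / 2)))) (Re (of_real (sqrt (2 * pi) / \<sigma> n)))"
        using integral_cis_gaussian[OF \<sigma>[of n], of 0] by (intro has_bochner_integral_Re) simp
      then show ?thesis by simp
    qed
    have Fm: "case_prod F \<in> borel_measurable (lborel \<Otimes>\<^sub>M lborel)"
      unfolding F_def by measurable
    have Fn: "norm (F x v) = exp (- (\<sigma> n * x)\<^sup>2 / 2) * \<bar>Q v\<bar>" for x v
      by (simp add: F_def norm_mult)
    have int: "integrable (lborel \<Otimes>\<^sub>M lborel) (case_prod F)"
    proof (rule lborel_pair.Fubini_integrable[OF Fm])
      show "integrable lborel (\<lambda>x. \<integral>v. norm (case (x, v) of (x, v) \<Rightarrow> F x v) \<partial>lborel)"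
        using G by (simp add: Fn has_bochner_integral_iff)
      show "AE x in lborel. integrable lborel (\<lambda>v. case (x, v) of (x, v) \<Rightarrow> F x v)"
      proof (rule AE_I2)
        fix x
        have "integrable lborel (\<lambda>v. norm (F x v))" unfolding Fn using Q(3) by simp
        moreover have "F x \<in> borel_measurable lborel" unfolding F_def by measurable
        ultimately show "integrable lborel (\<lambda>v. case (x, v) of (x, v) \<Rightarrow> F x v)"
          by (simp add: integrable_norm_iff)
      qed
    qed
    have "J n = (\<integral>x. (\<integral>v. F x v \<partial>lborel) \<partial>lborel)"
      unfolding J_def
    proof (intro Bochner_Integration.integral_cong refl)
      fix x
      have "(\<integral>v. F x v \<partial>lborel) = (\<integral>v. (exp (- \<i> * of_real (x * u)) * of_real (exp (- (\<sigma> n * x)\<^sup>2 / 2))) *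
          (exp (\<i> * of_real (x * v)) * of_real (Q v)) \<partial>lborel)"
      proof (intro Bochner_Integration.integral_cong refl)
        fix v
        have "exp (\<i> * of_real (x * (v - u))) = exp (- \<i> * of_real (x * u)) * exp (\<i> * of_real (x * v))"
          unfolding exp_add[symmetric] by (simp add: algebra_simps)
        then show "F x v = (exp (- \<i> * of_real (x * u)) * of_real (exp (- (\<sigma> n * x)\<^sup>2 / 2))) *
          (exp (\<i> * of_real (x * v)) * of_real (Q v))"
          unfolding F_def by (simp only: mult_ac)
      qed
      also have "\<dots> = (exp (- \<i> * of_real (x * u)) * of_real (exp (- (\<sigma> n * x)\<^sup>2 / 2))) * \<phi> x"
        unfolding \<phi> by (rule integral_mult_right_zero)
      finally show "\<phi> x * exp (- \<i> * of_real (x * u)) * of_real (exp (- (\<sigma> n * x)\<^sup>2 / 2)) = (\<integral>v. F x v \<partial>lborel)"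
        by (simp only: mult_ac)
    qed
    also have "\<dots> = (\<integral>v. (\<integral>x. F x v \<partial>lborel) \<partial>lborel)"
      by (rule lborel_pair.Fubini_integral[OF int, symmetric])
    \<comment> \<open>The inner integral is a Gaussian bump of width \<open>\<sigma> n\<close> at
      \<open>u\<close>; the substitution \<open>v = u + \<sigma> n * y\<close> then moves the
      dependence on \<open>n\<close> into the argument of \<open>Q\<close>.\<close>
    also have "\<dots> = (\<integral>v. of_real (Q v * (sqrt (2 * pi) / \<sigma> n * exp (- ((v - u) / \<sigma> n)\<^sup>2 / 2))) \<partial>lborel)"
    proof (intro Bochner_Integration.integral_cong refl)
      fix v
      have "(\<integral>x. F x v \<partial>lborel) = (\<integral>x. of_real (Q v) * (exp (\<i> * of_real (x * (v - u))) * complex_of_real (exp (- (\<sigma> n * x)\<^sup>2 / 2))) \<partial>lborel)"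
        unfolding F_def by (simp only: mult_ac)
      also have "\<dots> = of_real (Q v) * of_real (sqrt (2 * pi) / \<sigma> n * exp (- ((v - u) / \<sigma> n)\<^sup>2 / 2))"
        using integral_cis_gaussian[OF \<sigma>[of n], of "v - u"]
        by (subst integral_mult_right_zero) (simp only: has_bochner_integral_iff)
      finally show "(\<integral>x. F x v \<partial>lborel) = of_real (Q v * (sqrt (2 * pi) / \<sigma> n * exp (- ((v - u) / \<sigma> n)\<^sup>2 / 2)))" by simp
    qed
    also have "\<dots> = \<bar>\<sigma> n\<bar> *\<^sub>R (\<integral>y. of_real (Q (u + \<sigma> n * y) * (sqrt (2 * pi) / \<sigma> n * exp (- ((u + \<sigma> n * y - u) / \<sigma> n)\<^sup>2 / 2))) \<partial>lborel)"
      using \<sigma>[of n] by (subst lborel_integral_real_affine[of "\<sigma> n" _ u]) simp_all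
    also have "\<dots> = (\<integral>y. of_real (sqrt (2 * pi)) * of_real (Q (u + \<sigma> n * y) * exp (- y\<^sup>2 / 2)) \<partial>lborel)"
      unfolding scaleR_conv_of_real integral_mult_right_zero[symmetric]
      using \<sigma>[of n] by (intro Bochner_Integration.integral_cong refl) (simp add: field_simps)
    also have "\<dots> = of_real (sqrt (2 * pi)) * (\<integral>y. of_real (Q (u + \<sigma> n * y) * exp (- y\<^sup>2 / 2)) \<partial>lborel)"
      by (rule integral_mult_right_zero)
    finally show ?thesis .
  qed
  have G1: "has_bochner_integral lborel (\<lambda>x. complex_of_real (exp (- x\<^sup>2 / 2))) (of_real (sqrt (2 * pi)))"
    using integral_cis_gaussian[of 1 0] by simp
  have "(\<lambda>n. \<integral>y. complex_of_real (Q (u + \<sigma> n * y) * exp (- y\<^sup>2 / 2)) \<partial>lborel) \<longlonglongrightarrow>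
      (\<integral>y. complex_of_real (Q u * exp (- y\<^sup>2 / 2)) \<partial>lborel)"
  proof (rule integral_dominated_convergence[where w = "\<lambda>y. B * exp (- y\<^sup>2 / 2)"])
    have "integrable lborel (\<lambda>x. norm (complex_of_real (exp (- x\<^sup>2 / 2))))"
      using G1 by (intro integrable_norm) (simp only: has_bochner_integral_iff)
    then show "integrable lborel (\<lambda>y. B * exp (- y\<^sup>2 / 2))" by simp
    show "AE y in lborel. (\<lambda>n. complex_of_real (Q (u + \<sigma> n * y) * exp (- y\<^sup>2 / 2))) \<longlonglongrightarrow> complex_of_real (Q u * exp (- y\<^sup>2 / 2))"
    proof (rule AE_I2)
      fix y
      have "(\<lambda>n. u + \<sigma> n * y) \<longlonglongrightarrow> u + 0 * y" by (intro tendsto_intros \<sigma>0)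
      then have lim: "(\<lambda>n. u + \<sigma> n * y) \<longlonglongrightarrow> u" by simp
      have "isCont Q u" using Q(1) by (simp add: continuous_on_eq_continuous_at)
      from isCont_tendsto_compose[OF this lim] have "(\<lambda>n. Q (u + \<sigma> n * y)) \<longlonglongrightarrow> Q u" .
      then show "(\<lambda>n. complex_of_real (Q (u + \<sigma> n * y) * exp (- y\<^sup>2 / 2))) \<longlonglongrightarrow> complex_of_real (Q u * exp (- y\<^sup>2 / 2))"
        by (intro tendsto_intros)
    qed
    show "AE y in lborel. norm (complex_of_real (Q (u + \<sigma> n * y) * exp (- y\<^sup>2 / 2))) \<le> B * exp (- y\<^sup>2 / 2)" for n
      using Q(2) by (intro AE_I2) (simp add: norm_mult mult_right_mono)
  qed measurable
  moreover have "(\<integral>y. complex_of_real (Q u * exp (- y\<^sup>2 / 2)) \<partial>lborel) = of_real (Q u * sqrt (2 * pi))"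
    using G1 by (simp add: has_bochner_integral_iff)
  ultimately have "(\<lambda>n. \<integral>y. complex_of_real (Q (u + \<sigma> n * y) * exp (- y\<^sup>2 / 2)) \<partial>lborel) \<longlonglongrightarrow>
      of_real (Q u * sqrt (2 * pi))" by (simp only:)
  then have "J \<longlonglongrightarrow> of_real (sqrt (2 * pi)) * of_real (Q u * sqrt (2 * pi))"
    unfolding J by (rule tendsto_mult[OF tendsto_const])
  from LIMSEQ_unique[OF this L1] show ?thesis
    by (simp add: power2_eq_square mult_ac flip: of_real_mult)
qed

section \<open>Fourier and Laplace transforms of the Gamma weight\<close>

lemma integrable_exp_neg_abs:
  assumes c: "c > (0::real)"
  shows "integrable lborel (\<lambda>x. exp (- c * \<bar>x\<bar>))"
proof -
  let ?f = "\<lambda>x. if x > 0 then x powr (1 - 1) * exp (- c * x) else 0"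
  have 1: "integrable lborel ?f"
    using has_bochner_integral_gamma_kernel[of 1 c] c by (simp add: has_bochner_integral_iff)
  have 2: "integrable lborel (\<lambda>x. ?f (0 + (-1) * x))" by (rule lborel_integrable_real_affine[OF 1]) simp
  show ?thesis
  proof (rule Bochner_Integration.integrable_bound[OF Bochner_Integration.integrable_add[OF 1 2]])
    \<comment> \<open>The two one-sided functions both vanish at 0, so the bound fails exactly
      there.\<close>
    show "AE x in lborel. norm (exp (- c * \<bar>x\<bar>)) \<le> norm (?f x + ?f (0 + (-1) * x))"
      using AE_lborel_singleton[of "0::real"] by eventually_elim auto
  qed simp
qed

text \<open>The part of \<open>ghs_density\<close> that carries neither \<open>\<theta>\<close> nor
  the normalisation; the factor with \<open>\<theta>\<close> then only shifts the Laplace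
  variable.\<close>

definition ghs_weight :: "real \<Rightarrow> real \<Rightarrow> real" where
  "ghs_weight r x = (cmod (Gamma (Complex (r / 2) (x / 2))))\<^sup>2"

lemma ghs_weight_measurable [measurable]:
  assumes "r > 0"
  shows "ghs_weight r \<in> borel_measurable borel"
  unfolding ghs_weight_def
proof -
  have "Complex (r / 2) (x / 2) \<notin> \<int>\<^sub>\<le>\<^sub>0" for x
    using assms by (auto simp: complex_eq_iff elim!: nonpos_Ints_cases)
  moreover have "continuous_on UNIV (\<lambda>x. Complex (r / 2) (x / 2))"
    unfolding Complex_eq by (intro continuous_intros) auto
  ultimately have "continuous_on UNIV (\<lambda>x. Gamma (Complex (r / 2) (x / 2)))"
    by (intro continuous_on_compose2[OF continuous_on_Gamma[of "range (\<lambda>x. Complex (r / 2) (x / 2))"]]) auto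
  then have "continuous_on UNIV (\<lambda>x. (cmod (Gamma (Complex (r / 2) (x / 2))))\<^sup>2)"
    by (intro continuous_intros)
  then show "(\<lambda>x. (cmod (Gamma (Complex (r / 2) (x / 2))))\<^sup>2) \<in> borel_measurable borel"
    by (rule borel_measurable_continuous_onI)
qed

lemma integrable_exp_ghs_weight:
  assumes r: "r > 0" and h: "\<bar>h\<bar> < pi / 2"
  shows "integrable lborel (\<lambda>x. exp (h * x) * ghs_weight r x)"
proof -
  \<comment> \<open>Midway between \<open>2 * \<bar>h\<bar>\<close> and \<open>pi\<close>: Gamma is
    evaluated at \<open>x / 2\<close>, so decay at rate \<open>\<eta>\<close> in its argument is
    decay at rate \<open>\<eta> / 2\<close> in \<open>x\<close>, which has to beat
    \<open>\<bar>h\<bar>\<close>.\<close>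
  define \<eta> where "\<eta> = \<bar>h\<bar> + pi / 2"
  have \<eta>: "\<eta> < pi" "2 * \<bar>h\<bar> < \<eta>" using h by (auto simp: \<eta>_def)
  obtain C where C: "\<And>t. (cmod (Gamma (Complex (r / 2) t)))\<^sup>2 \<le> C * exp (- \<eta> * \<bar>t\<bar>)"
    using cmod_Gamma_exponential_decay[of "r / 2" \<eta>] r \<eta> by auto
  have "integrable lborel (\<lambda>x. C * exp (- (\<eta> / 2 - \<bar>h\<bar>) * \<bar>x\<bar>))"
    using \<eta> by (intro integrable_mult_right integrable_exp_neg_abs) auto
  then show ?thesis
  proof (rule Bochner_Integration.integrable_bound)
    show "AE x in lborel. norm (exp (h * x) * ghs_weight r x) \<le> norm (C * exp (- (\<eta> / 2 - \<bar>h\<bar>) * \<bar>x\<bar>))"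
    proof (rule AE_I2)
      fix x :: real
      have "h * x \<le> \<bar>h\<bar> * \<bar>x\<bar>" by (metis abs_ge_self abs_mult)
      then have "exp (h * x) * ghs_weight r x \<le> exp (\<bar>h\<bar> * \<bar>x\<bar>) * (C * exp (- \<eta> * \<bar>x / 2\<bar>))"
        unfolding ghs_weight_def by (intro mult_mono C) auto
      also have "\<dots> = C * exp (- (\<eta> / 2 - \<bar>h\<bar>) * \<bar>x\<bar>)"
        by (simp add: mult.left_commute[of _ C] exp_add[symmetric] algebra_simps)
      finally show "norm (exp (h * x) * ghs_weight r x) \<le> norm (C * exp (- (\<eta> / 2 - \<bar>h\<bar>) * \<bar>x\<bar>))"
        by (simp add: ghs_weight_def)
    qed
  qed (use r in measurable)
qed

lemma logistic_kernel_double: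
  "logistic_kernel r (2 * v) = (2 * cosh v) powr (- r)"
proof -
  have "exp (2 * v) = exp v * exp v" by (simp add: exp_add[symmetric])
  then have "2 * cosh v = (1 + exp (2 * v)) / exp v"
    by (simp only:) (simp add: cosh_field_def exp_minus field_simps)
  then have "(2 * cosh v) powr (- r) = (1 + exp (2 * v)) powr (- r) / exp v powr (- r)"
    by (simp add: powr_divide add_nonneg_nonneg)
  also have "exp v powr (- r) = exp (- (r * v))" by (simp add: powr_def)
  finally show ?thesis by (simp add: logistic_kernel_def powr_minus exp_minus field_simps)
qed

lemma ghs_weight_fourier:
  assumes r: "r > 0"
  shows "(\<integral>x. of_real (ghs_weight r x) * exp (- \<i> * of_real (x * u)) \<partial>lborel) =
    complex_of_real (4 * pi * Gamma r * (2 * cosh u) powr (- r))"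
proof -
  \<comment> \<open>Substituting \<open>y = 2 * v\<close> in the Beta representation shows the
    weight as the Fourier transform of this function; the factor 2 is the Jacobian.\<close>
  define Q where "Q = (\<lambda>v. 2 * Gamma r * (2 * cosh v) powr (- r))"
  have ch: "2 * cosh v \<ge> 1" for v :: real using cosh_real_ge_1[of v] by linarith
  have Gr: "Gamma r > 0" using r by simp
  have I: "integrable lborel (logistic_kernel r)" by (rule Gamma_mult_cnj_integral(1)[OF r])
  have "(\<integral>x. of_real (ghs_weight r x) * exp (- \<i> * of_real (x * u)) \<partial>lborel) = complex_of_real (2 * pi * Q u)"
  proof (rule fourier_inversion[where B = "2 * Gamma r"])
    have "cosh v \<noteq> 0" for v :: real using ch[of v] by auto
    then show "continuous_on UNIV Q" unfolding Q_def by (intro continuous_intros) auto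
    show "\<bar>Q v\<bar> \<le> 2 * Gamma r" for v
      using ch[of v] Gr powr_mono2'[OF _ _ ch[of v], of "- r"] r by (simp add: Q_def abs_mult)
    have "integrable lborel (\<lambda>v. logistic_kernel r (0 + 2 * v))"
      by (rule lborel_integrable_real_affine[OF I]) simp
    then show "integrable lborel Q" unfolding Q_def by (simp add: logistic_kernel_double)
    have "integrable lborel (\<lambda>x. exp (0 * x) * ghs_weight r x)" by (rule integrable_exp_ghs_weight[OF r]) simp
    then show "integrable lborel (\<lambda>x. complex_of_real (ghs_weight r x))" by simp
    fix x
    have "complex_of_real (ghs_weight r x) = of_real (Gamma r) * (\<integral>y. exp (\<i> * of_real (x / 2 * y)) * of_real (logistic_kernel r y) \<partial>lborel)"
      unfolding ghs_weight_def by (rule Gamma_mult_cnj_integral(2)[OF r])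
    also have "(\<integral>y. exp (\<i> * of_real (x / 2 * y)) * complex_of_real (logistic_kernel r y) \<partial>lborel) =
        2 * (\<integral>v. exp (\<i> * of_real (x * v)) * of_real ((2 * cosh v) powr (- r)) \<partial>lborel)"
      by (subst lborel_integral_real_affine[of 2 _ 0]) (simp_all add: logistic_kernel_double scaleR_conv_of_real)
    also have "of_real (Gamma r) * \<dots> = (\<integral>v. exp (\<i> * of_real (x * v)) * of_real (Q v) \<partial>lborel)"
      unfolding integral_mult_right_zero[symmetric] mult.assoc[symmetric]
      by (intro Bochner_Integration.integral_cong refl) (simp add: Q_def)
    finally show "complex_of_real (ghs_weight r x) = (\<integral>v. exp (\<i> * of_real (x * v)) * of_real (Q v) \<partial>lborel)" .
  qed
  then show ?thesis by (simp add: Q_def mult_ac)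
qed

text \<open>The two sides are holomorphic on the strip and agree on the imaginary axis.\<close>

lemma ghs_weight_laplace:
  assumes r: "r > 0" and h: "\<bar>h\<bar> < pi / 2"
  shows "(\<integral>x. exp (h * x) * ghs_weight r x \<partial>lborel) = 4 * pi * Gamma r * (2 * cos h) powr (- r)"
proof -
  note [measurable] = ghs_weight_measurable[OF r]
  define M where "M = density lborel (\<lambda>x. ennreal (ghs_weight r x))"
  have nn: "ghs_weight r x \<ge> 0" for x by (simp add: ghs_weight_def)
  let ?S = "{z. - (pi / 2) < Re z \<and> Re z < pi / 2}"
  define F where "F = (\<lambda>z::complex. (\<integral>x. exp (z * of_real x) \<partial>M) - of_real (4 * pi * Gamma r) * (2 * cos z) powr (- of_real r))"
  have int: "integrable M (\<lambda>x. exp (g * x))" if "- (pi / 2) < g" "g < pi / 2" for g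
    unfolding M_def using integrable_exp_ghs_weight[OF r, of g] that nn
    by (subst integrable_density) (auto simp: mult.commute abs_less_iff)
  have Xm: "(\<lambda>x. x) \<in> borel_measurable M" by (simp add: M_def)
  \<comment> \<open>Keeps \<open>2 * cos z\<close> off the branch cut, so that the complex power is
    holomorphic on the whole strip.\<close>
  have cosR: "Re (cos z) > 0" if "z \<in> ?S" for z
    unfolding Re_cos using that by (intro divide_pos_pos mult_pos_pos cos_gt_zero_pi add_pos_pos) auto
  have hol: "F holomorphic_on ?S"
    unfolding F_def
  proof (intro holomorphic_intros laplace_holomorphic_on_strip[OF Xm] int)
    fix z assume "z \<in> ?S"
    with cosR[of z] show "2 * cos z \<notin> \<real>\<^sub>\<le>\<^sub>0" by (auto simp: complex_nonpos_Reals_iff)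
  qed auto
  have "F (of_real h) = 0"
  proof (rule analytic_continuation[OF hol open_strip connected_strip, of "(\<lambda>u. \<i> * of_real u) ` UNIV" 0])
    show "range (\<lambda>u. \<i> * complex_of_real u) \<subseteq> ?S" by auto
    show "0 islimpt range (\<lambda>u. \<i> * complex_of_real u)"
    proof (rule islimptI)
      fix T :: "complex set" assume T: "0 \<in> T" "open T"
      then obtain e where e: "e > 0" "ball 0 e \<subseteq> T" by (auto simp: open_contains_ball)
      have "\<i> * of_real (e / 2) \<in> ball (0::complex) e" using e by (simp add: norm_mult)
      then show "\<exists>y\<in>range (\<lambda>u. \<i> * complex_of_real u). y \<in> T \<and> y \<noteq> 0"
        using e by (intro bexI[of _ "\<i> * of_real (e / 2)"] rangeI conjI) auto
    qed
    show "F z = 0" if zr: "z \<in> range (\<lambda>u. \<i> * complex_of_real u)" for z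
    proof -
      obtain u where z: "z = \<i> * of_real u" using zr by blast
      \<comment> \<open>On the imaginary axis the transform is the Fourier integral at
        \<open>- u\<close>, and the hyperbolic cosine is even.\<close>
      have "(\<integral>x. exp (z * of_real x) \<partial>M) = (\<integral>x. of_real (ghs_weight r x) * exp (- \<i> * of_real (x * (- u))) \<partial>lborel)"
        unfolding M_def using nn by (subst integral_density) (auto simp: z scaleR_conv_of_real mult_ac)
      also have "\<dots> = of_real (4 * pi * Gamma r * (2 * cosh u) powr (- r))"
        unfolding ghs_weight_fourier[OF r] by simp
      also have "\<dots> = of_real (4 * pi * Gamma r) * (2 * cos z) powr (- of_real r)"
      proof -
        have "2 * cos z = of_real (2 * cosh u)"
          unfolding z cosh_conv_cos[symmetric]
          by (simp add: cosh_field_def of_real_exp exp_minus)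
        moreover have "2 * cosh u \<ge> 0" using cosh_real_pos[of u] by simp
        ultimately show ?thesis using powr_of_real[of "2 * cosh u" "- r"] by (simp only: of_real_mult of_real_minus)
      qed
      finally show ?thesis by (simp add: F_def)
    qed
  qed (use h in auto)
  then have e1: "(\<integral>x. exp (of_real h * complex_of_real x) \<partial>M) = of_real (4 * pi * Gamma r) * (2 * cos (of_real h)) powr (- of_real r)"
    by (simp add: F_def)
  have e2: "(\<integral>x. exp (of_real h * complex_of_real x) \<partial>M) = of_real (\<integral>x. exp (h * x) * ghs_weight r x \<partial>lborel)"
  proof -
    have "(\<integral>x. exp (of_real h * complex_of_real x) \<partial>M) = (\<integral>x. complex_of_real (exp (h * x)) \<partial>M)"
      by (simp add: exp_of_real[symmetric])
    also have "\<dots> = of_real (\<integral>x. exp (h * x) \<partial>M)" by (rule integral_complex_of_real)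
    also have "(\<integral>x. exp (h * x) \<partial>M) = (\<integral>x. exp (h * x) * ghs_weight r x \<partial>lborel)"
      unfolding M_def using nn by (subst integral_density) (auto simp: mult.commute)
    finally show ?thesis .
  qed
  have e3: "of_real (4 * pi * Gamma r) * (2 * cos (of_real h)) powr (- of_real r) =
      complex_of_real (4 * pi * Gamma r * (2 * cos h) powr (- r))"
  proof -
    have "2 * cos h \<ge> 0" using h by (intro mult_nonneg_nonneg cos_ge_zero) auto
    then show ?thesis using powr_of_real[of "2 * cos h" "- r"]
      by (simp only: of_real_mult of_real_minus cos_of_real[symmetric] of_real_numeral)
  qed
  from e1[unfolded e2 e3] show ?thesis by (simp only: of_real_eq_iff)
qed

lemma quad_cumulant_ghs:
  assumes r: "r > 0" and \<theta>: "- pi / 2 < \<theta>" "\<theta> < pi / 2"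
  shows "quad_cumulant (ghs_law r \<theta>) (1 / r) 0 r (r * tan \<theta>)"
proof -
  note [measurable] = ghs_weight_measurable[OF r]
  \<comment> \<open>Distance from \<open>\<theta>\<close> to the ends of the admissible interval, so
    that \<open>\<theta> + h\<close> stays inside it.\<close>
  define \<delta> where "\<delta> = min (pi / 2 - \<theta>) (pi / 2 + \<theta>)"
  have "quad_cumulant (ghs_law r \<theta>) (1 / r) 0 r ((\<lambda>h. r * tan (\<theta> + h)) 0)"
    unfolding ghs_law_def
  proof (rule quad_cumulant_density[where \<delta> = \<delta> and K = "\<lambda>h. r * ln (cos \<theta>) - r * ln (cos (\<theta> + h))"])
    define c where "c = 2 powr (r - 2) / (pi * Gamma r)"
    have Gr: "Gamma r > 0" using r by simp
    have f: "ghs_density r \<theta> x = exp (r * ln (cos \<theta>)) * c * (exp (\<theta> * x) * ghs_weight r x)" for x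
      by (simp add: ghs_density_def c_def ghs_weight_def exp_add)
    show "ghs_density r \<theta> \<in> borel_measurable borel" unfolding f by measurable
    show "ghs_density r \<theta> x \<ge> 0" for x using Gr by (simp add: f c_def ghs_weight_def)
    show "\<delta> > 0" using \<theta> by (auto simp: \<delta>_def)
    fix h :: real assume h: "\<bar>h\<bar> < \<delta>"
    then have "\<bar>h\<bar> < pi / 2 - \<theta>" "\<bar>h\<bar> < pi / 2 + \<theta>" by (auto simp: \<delta>_def)
    then have h': "\<bar>\<theta> + h\<bar> < pi / 2" unfolding abs_less_iff by (elim conjE, intro conjI; linarith)
    then have "- (pi / 2) < \<theta> + h" "\<theta> + h < pi / 2" unfolding abs_less_iff by linarith+
    then have cos: "cos (\<theta> + h) > 0" by (rule cos_gt_zero_pi)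
    \<comment> \<open>The constant \<open>c\<close> of the density cancels the prefactor of the
      Laplace transform: the powers of 2 have exponents \<open>r - 2\<close>, \<open>2\<close> and
      \<open>- r\<close>.\<close>
    have cc: "c * (4 * pi * Gamma r * (2 * cos (\<theta> + h)) powr (- r)) = exp (- (r * ln (cos (\<theta> + h))))"
    proof -
      have "c * (4 * pi * Gamma r * (2 * cos (\<theta> + h)) powr (- r)) =
          (2 powr (r - 2) * 2 powr 2 * 2 powr (- r)) * cos (\<theta> + h) powr (- r)"
        using cos Gr by (simp add: c_def powr_mult)
      also have "2 powr (r - 2) * 2 powr 2 * 2 powr (- r) = (1::real)" by (simp only: powr_add[symmetric]) simp
      finally show ?thesis using cos by (simp add: powr_def)
    qed
    have e: "ghs_density r \<theta> x * exp (h * x) = exp (r * ln (cos \<theta>)) * c * (exp ((\<theta> + h) * x) * ghs_weight r x)" for x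
      by (simp add: f exp_add distrib_right distrib_left mult_ac)
    have "has_bochner_integral lborel (\<lambda>x. ghs_density r \<theta> x * exp (h * x))
       (exp (r * ln (cos \<theta>)) * c * (4 * pi * Gamma r * (2 * cos (\<theta> + h)) powr (- r)))"
      unfolding e using integrable_exp_ghs_weight[OF r h'] ghs_weight_laplace[OF r h']
      by (intro has_bochner_integral_mult_right) (simp add: has_bochner_integral_iff)
    moreover have "exp (r * ln (cos \<theta>)) * c * (4 * pi * Gamma r * (2 * cos (\<theta> + h)) powr (- r)) =
        exp (r * ln (cos \<theta>) - r * ln (cos (\<theta> + h)))"
      unfolding mult.assoc[of "exp _" c] cc exp_add[symmetric] by simp
    ultimately show "has_bochner_integral lborel (\<lambda>x. ghs_density r \<theta> x * exp (h * x)) (exp (r * ln (cos \<theta>) - r * ln (cos (\<theta> + h))))"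
      by (simp only:)
    show "((\<lambda>h. r * ln (cos \<theta>) - r * ln (cos (\<theta> + h))) has_real_derivative r * tan (\<theta> + h)) (at h)"
      using cos by (auto intro!: derivative_eq_intros simp: tan_def field_simps)
    have "((\<lambda>h. r * tan (\<theta> + h)) has_real_derivative r * inverse ((cos (\<theta> + h))\<^sup>2)) (at h)"
      using cos by (auto intro!: derivative_eq_intros)
    also have "r * inverse ((cos (\<theta> + h))\<^sup>2) = 1 / r * (r * tan (\<theta> + h))\<^sup>2 + 0 * (r * tan (\<theta> + h)) + r"
    proof -
      have "inverse ((cos (\<theta> + h))\<^sup>2) = 1 + (tan (\<theta> + h))\<^sup>2" using cos tan_sec[of "\<theta> + h"] by (simp add: power_inverse)
      then show ?thesis using r by (simp only:) (simp add: power_mult_distrib power2_eq_square field_simps)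
    qed
    finally show "((\<lambda>h. r * tan (\<theta> + h)) has_real_derivative
        1 / r * (r * tan (\<theta> + h))\<^sup>2 + 0 * (r * tan (\<theta> + h)) + r) (at h)" .
  qed simp
  then show ?thesis by simp
qed

text \<open>For \<open>r = 1 / s\<close> the leading coefficient is already \<open>s\<close>, and
  scaling by \<open>sqrt s\<close> turns the constant coefficient \<open>1 / s\<close> into
  1.\<close>

lemma quad_cumulant_scaled_ghs:
  assumes s: "s > 0" and \<theta>: "- pi / 2 < \<theta>" "\<theta> < pi / 2"
  shows "quad_cumulant (distr (ghs_law (1 / s) \<theta>) borel (\<lambda>x. sqrt s * x)) s 0 1 (tan \<theta> / sqrt s)"
proof -
  have "quad_cumulant (distr (ghs_law (1 / s) \<theta>) borel (\<lambda>x. sqrt s * x + 0)) s 0 1 (sqrt s * (1 / s * tan \<theta>) + 0)"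
    using s quad_cumulant_ghs[of "1 / s" \<theta>] \<theta>
    by (intro quad_cumulant_affine[where ?w1.0 = 0 and ?w0.0 = "1 / s"]) auto
  moreover have "sqrt s * (1 / s * tan \<theta>) = tan \<theta> / sqrt s"
    using s by (simp add: field_simps)
  ultimately show ?thesis by simp
qed

section \<open>Integrality of the binomial exponent\<close>

text \<open>The witness is the \<open>n\<close>-fold forward difference at 0, built up one order at
  a time.\<close>

lemma power_sums_vanish_below:
  "\<exists>a::nat \<Rightarrow> real. (\<forall>m<n. (\<Sum>i\<le>n. a i * real i ^ m) = 0) \<and> (\<Sum>i\<le>n. a i * real i ^ n) \<noteq> 0"
proof (induction n)
  case 0
  show ?case by (rule exI[of _ "\<lambda>_. 1"]) simp
next
  case (Suc n)
  then obtain a where a: "\<And>m. m < n \<Longrightarrow> (\<Sum>i\<le>n. a i * real i ^ m) = 0" "(\<Sum>i\<le>n. a i * real i ^ n) \<noteq> 0"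
    by blast
  \<comment> \<open>Summation by parts: pairing \<open>a'\<close> with a function \<open>g\<close>
    is pairing \<open>a\<close> with \<open>g (i + 1) - g i\<close>, which lowers the degree of a
    power by one.\<close>
  define a' where "a' = (\<lambda>i. (if i = 0 then 0 else a (i - 1)) - (if i \<le> n then a i else 0))"
  have S: "(\<Sum>i\<le>Suc n. a' i * real i ^ m) = (\<Sum>l<m. real (m choose l) * (\<Sum>i\<le>n. a i * real i ^ l))" for m
  proof -
    have "(\<Sum>i\<le>Suc n. a' i * real i ^ m) =
        (\<Sum>i\<le>Suc n. (if i = 0 then 0 else a (i - 1)) * real i ^ m) - (\<Sum>i\<le>Suc n. (if i \<le> n then a i else 0) * real i ^ m)"
      by (simp only: a'_def left_diff_distrib sum_subtractf)
    also have "(\<Sum>i\<le>Suc n. (if i = 0 then 0 else a (i - 1)) * real i ^ m) = (\<Sum>i\<le>n. a i * real (Suc i) ^ m)"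
      by (subst sum.atMost_Suc_shift) simp
    also have "(\<Sum>i\<le>Suc n. (if i \<le> n then a i else 0) * real i ^ m) = (\<Sum>i\<le>n. a i * real i ^ m)"
      by simp
    also have "(\<Sum>i\<le>n. a i * real (Suc i) ^ m) - (\<Sum>i\<le>n. a i * real i ^ m) =
        (\<Sum>i\<le>n. a i * (\<Sum>l<m. real (m choose l) * real i ^ l))"
      using binomial_ring[of "real _" 1 m]
      by (simp add: sum_subtractf[symmetric] lessThan_Suc_atMost[symmetric] right_diff_distrib[symmetric] del: sum.lessThan_Suc)
         (simp add: add.commute)
    also have "\<dots> = (\<Sum>l<m. real (m choose l) * (\<Sum>i\<le>n. a i * real i ^ l))"
      by (simp add: sum_distrib_left sum.swap[of _ "{..n}"] mult_ac)
    finally show ?thesis .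
  qed
  show ?case
  proof (intro exI[of _ a'] conjI allI impI)
    show "(\<Sum>i\<le>Suc n. a' i * real i ^ m) = 0" if "m < Suc n" for m
      unfolding S using that a(1) by (intro sum.neutral) auto
    have "(\<Sum>l<Suc n. real (Suc n choose l) * (\<Sum>i\<le>n. a i * real i ^ l)) = real (Suc n) * (\<Sum>i\<le>n. a i * real i ^ n)"
      using a(1) by (simp add: sum.lessThan_Suc)
    then show "(\<Sum>i\<le>Suc n. a' i * real i ^ Suc n) \<noteq> 0" unfolding S using a(2) by simp
  qed
qed

text \<open>If \<open>\<kappa>\<close> lay strictly between \<open>j\<close> and
  \<open>j + 1\<close>, the coefficient of order \<open>j + 2\<close> would have exactly one
  negative factor, \<open>\<kappa> - (j + 1)\<close>.\<close>

lemma gchoose_nonneg_imp_nat: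
  fixes \<kappa> :: real
  assumes "\<kappa> > 0" and nonneg: "\<And>n. (\<kappa> gchoose n) \<ge> 0"
  shows "\<exists>n::nat. \<kappa> = real n"
proof (rule ccontr)
  assume non: "\<not> (\<exists>n::nat. \<kappa> = real n)"
  define j where "j = nat \<lfloor>\<kappa>\<rfloor>"
  have "real j = of_int \<lfloor>\<kappa>\<rfloor>" using assms(1) by (simp add: j_def)
  then have "real j \<le> \<kappa>" "\<kappa> < real j + 1" by linarith+
  moreover have "\<kappa> \<noteq> real j" using non by blast
  ultimately have j: "real j < \<kappa>" "\<kappa> < real j + 1" by auto
  have "(\<Prod>i<Suc j. \<kappa> - real i) > 0" using j(1) by (intro prod_pos) auto
  then have "(\<Prod>i<Suc (Suc j). \<kappa> - real i) < 0"
    using j(2) by (simp add: mult_less_0_iff)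
  then have "(\<kappa> gchoose Suc (Suc j)) < 0"
    unfolding gbinomial_prod_rev atLeast0LessThan by (simp add: divide_less_0_iff del: prod.lessThan_Suc)
  with nonneg[of "Suc (Suc j)"] show False by simp
qed

text \<open>Tilting a law with this moment generating function by \<open>h t = ln ((1 + q * t) / (1 - p * t))\<close> gives
  densities with inner products \<open>(1 + p * q * s * t) powr \<kappa>\<close>; positivity of the norm of a finite
  difference of order \<open>n\<close> in \<open>t\<close> isolates the binomial coefficient \<open>\<kappa> gchoose n\<close>.\<close>

lemma binomial_mgf_exponent_nat:
  fixes M :: "real measure"
  assumes M: "real_distribution M" and \<kappa>: "\<kappa> > 0" and p: "0 < p" "p < 1" and \<delta>: "\<delta> > 0"
    and int: "\<And>h. \<bar>h\<bar> < \<delta> \<Longrightarrow> integrable M (\<lambda>x. exp (h * x))"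
    and mgf: "\<And>h. \<bar>h\<bar> < \<delta> \<Longrightarrow> (\<integral>x. exp (h * x) \<partial>M) = (1 - p + p * exp h) powr \<kappa>"
  shows "\<exists>n::nat. \<kappa> = real n"
proof (rule gchoose_nonneg_imp_nat[OF \<kappa>])
  fix n
  interpret real_distribution M by fact
  define q where "q = 1 - p"
  have q: "0 < q" "q < 1" "p + q = 1" using p by (auto simp: q_def)
  define h where "h = (\<lambda>t. ln ((1 + q * t) / (1 - p * t)))"
  have "isCont h 0" unfolding h_def by (intro continuous_intros) auto
  then have "\<forall>\<^sub>F t in at 0. \<bar>h t - h 0\<bar> < \<delta> / 2"
    using \<delta> unfolding isCont_def tendsto_iff dist_real_def by (metis half_gt_zero)
  then obtain \<eta> where \<eta>: "\<eta> > 0" "\<And>t. t \<noteq> 0 \<Longrightarrow> \<bar>t\<bar> < \<eta> \<Longrightarrow> \<bar>h t - h 0\<bar> < \<delta> / 2"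
    unfolding eventually_at by (auto simp: dist_real_def)
  have h0: "h 0 = 0" by (simp add: h_def)
  have hb: "\<bar>h t\<bar> < \<delta> / 2" if "\<bar>t\<bar> < \<eta>" for t
    using \<eta>(2)[OF _ that] h0 \<delta> by (cases "t = 0") auto
  \<comment> \<open>The power of \<open>1 - p * t\<close> gives the tilt integral 1, as the inner
    product with \<open>f 0 = 1\<close> shows, and it cancels the denominators in all inner
    products.\<close>
  define f where "f = (\<lambda>t x. exp (h t * x) * (1 - p * t) powr \<kappa>)"
  have ff: "integrable M (\<lambda>x. f s x * f t x)" "(\<integral>x. f s x * f t x \<partial>M) = (1 + p * q * (s * t)) powr \<kappa>"
    if st: "\<bar>s\<bar> < \<eta>" "\<bar>t\<bar> < \<eta>" "\<bar>s\<bar> < 1" "\<bar>t\<bar> < 1" for s t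
  proof -
    have d: "\<bar>h s + h t\<bar> < \<delta>" using hb[OF st(1)] hb[OF st(2)] by auto
    have pos: "1 + q * u > 0" "1 - p * u > 0" if "\<bar>u\<bar> < 1" for u
    proof -
      have "\<bar>q * u\<bar> < 1" "\<bar>p * u\<bar> < 1"
        using that p q mult_strict_mono[of q 1 "\<bar>u\<bar>" 1] mult_strict_mono[of p 1 "\<bar>u\<bar>" 1]
        by (auto simp: abs_mult)
      then show "1 + q * u > 0" "1 - p * u > 0" by auto
    qed
    have eh: "exp (h u) = (1 + q * u) / (1 - p * u)" if "\<bar>u\<bar> < 1" for u
      using pos[OF that] by (simp add: h_def)
    have e: "f s x * f t x = ((1 - p * s) * (1 - p * t)) powr \<kappa> * exp ((h s + h t) * x)" for x
      using pos[OF st(3)] pos[OF st(4)] by (simp add: f_def powr_mult exp_add distrib_right distrib_left mult_ac)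
    show "integrable M (\<lambda>x. f s x * f t x)" unfolding e using int[OF d] by simp
    have key: "1 - p + p * exp (h s + h t) = (1 + p * q * (s * t)) / ((1 - p * s) * (1 - p * t))"
    proof -
      have "q * ((1 - p * s) * (1 - p * t)) + p * ((1 + q * s) * (1 + q * t)) = 1 + p * q * (s * t)"
        by (simp add: q_def algebra_simps)
      moreover have "1 - p + p * exp (h s + h t) =
          (q * ((1 - p * s) * (1 - p * t)) + p * ((1 + q * s) * (1 + q * t))) / ((1 - p * s) * (1 - p * t))"
        unfolding exp_add eh[OF st(3)] eh[OF st(4)] using pos[OF st(3)] pos[OF st(4)]
        by (simp add: q_def add_divide_distrib[of "_ * (_ * _)"])
      ultimately show ?thesis by simp
    qed
    have nn: "1 + p * q * (s * t) \<ge> 0"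
    proof -
      have "\<bar>p * q * (s * t)\<bar> \<le> 1"
        unfolding abs_mult using p q st by (intro mult_le_one) auto
      then show ?thesis by auto
    qed
    show "(\<integral>x. f s x * f t x \<partial>M) = (1 + p * q * (s * t)) powr \<kappa>"
      unfolding e using mgf[OF d] key pos[OF st(3)] pos[OF st(4)] nn
      by (simp add: powr_divide)
  qed
  obtain a :: "nat \<Rightarrow> real" where a: "\<And>m. m < n \<Longrightarrow> (\<Sum>i\<le>n. a i * real i ^ m) = 0" "(\<Sum>i\<le>n. a i * real i ^ n) \<noteq> 0"
    using power_sums_vanish_below[of n] by blast
  define S where "S = (\<lambda>m. \<Sum>i\<le>n. a i * real i ^ m)"
  \<comment> \<open>In the squared norm of the difference the double sum over nodes
    \<open>i\<close>, \<open>j\<close> of \<open>(i * j) ^ m\<close> splits into a square; these are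
    the coefficients in powers of \<open>\<epsilon>\<^sup>2\<close>.\<close>
  define c where "c = (\<lambda>m. (\<kappa> gchoose m) * (p * q) ^ m * (S m)\<^sup>2)"
  \<comment> \<open>Puts all nodes \<open>\<epsilon> * real i\<close> with \<open>i \<le> n\<close>
    into the region where the inner products are known.\<close>
  define \<epsilon>0 where "\<epsilon>0 = min \<eta> 1 / real (Suc n)"
  have \<epsilon>0: "\<epsilon>0 > 0" using \<eta> by (simp add: \<epsilon>0_def)
  have sums: "(\<lambda>m. c m * (\<epsilon>\<^sup>2) ^ m) sums (\<integral>x. (\<Sum>i\<le>n. a i * f (\<epsilon> * real i) x)\<^sup>2 \<partial>M)"
    if \<epsilon>: "0 < \<epsilon>" "\<epsilon> < \<epsilon>0" for \<epsilon>
  proof -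
    have t: "\<bar>\<epsilon> * real i\<bar> < \<eta>" "\<bar>\<epsilon> * real i\<bar> < 1" if "i \<le> n" for i
    proof -
      have "\<epsilon> * real i \<le> \<epsilon> * real (Suc n)" using that \<epsilon> by (intro mult_left_mono) auto
      also have "\<dots> < \<epsilon>0 * real (Suc n)" using \<epsilon> by (intro mult_strict_right_mono) auto
      also have "\<dots> = min \<eta> 1" by (simp add: \<epsilon>0_def)
      finally show "\<bar>\<epsilon> * real i\<bar> < \<eta>" "\<bar>\<epsilon> * real i\<bar> < 1" using \<epsilon> by auto
    qed
    have "(\<integral>x. (\<Sum>i\<le>n. a i * f (\<epsilon> * real i) x)\<^sup>2 \<partial>M) =
        (\<integral>x. (\<Sum>i\<le>n. \<Sum>j\<le>n. a i * a j * (f (\<epsilon> * real i) x * f (\<epsilon> * real j) x)) \<partial>M)"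
      by (simp add: power2_eq_square sum_product mult_ac)
    also have "\<dots> = (\<Sum>i\<le>n. \<Sum>j\<le>n. a i * a j * (1 + p * q * ((\<epsilon> * real i) * (\<epsilon> * real j))) powr \<kappa>)"
      using t by (subst Bochner_Integration.integral_sum; (intro Bochner_Integration.integrable_sum sum.cong refl)?)
        (auto intro!: ff sum.cong simp: Bochner_Integration.integral_sum ff)
    finally have E: "(\<integral>x. (\<Sum>i\<le>n. a i * f (\<epsilon> * real i) x)\<^sup>2 \<partial>M) =
      (\<Sum>i\<le>n. \<Sum>j\<le>n. a i * a j * (1 + p * q * ((\<epsilon> * real i) * (\<epsilon> * real j))) powr \<kappa>)" .
    have "(\<lambda>m. \<Sum>i\<le>n. \<Sum>j\<le>n. a i * a j * ((\<kappa> gchoose m) * (p * q * ((\<epsilon> * real i) * (\<epsilon> * real j))) ^ m)) sums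
      (\<Sum>i\<le>n. \<Sum>j\<le>n. a i * a j * (1 + p * q * ((\<epsilon> * real i) * (\<epsilon> * real j))) powr \<kappa>)"
    proof (intro sums_sum sums_mult gen_binomial_real)
      fix i j assume "i \<in> {..n}" "j \<in> {..n}"
      then have ij: "\<bar>\<epsilon> * real i\<bar> < 1" "\<bar>\<epsilon> * real j\<bar> < 1" using t by auto
      have "\<bar>p * q\<bar> * \<bar>(\<epsilon> * real i) * (\<epsilon> * real j)\<bar> < 1"
        using ij p q mult_strict_mono'[of p 1 q 1] mult_strict_mono'[of "\<bar>\<epsilon> * real i\<bar>" 1 "\<bar>\<epsilon> * real j\<bar>" 1]
        mult_strict_mono'[of "p * q" 1 "\<bar>(\<epsilon> * real i) * (\<epsilon> * real j)\<bar>" 1]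
        by (simp add: abs_mult)
      then show "\<bar>p * q * (\<epsilon> * real i * (\<epsilon> * real j))\<bar> < 1" by (simp only: abs_mult)
    qed
    moreover have "(\<Sum>i\<le>n. \<Sum>j\<le>n. a i * a j * ((\<kappa> gchoose m) * (p * q * ((\<epsilon> * real i) * (\<epsilon> * real j))) ^ m)) =
       c m * (\<epsilon>\<^sup>2) ^ m" for m
      unfolding c_def S_def power2_eq_square[of "sum _ _"] sum_product
      by (simp add: sum_distrib_left sum_distrib_right power_mult_distrib power2_eq_square mult_ac)
    ultimately show ?thesis unfolding E by simp
  qed
  \<comment> \<open>The finite difference kills the coefficients below order \<open>n\<close>; after
    division by \<open>y ^ n\<close>, where \<open>y = \<epsilon>\<^sup>2\<close>, the constant term
    \<open>c n\<close> is the limit at 0 from the right of nonnegative quantities.\<close>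
  have low: "c m = 0" if "m < n" for m using a(1)[OF that] by (simp add: c_def S_def)
  have sums': "(\<lambda>m. c (m + n) * y ^ m) sums
      ((\<integral>x. (\<Sum>i\<le>n. a i * f (sqrt y * real i) x)\<^sup>2 \<partial>M) / y ^ n)" if y: "0 < y" "y < \<epsilon>0\<^sup>2" for y
  proof -
    have "sqrt y < \<epsilon>0" using y \<epsilon>0 by (simp add: real_less_lsqrt)
    then have "(\<lambda>m. c m * y ^ m) sums (\<integral>x. (\<Sum>i\<le>n. a i * f (sqrt y * real i) x)\<^sup>2 \<partial>M)"
      using sums[of "sqrt y"] y by simp
    from sums_split_initial_segment[OF this, of n]
    have "(\<lambda>m. c (m + n) * y ^ (m + n)) sums (\<integral>x. (\<Sum>i\<le>n. a i * f (sqrt y * real i) x)\<^sup>2 \<partial>M)"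
      using low by simp
    from sums_divide[OF this, of "y ^ n"] show ?thesis using y by (simp add: power_add)
  qed
  define g where "g = (\<lambda>y. \<Sum>m. c (m + n) * y ^ m)"
  have "\<epsilon>0\<^sup>2 / 2 > 0" using \<epsilon>0 by simp
  moreover have "(\<lambda>m. c (m + n) * y ^ m) sums g y" if "norm y < \<epsilon>0\<^sup>2 / 2" for y
  proof -
    have "summable (\<lambda>m. c (m + n) * (\<epsilon>0\<^sup>2 / 2) ^ m)"
      using sums'[of "\<epsilon>0\<^sup>2 / 2"] \<epsilon>0 by (auto simp: sums_iff)
    from powser_inside[OF this, of y] that show ?thesis by (simp add: g_def summable_sums)
  qed
  ultimately have "(g \<longlongrightarrow> c (0 + n)) (at 0)" by (rule powser_limit_0)
  then have lim: "(g \<longlongrightarrow> c n) (at_right 0)" by (auto intro: tendsto_mono at_le)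
  have "c n \<ge> 0"
  proof (rule tendsto_lowerbound[OF lim])
    have "\<forall>\<^sub>F y in at_right 0. y \<in> {0<..<\<epsilon>0\<^sup>2}" using \<epsilon>0 by (intro eventually_at_right_real) auto
    then show "\<forall>\<^sub>F y in at_right 0. 0 \<le> g y"
    proof eventually_elim
      fix y assume y: "y \<in> {0<..<\<epsilon>0\<^sup>2}"
      then have "g y = (\<integral>x. (\<Sum>i\<le>n. a i * f (sqrt y * real i) x)\<^sup>2 \<partial>M) / y ^ n"
        unfolding g_def using sums'[of y] by (simp add: sums_iff)
      also have "\<dots> \<ge> 0" using y by (intro divide_nonneg_nonneg integral_nonneg_AE) auto
      finally show "0 \<le> g y" .
    qed
  qed simp
  then show "(\<kappa> gchoose n) \<ge> 0"
  proof -
    have "(p * q) ^ n * (S n)\<^sup>2 > 0" using a(2) p q by (simp add: S_def)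
    then show ?thesis using \<open>c n \<ge> 0\<close> by (simp add: c_def mult.assoc zero_le_mult_iff)
  qed
qed

section \<open>Classification of quadratic variance functions\<close>

text \<open>For fractional \<open>\<kappa>\<close> there is no binomial law to compare with.
  Uniqueness for the differential equation still forces the moment generating function to be
  \<open>(1 - p + p * exp h) powr \<kappa>\<close> with \<open>p = m / \<kappa>\<close>, and
  positivity decides.\<close>

lemma binomial_cumulant_exponent_nat:
  assumes M: "quad_cumulant M (- 1 / \<kappa>) 1 0 m" and m: "0 < m" "m < \<kappa>"
  shows "\<exists>n::nat. \<kappa> = real n"
proof -
  have \<kappa>: "\<kappa> > 0" using m by linarith
  from M obtain d K k where M': "real_distribution M" "d > 0" "k 0 = m" and
    K: "\<And>h. \<bar>h\<bar> < d \<Longrightarrow> integrable M (\<lambda>x. exp (h * x)) \<and> (\<integral>x. exp (h * x) \<partial>M) = exp (K h) \<and>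
        (K has_real_derivative k h) (at h) \<and>
        (k has_real_derivative (- 1 / \<kappa>) * (k h)\<^sup>2 + 1 * k h + 0) (at h)"
    unfolding quad_cumulant_def by metis
  interpret real_distribution M by fact
  define p where "p = m / \<kappa>"
  have p: "0 < p" "p < 1" using m \<kappa> by (auto simp: p_def)
  have K0: "K 0 = 0" using K[of 0] M'(2) mgf_0[of "\<lambda>x. x"] by auto
  have pos: "1 - p + p * exp h > 0" for h :: real using p by (simp add: add_pos_pos)
  have eq: "K h - K 0 = \<kappa> * ln (1 - p + p * exp h) - \<kappa> * ln (1 - p + p * exp 0)" if "\<bar>h\<bar> < d" for h
  proof (rule quadratic_ode_unique[OF M'(2), of k "\<lambda>h. \<kappa> * (p * exp h) / (1 - p + p * exp h)" K "- 1 / \<kappa>" 1 0])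
    show "k 0 = \<kappa> * (p * exp 0) / (1 - p + p * exp 0)" using M'(3) \<kappa> by (simp add: p_def)
    fix h :: real
    show "((\<lambda>h. \<kappa> * ln (1 - p + p * exp h)) has_real_derivative \<kappa> * (p * exp h) / (1 - p + p * exp h)) (at h)"
      using pos[of h] by (auto intro!: derivative_eq_intros)
    define u where "u = p * exp h"
    define v where "v = 1 - p + u"
    have v: "v > 0" using pos[of h] by (auto simp: u_def v_def)
    have "((\<lambda>h. \<kappa> * (p * exp h) / (1 - p + p * exp h)) has_real_derivative
        (\<kappa> * u * v - \<kappa> * u * u) / (v * v)) (at h)"
      using pos[of h] by (auto intro!: derivative_eq_intros simp: u_def v_def)
    also have "(\<kappa> * u * v - \<kappa> * u * u) / (v * v) = - 1 / \<kappa> * (\<kappa> * u / v)\<^sup>2 + 1 * (\<kappa> * u / v) + 0"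
      using v \<kappa> by (simp add: field_simps power2_eq_square)
    finally show "((\<lambda>h. \<kappa> * (p * exp h) / (1 - p + p * exp h)) has_real_derivative
        - 1 / \<kappa> * (\<kappa> * (p * exp h) / (1 - p + p * exp h))\<^sup>2 +
          1 * (\<kappa> * (p * exp h) / (1 - p + p * exp h)) + 0) (at h)"
      unfolding u_def v_def .
  qed (use K that in auto)
  show ?thesis
  proof (rule binomial_mgf_exponent_nat[OF M'(1) \<kappa> p M'(2)])
    fix h assume h: "\<bar>h\<bar> < d"
    show "integrable M (\<lambda>x. exp (h * x))" using K[OF h] by simp
    show "(\<integral>x. exp (h * x) \<partial>M) = (1 - p + p * exp h) powr \<kappa>"
      using K[OF h] eq[OF h] K0 pos[of h] by (simp add: powr_def)
  qed
qed

section \<open>Assembling the six cases\<close>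

lemma six_families_normal:
  "(\<And>\<rho>. \<rho> \<in> R \<Longrightarrow> \<exists>m. M \<rho> = normal_law m 1) \<Longrightarrow> six_families R M 0 0 1"
  unfolding six_families_def by (rule disjI1) simp

lemma six_families_poisson:
  "(\<And>\<rho>. \<rho> \<in> R \<Longrightarrow> \<exists>m>0. M \<rho> = poisson_law m) \<Longrightarrow> six_families R M 0 1 0"
  unfolding six_families_def by (rule disjI2, rule disjI1) simp

lemma six_families_gamma:
  "s > 0 \<Longrightarrow> (\<And>\<rho>. \<rho> \<in> R \<Longrightarrow> \<exists>\<beta>>0. M \<rho> = gamma_law (1 / s) \<beta>) \<Longrightarrow> six_families R M s 0 0"
  unfolding six_families_def by (rule disjI2, rule disjI2, rule disjI1) blast

lemma six_families_binomial:
  "\<kappa> \<ge> 1 \<Longrightarrow> (\<And>\<rho>. \<rho> \<in> R \<Longrightarrow> \<exists>p. 0 < p \<and> p < 1 \<and> M \<rho> = binomial_law \<kappa> p) \<Longrightarrow>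
   six_families R M (- 1 / real \<kappa>) 1 0"
  unfolding six_families_def by (rule disjI2, rule disjI2, rule disjI2, rule disjI1) blast

lemma six_families_neg_binomial:
  "s > 0 \<Longrightarrow> (\<And>\<rho>. \<rho> \<in> R \<Longrightarrow> \<exists>p. 0 < p \<and> p < 1 \<and> M \<rho> = neg_binomial_law (1 / s) p) \<Longrightarrow>
   six_families R M s 1 0"
  unfolding six_families_def by (rule disjI2, rule disjI2, rule disjI2, rule disjI2, rule disjI1) blast

lemma six_families_ghs:
  "s > 0 \<Longrightarrow> (\<And>\<rho>. \<rho> \<in> R \<Longrightarrow> \<exists>\<theta>. - pi / 2 < \<theta> \<and> \<theta> < pi / 2 \<and>
     M \<rho> = distr (ghs_law (1 / s) \<theta>) borel (\<lambda>x. sqrt s * x)) \<Longrightarrow> six_families R M s 0 1"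
  unfolding six_families_def by (rule disjI2, rule disjI2, rule disjI2, rule disjI2, rule disjI2) blast

text \<open>One pair \<open>A\<close>, \<open>B\<close> must work for all means. Where the variance
  polynomial has real zeros, the pair moves a suitable zero to 0 and, if that zero is simple, makes
  the slope there 1; positivity and connectedness decide on which side of the zeros the means
  lie.\<close>

theorem morris_classification:
  fixes R :: "real set" and L :: "real \<Rightarrow> real measure"
  assumes R: "connected R" "R \<noteq> {}"
    and L: "\<And>m. m \<in> R \<Longrightarrow> quad_cumulant (L m) v2 v1 v0 m"
    and pos: "\<And>m. m \<in> R \<Longrightarrow> v2 * m\<^sup>2 + v1 * m + v0 > 0"
  shows "\<exists>A B. A \<noteq> 0 \<and> six_families R (\<lambda>m. distr (L m) borel (\<lambda>x. A * x + B)) v2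
           (A * v1 - 2 * v2 * B) (A\<^sup>2 * v0 - A * v1 * B + v2 * B\<^sup>2)"
proof -
  obtain m0 where m0: "m0 \<in> R" using R by auto
  define T where "T = (\<lambda>A B m. distr (L m) borel (\<lambda>x. A * x + B))"
  have T: "quad_cumulant (T A B m) v2 w1 w0 (A * m + B)"
    if "m \<in> R" "A \<noteq> 0" "A * v1 - 2 * v2 * B = w1" "A\<^sup>2 * v0 - A * v1 * B + v2 * B\<^sup>2 = w0" for A B m w1 w0
    unfolding T_def using quad_cumulant_affine[OF L[OF that(1)] that(2)] that(3,4) by metis
  have goal: ?thesis if "A \<noteq> 0" "A * v1 - 2 * v2 * B = w1" "A\<^sup>2 * v0 - A * v1 * B + v2 * B\<^sup>2 = w0"
    "six_families R (T A B) v2 w1 w0" for A B w1 w0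
    using that unfolding T_def by blast
  \<comment> \<open>The sign of the leading coefficient, refined by the sign of the discriminant:
    both are invariant under affine maps.\<close>
  consider (normal) "v2 = 0" "v1 = 0" | (poisson) "v2 = 0" "v1 \<noteq> 0"
    | (gamma) "v2 > 0" "v1\<^sup>2 - 4 * v0 * v2 = 0" | (ghs) "v2 > 0" "v1\<^sup>2 - 4 * v0 * v2 < 0"
    | (negbin) "v2 > 0" "v1\<^sup>2 - 4 * v0 * v2 > 0" | (binomial) "v2 < 0"
    by linarith
  then show ?thesis
  proof cases
    case normal
    have v0: "v0 > 0" using pos[OF m0] normal by simp
    define A where "A = 1 / sqrt v0"
    have A: "A \<noteq> 0" "A * v1 - 2 * v2 * 0 = 0" "A\<^sup>2 * v0 - A * v1 * 0 + v2 * 0\<^sup>2 = 1"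
      using v0 normal by (auto simp: A_def power_divide)
    have "T A 0 m = normal_law (A * m + 0) 1" if "m \<in> R" for m
      using quad_cumulant_unique[OF T[OF that A]] quad_cumulant_normal normal by metis
    then have "six_families R (T A 0) v2 0 1" unfolding normal(1) by (intro six_families_normal) blast
    then show ?thesis by (rule goal[OF A])
  next
    case poisson
    \<comment> \<open>The zero \<open>- v0 / v1\<close> of the variance goes to 0, and the slope
      becomes 1.\<close>
    define A where "A = 1 / v1"
    define B where "B = v0 / v1\<^sup>2"
    have A: "A \<noteq> 0" "A * v1 - 2 * v2 * B = 1" "A\<^sup>2 * v0 - A * v1 * B + v2 * B\<^sup>2 = 0"
      using poisson by (auto simp: A_def B_def power_divide)
    have "A * m + B > 0 \<and> T A B m = poisson_law (A * m + B)" if "m \<in> R" for m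
    proof -
      have "A * m + B = (v1 * m + v0) / v1\<^sup>2" using poisson by (simp add: A_def B_def power2_eq_square field_simps)
      then have p: "A * m + B > 0" using pos[OF that] poisson by simp
      show ?thesis
        using quad_cumulant_unique[OF T[OF that A]] quad_cumulant_poisson[OF p] poisson p by metis
    qed
    then have "six_families R (T A B) v2 1 0" unfolding poisson(1) by (intro six_families_poisson) blast
    then show ?thesis by (rule goal[OF A])
  next
    case gamma
    define c where "c = v1 / (2 * v2)"
    have v1: "v1 = 2 * v2 * c" and v0: "v0 = v2 * c\<^sup>2"
      using gamma by (auto simp: c_def power2_eq_square field_simps)
    have Q: "v2 * m\<^sup>2 + v1 * m + v0 = v2 * (m + c)\<^sup>2" for m
      by (simp add: v1 v0 power2_eq_square algebra_simps)
    \<comment> \<open>The double zero \<open>- c\<close> would be a mean with variance 0, so all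
      means lie on one side of it; the sign of \<open>A\<close> reflects them to the positive side
      if necessary.\<close>
    have "- c \<notin> R" using pos[of "- c"] Q[of "- c"] by auto
    then have side: "(\<forall>m\<in>R. m + c > 0) \<or> (\<forall>m\<in>R. - m - c > 0)"
      using connectedD_interval[OF R(1), of _ _ "- c"] by (smt (verit))
    obtain A where A': "A = 1 \<or> A = -1" "\<And>m. m \<in> R \<Longrightarrow> A * m + A * c > 0"
      using side by (metis (no_types, opaque_lifting) diff_conv_add_uminus mult_1 mult_minus1)
    have A: "A \<noteq> 0" "A * v1 - 2 * v2 * (A * c) = 0" "A\<^sup>2 * v0 - A * v1 * (A * c) + v2 * (A * c)\<^sup>2 = 0"
      using A'(1) by (auto simp: v1 v0 power2_eq_square)
    have "\<exists>\<beta>>0. T A (A * c) m = gamma_law (1 / v2) \<beta>" if "m \<in> R" for m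
    proof (intro exI conjI)
      let ?\<beta> = "1 / (v2 * (A * m + A * c))"
      show \<beta>: "?\<beta> > 0" using A'(2)[OF that] gamma by simp
      have "1 / (v2 * ?\<beta>) = A * m + A * c" using A'(2)[OF that] gamma by simp
      then show "T A (A * c) m = gamma_law (1 / v2) ?\<beta>"
        using quad_cumulant_unique[OF T[OF that A]] quad_cumulant_gamma[OF gamma(1) \<beta>] by metis
    qed
    then have "six_families R (T A (A * c)) v2 0 0" by (rule six_families_gamma[OF gamma(1)])
    then show ?thesis by (rule goal[OF A])
  next
    case ghs
    define c where "c = v1 / (2 * v2)"
    \<comment> \<open>Minimum of the variance polynomial, attained at \<open>- c\<close>; scaling by
      \<open>1 / sqrt e\<close> makes the constant coefficient 1.\<close>
    define e where "e = v0 - v2 * c\<^sup>2"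
    have v1: "v1 = 2 * v2 * c" and v0: "v0 = e + v2 * c\<^sup>2"
      using ghs by (auto simp: c_def e_def)
    have "v1\<^sup>2 - 4 * v0 * v2 = - 4 * v2 * e"
      by (simp add: v1 v0 power2_eq_square algebra_simps)
    then have e: "e > 0" using ghs by (simp add: zero_less_mult_iff)
    define A where "A = 1 / sqrt e"
    have A2: "A\<^sup>2 * e = 1" using e by (simp add: A_def power_divide)
    have "A\<^sup>2 * v0 - A * v1 * (A * c) + v2 * (A * c)\<^sup>2 = A\<^sup>2 * e"
      by (simp add: v1 v0 power2_eq_square algebra_simps)
    then have A: "A \<noteq> 0" "A * v1 - 2 * v2 * (A * c) = 0" "A\<^sup>2 * v0 - A * v1 * (A * c) + v2 * (A * c)\<^sup>2 = 1"
      using e A2 by (auto simp: A_def v1)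
    have "\<exists>\<theta>. - pi / 2 < \<theta> \<and> \<theta> < pi / 2 \<and> T A (A * c) m = distr (ghs_law (1 / v2) \<theta>) borel (\<lambda>x. sqrt v2 * x)"
      if "m \<in> R" for m
    proof (intro exI conjI)
      let ?\<theta> = "arctan (sqrt v2 * (A * m + A * c))"
      show \<theta>: "- pi / 2 < ?\<theta>" "?\<theta> < pi / 2" using arctan_lbound arctan_ubound by auto
      have "tan ?\<theta> / sqrt v2 = A * m + A * c" using ghs by (simp add: tan_arctan)
      then show "T A (A * c) m = distr (ghs_law (1 / v2) ?\<theta>) borel (\<lambda>x. sqrt v2 * x)"
        using quad_cumulant_unique[OF T[OF that A]] quad_cumulant_scaled_ghs[OF ghs(1) \<theta>] by metis
    qed
    then have "six_families R (T A (A * c)) v2 0 1" by (rule six_families_ghs[OF ghs(1)])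
    then show ?thesis by (rule goal[OF A])
  next
    case negbin
    define D where "D = sqrt (v1\<^sup>2 - 4 * v0 * v2)"
    have D: "D > 0" "D\<^sup>2 = v1\<^sup>2 - 4 * v0 * v2" using negbin by (auto simp: D_def)
    define x1 where "x1 = (- v1 - D) / (2 * v2)"
    define x2 where "x2 = (- v1 + D) / (2 * v2)"
    have x12: "x1 < x2" using D negbin by (simp add: x1_def x2_def divide_strict_right_mono)
    have vx: "2 * v2 * x1 = - v1 - D" "2 * v2 * x2 = - v1 + D" using negbin by (auto simp: x1_def x2_def)
    have Q: "v2 * m\<^sup>2 + v1 * m + v0 = v2 * (m - x1) * (m - x2)" for m
    proof -
      have "4 * v2 * (v2 * (m - x1) * (m - x2)) = (2 * v2 * m - 2 * v2 * x1) * (2 * v2 * m - 2 * v2 * x2)"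
        by (simp add: algebra_simps)
      also have "\<dots> = (2 * v2 * m + v1)\<^sup>2 - D\<^sup>2" unfolding vx by (simp add: power2_eq_square algebra_simps)
      also have "\<dots> = 4 * v2 * (v2 * m\<^sup>2 + v1 * m + v0)" unfolding D(2) by (simp add: power2_eq_square algebra_simps)
      finally show ?thesis using negbin by simp
    qed
    have out: "m < x1 \<or> m > x2" if "m \<in> R" for m
    proof -
      have "0 < v2 * ((m - x1) * (m - x2))" using pos[OF that] unfolding Q by (simp only: mult.assoc)
      then have "0 < (m - x1) * (m - x2)" using negbin(1) by (rule zero_less_mult_pos)
      then show ?thesis using x12 by (auto simp: zero_less_mult_iff)
    qed
    have "x1 \<notin> R" using pos[of x1] Q[of x1] by auto
    \<comment> \<open>The forbidden interval contains \<open>x1\<close>, so connectedness leaves one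
      of the two outer rays.\<close>
    then have side: "(\<forall>m\<in>R. m > x2) \<or> (\<forall>m\<in>R. m < x1)"
      using connectedD_interval[OF R(1), of _ _ x1] out x12 by (smt (verit))
    \<comment> \<open>The zero next to \<open>R\<close> goes to 0. The slope of the variance is
      \<open>D\<close> at \<open>x2\<close> and \<open>- D\<close> at \<open>x1\<close>, hence
      \<open>A = 1 / D\<close> or \<open>A = - 1 / D\<close>; the sign also makes the new means
      positive.\<close>
    have "\<exists>A B. A \<noteq> 0 \<and> A * v1 - 2 * v2 * B = 1 \<and> A\<^sup>2 * v0 - A * v1 * B + v2 * B\<^sup>2 = 0 \<and> (\<forall>m\<in>R. A * m + B > 0)"
      using side
    proof
      assume m: "\<forall>m\<in>R. m > x2"
      have "(1 / D) * v1 - 2 * v2 * (- x2 / D) = (v1 + 2 * v2 * x2) / D" by (simp add: add_divide_distrib)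
      moreover have "(1 / D)\<^sup>2 * v0 - (1 / D) * v1 * (- x2 / D) + v2 * (- x2 / D)\<^sup>2 = (v2 * x2\<^sup>2 + v1 * x2 + v0) / D\<^sup>2"
        using D(1) by (simp add: power2_eq_square field_simps)
      moreover have "(1 / D) * m + - x2 / D > 0" if "m \<in> R" for m
        using m that D(1) by (simp add: field_simps)
      ultimately show ?thesis using D(1) vx Q[of x2]
        by (intro exI[of _ "1 / D"] exI[of _ "- x2 / D"]) auto
    next
      assume m: "\<forall>m\<in>R. m < x1"
      have "(- 1 / D) * v1 - 2 * v2 * (x1 / D) = - (v1 + 2 * v2 * x1) / D" by (simp add: add_divide_distrib diff_divide_distrib)
      moreover have "(- 1 / D)\<^sup>2 * v0 - (- 1 / D) * v1 * (x1 / D) + v2 * (x1 / D)\<^sup>2 = (v2 * x1\<^sup>2 + v1 * x1 + v0) / D\<^sup>2"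
        using D(1) by (simp add: power2_eq_square field_simps)
      moreover have "(- 1 / D) * m + x1 / D > 0" if "m \<in> R" for m
        using m that D(1) by (simp add: field_simps)
      ultimately show ?thesis using D(1) vx Q[of x1]
        by (intro exI[of _ "- 1 / D"] exI[of _ "x1 / D"]) auto
    qed
    then obtain A B where A: "A \<noteq> 0" "A * v1 - 2 * v2 * B = 1" "A\<^sup>2 * v0 - A * v1 * B + v2 * B\<^sup>2 = 0"
      and AB: "\<And>m. m \<in> R \<Longrightarrow> A * m + B > 0" by blast
    have "\<exists>p. 0 < p \<and> p < 1 \<and> T A B m = neg_binomial_law (1 / v2) p" if "m \<in> R" for m
    proof (intro exI conjI)
      \<comment> \<open>Solves \<open>(1 - p) / (v2 * p) = A * m + B\<close>, where the left side is
        the mean of the negative binomial law.\<close>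
      let ?p = "1 / (1 + v2 * (A * m + B))"
      have vm: "v2 * (A * m + B) > 0" using negbin AB[OF that] by simp
      show p: "0 < ?p" "?p < 1" using vm by auto
      have "(1 - 1 / (1 + t)) / (v2 * (1 / (1 + t))) = t / v2" if "t > 0" for t
      proof -
        have "1 - 1 / (1 + t) = t / (1 + t)" using that by (simp add: field_simps)
        then show ?thesis using that by (simp only:) simp
      qed
      from this[OF vm] have "(1 - ?p) / (v2 * ?p) = A * m + B" using negbin(1) by simp
      then show "T A B m = neg_binomial_law (1 / v2) ?p"
        using quad_cumulant_unique[OF T[OF that A]] quad_cumulant_neg_binomial[OF negbin(1) p] by metis
    qed
    then have "six_families R (T A B) v2 1 0" by (rule six_families_neg_binomial[OF negbin(1)])
    then show ?thesis by (rule goal[OF A])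
  next
    case binomial
    \<comment> \<open>Completing the square: a single positive value of a concave quadratic forces
      two distinct real zeros.\<close>
    have "0 < - 4 * v2 * (v2 * m0\<^sup>2 + v1 * m0 + v0)" using pos[OF m0] binomial by (simp add: zero_less_mult_iff mult_neg_pos)
    also have "\<dots> = (v1\<^sup>2 - 4 * v0 * v2) - (2 * v2 * m0 + v1)\<^sup>2" by (simp add: power2_eq_square algebra_simps)
    finally have \<Delta>: "v1\<^sup>2 - 4 * v0 * v2 > 0" using zero_le_power2[of "2 * v2 * m0 + v1"] by linarith
    define D where "D = sqrt (v1\<^sup>2 - 4 * v0 * v2)"
    have D: "D > 0" "D\<^sup>2 = v1\<^sup>2 - 4 * v0 * v2" using \<Delta> by (auto simp: D_def)
    \<comment> \<open>The signs of \<open>D\<close> are exchanged against the previous case because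
      \<open>v2\<close> is negative; this keeps \<open>x1 < x2\<close>.\<close>
    define x1 where "x1 = (- v1 + D) / (2 * v2)"
    define x2 where "x2 = (- v1 - D) / (2 * v2)"
    have vx: "2 * v2 * x1 = - v1 + D" "2 * v2 * x2 = - v1 - D" using binomial by (auto simp: x1_def x2_def)
    have x12: "x1 < x2" using D binomial by (simp add: x1_def x2_def divide_strict_right_mono_neg)
    have Q: "v2 * m\<^sup>2 + v1 * m + v0 = v2 * (m - x1) * (m - x2)" for m
    proof -
      have "4 * v2 * (v2 * (m - x1) * (m - x2)) = (2 * v2 * m - 2 * v2 * x1) * (2 * v2 * m - 2 * v2 * x2)"
        by (simp add: algebra_simps)
      also have "\<dots> = (2 * v2 * m + v1)\<^sup>2 - D\<^sup>2" unfolding vx by (simp add: power2_eq_square algebra_simps)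
      also have "\<dots> = 4 * v2 * (v2 * m\<^sup>2 + v1 * m + v0)" unfolding D(2) by (simp add: power2_eq_square algebra_simps)
      finally show ?thesis using binomial by simp
    qed
    have ins: "x1 < m" "m < x2" if "m \<in> R" for m
      using pos[OF that] binomial x12 unfolding Q by (auto simp: zero_less_mult_iff mult_less_0_iff)
    define A where "A = 1 / D"
    define B where "B = - x1 / D"
    have "A * v1 - 2 * v2 * B = (v1 + 2 * v2 * x1) / D" by (simp add: A_def B_def add_divide_distrib)
    moreover have "A\<^sup>2 * v0 - A * v1 * B + v2 * B\<^sup>2 = (v2 * x1\<^sup>2 + v1 * x1 + v0) / D\<^sup>2"
      using D(1) by (simp add: A_def B_def power2_eq_square field_simps)
    ultimately have A: "A \<noteq> 0" "A * v1 - 2 * v2 * B = 1" "A\<^sup>2 * v0 - A * v1 * B + v2 * B\<^sup>2 = 0"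
      using D(1) vx Q[of x1] by (auto simp: A_def)
    \<comment> \<open>The image of \<open>x2\<close> under the affine map, while \<open>x1\<close>
      goes to 0; the new means therefore lie strictly between 0 and \<open>\<kappa>\<close>.\<close>
    define \<kappa> where "\<kappa> = - 1 / v2"
    have \<kappa>: "v2 = - 1 / \<kappa>" "\<kappa> > 0" using binomial by (auto simp: \<kappa>_def)
    have mean: "0 < A * m + B" "A * m + B < \<kappa>" if "m \<in> R" for m
    proof -
      have AB: "A * m + B = (m - x1) / D" by (simp add: A_def B_def diff_divide_distrib)
      show "0 < A * m + B" unfolding AB using ins[OF that] D(1) by simp
      have "(m - x1) / D < (x2 - x1) / D" using ins[OF that] D(1) by (intro divide_strict_right_mono) auto
      also have "(x2 - x1) / D = \<kappa>"
        using D(1) binomial by (simp add: x1_def x2_def \<kappa>_def field_simps)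
      finally show "A * m + B < \<kappa>" unfolding AB .
    qed
    \<comment> \<open>The single mean \<open>m0\<close> settles this for the whole family, as
      \<open>\<kappa>\<close> does not depend on the mean.\<close>
    obtain n :: nat where n: "\<kappa> = real n"
      using binomial_cumulant_exponent_nat[of "T A B m0" \<kappa> "A * m0 + B"] T[OF m0 A] mean[OF m0] \<kappa>(1) by auto
    have n1: "n \<ge> 1" using n \<kappa>(2) by simp
    have "\<exists>p. 0 < p \<and> p < 1 \<and> T A B m = binomial_law n p" if "m \<in> R" for m
    proof (intro exI conjI)
      let ?p = "(A * m + B) / real n"
      show p: "0 < ?p" "?p < 1" using mean[OF that] n \<kappa>(2) by auto
      have "real n * ?p = A * m + B" using n1 by simp
      then show "T A B m = binomial_law n ?p"
        using quad_cumulant_unique[OF T[OF that A]] quad_cumulant_binomial[OF n1 p] \<kappa>(1) n by metis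
    qed
    then have "six_families R (T A B) v2 1 0" unfolding \<kappa>(1) n by (rule six_families_binomial[OF n1])
    then show ?thesis by (rule goal[OF A])
  qed
qed

section \<open>The second moment identity\<close>

lemma finite_sites [simp]: "finite (sites N)" by (simp add: sites_def)

lemma monomial_in_polys:
  assumes "\<alpha> \<in> sites N \<rightarrow>\<^sub>E {..k}" "(\<Sum>x\<in>sites N. \<alpha> x) \<le> k"
  shows "(\<lambda>\<eta>. \<Prod>x\<in>sites N. \<eta> x ^ \<alpha> x) \<in> polys N S k"
proof -
  let ?A = "{\<alpha>. \<alpha> \<in> sites N \<rightarrow>\<^sub>E {..k} \<and> (\<Sum>x\<in>sites N. \<alpha> x) \<le> k}"
  have fin: "finite ?A"
    by (rule finite_subset[of _ "sites N \<rightarrow>\<^sub>E {..k}"]) (auto intro: finite_PiE)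
  have "(\<Sum>\<beta>\<in>?A. (if \<beta> = \<alpha> then 1 else 0) * (\<Prod>x\<in>sites N. \<eta> x ^ \<beta> x)) = (\<Prod>x\<in>sites N. \<eta> x ^ \<alpha> x)"
    for \<eta> :: config
  proof -
    have "(\<Sum>\<beta>\<in>?A. (if \<beta> = \<alpha> then 1 else 0) * (\<Prod>x\<in>sites N. \<eta> x ^ \<beta> x)) =
        (\<Sum>\<beta>\<in>?A. if \<beta> = \<alpha> then (\<Prod>x\<in>sites N. \<eta> x ^ \<beta> x) else 0)"
      by (intro sum.cong) auto
    also have "\<dots> = (\<Prod>x\<in>sites N. \<eta> x ^ \<alpha> x)"
      using fin assms by (subst sum.delta) auto
    finally show ?thesis .
  qed
  then show ?thesis unfolding polys_def
    by (intro CollectI exI[of _ "\<lambda>\<beta>. if \<beta> = \<alpha> then 1 else 0"]) simp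
qed

lemma polys_linear_comb:
  assumes "f \<in> polys N S k" "g \<in> polys N S k"
  shows "(\<lambda>\<eta>. u * f \<eta> + v * g \<eta>) \<in> polys N S k"
proof -
  from assms obtain c d where
    "\<And>\<eta>. \<eta> \<in> configs N S \<Longrightarrow> f \<eta> = (\<Sum>\<alpha> | \<alpha> \<in> sites N \<rightarrow>\<^sub>E {..k} \<and> (\<Sum>x\<in>sites N. \<alpha> x) \<le> k.
        c \<alpha> * (\<Prod>x\<in>sites N. \<eta> x ^ \<alpha> x))"
    "\<And>\<eta>. \<eta> \<in> configs N S \<Longrightarrow> g \<eta> = (\<Sum>\<alpha> | \<alpha> \<in> sites N \<rightarrow>\<^sub>E {..k} \<and> (\<Sum>x\<in>sites N. \<alpha> x) \<le> k.
        d \<alpha> * (\<Prod>x\<in>sites N. \<eta> x ^ \<alpha> x))"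
    unfolding polys_def by blast
  then show ?thesis unfolding polys_def
    by (intro CollectI exI[of _ "\<lambda>\<alpha>. u * c \<alpha> + v * d \<alpha>"])
       (simp add: sum_distrib_left sum.distrib[symmetric] distrib_right mult.assoc)
qed

lemma quadratic_monomial_in_polys:
  assumes "x \<in> sites N" "y \<in> sites N"
  shows "(\<lambda>\<eta>. \<eta> x * \<eta> y) \<in> polys N S 2"
proof -
  \<comment> \<open>A sum of two indicators, so that \<open>x = y\<close> gives the exponent
    2.\<close>
  define \<alpha> where "\<alpha> = (\<lambda>z\<in>sites N. (if z = x then 1 else 0) + (if z = y then 1 else 0) :: nat)"
  have "(\<Prod>z\<in>sites N. \<eta> z ^ \<alpha> z) = \<eta> x * \<eta> y" for \<eta> :: config
  proof -
    have "(\<Prod>z\<in>sites N. \<eta> z ^ \<alpha> z) = (\<Prod>z\<in>sites N. (if z = x then \<eta> z else 1) * (if z = y then \<eta> z else 1))"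
      by (intro prod.cong) (auto simp: \<alpha>_def)
    also have "\<dots> = \<eta> x * \<eta> y" using assms by (simp add: prod.distrib prod.delta)
    finally show ?thesis .
  qed
  moreover have "(\<lambda>\<eta>. \<Prod>z\<in>sites N. \<eta> z ^ \<alpha> z) \<in> polys N S 2"
    by (rule monomial_in_polys)
       (use assms in \<open>auto simp: \<alpha>_def sum.distrib sum.delta\<close>)
  ultimately show ?thesis by simp
qed

lemma const_in_polys: "(\<lambda>_. u) \<in> polys N S k"
proof -
  have "(\<lambda>\<eta>. \<Prod>z\<in>sites N. \<eta> z ^ (\<lambda>z\<in>sites N. 0) z) \<in> polys N S k"
    by (rule monomial_in_polys) auto
  moreover have "(\<Prod>z\<in>sites N. \<eta> z ^ (\<lambda>z\<in>sites N. 0) z) = 1" for \<eta> :: config by (intro prod.neutral) auto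
  ultimately have 1: "(\<lambda>\<eta>::config. 1) \<in> polys N S k" by simp
  from polys_linear_comb[OF 1 1, of u 0] show ?thesis by simp
qed

lemma polys_sum:
  assumes "finite A" "\<And>i. i \<in> A \<Longrightarrow> f i \<in> polys N S k"
  shows "(\<lambda>\<eta>. \<Sum>i\<in>A. f i \<eta>) \<in> polys N S k"
  using assms
proof (induction A)
  case empty
  then show ?case by (simp add: const_in_polys)
next
  case (insert i A)
  then have "f i \<in> polys N S k" "(\<lambda>\<eta>. \<Sum>i\<in>A. f i \<eta>) \<in> polys N S k" by auto
  from polys_linear_comb[OF this, of 1 1] insert show ?case by simp
qed

section \<open>Translations of the torus and their effect on bonds\<close>

lemma shift_in_configs:
  assumes "\<eta> \<in> configs N S"
  shows "shift N x \<eta> \<in> configs N S"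
  using assms by (auto simp: configs_def shift_def sites_def PiE_iff extensional_def)

lemma bij_betw_site_shift:
  assumes "N \<ge> 1"
  shows "bij_betw (\<lambda>z. (z + x) mod int N) (sites N) (sites N)"
proof (rule bij_betwI[where g = "\<lambda>z. (z - x) mod int N"])
  show "(\<lambda>z. (z + x) mod int N) \<in> sites N \<rightarrow> sites N" "(\<lambda>z. (z - x) mod int N) \<in> sites N \<rightarrow> sites N"
    using assms by (auto simp: sites_def)
  show "((z + x) mod int N - x) mod int N = z" "((z - x) mod int N + x) mod int N = z" if "z \<in> sites N" for z
    using that by (auto simp: sites_def mod_diff_left_eq mod_add_left_eq)
qed

lemma sum_shift:
  assumes "N \<ge> 1"
  shows "(\<Sum>z\<in>sites N. g (shift N x \<eta> z)) = (\<Sum>z\<in>sites N. g (\<eta> z))"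
  using sum.reindex_bij_betw[OF bij_betw_site_shift[OF assms, of x], of "\<lambda>z. g (\<eta> z)"]
  by (simp add: shift_def)

text \<open>The translate of \<open>f\<close> agrees with \<open>f\<close> on configurations only;
  \<open>linear_operator_on\<close> guarantees that \<open>L01\<close> does not see the
  difference.\<close>

lemma bond_op_shift_invariant:
  assumes L: "linear_operator_on (configs N S) V L01" and f: "f \<in> V"
    and inv: "\<And>\<eta> x. \<eta> \<in> configs N S \<Longrightarrow> f (shift N x \<eta>) = f \<eta>" and \<eta>: "\<eta> \<in> configs N S"
  shows "bond_op N L01 x f \<eta> = L01 f (shift N x \<eta>)"
proof -
  have "\<forall>\<zeta>\<in>configs N S. f \<zeta> = tau N (- x) f \<zeta>" using inv by (simp add: tau_def)
  then have "\<forall>\<zeta>\<in>configs N S. L01 f \<zeta> = L01 (tau N (- x) f) \<zeta>"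
    using L f unfolding linear_operator_on_def by blast
  then show ?thesis using shift_in_configs[OF \<eta>] by (simp add: bond_op_def tau_def)
qed

text \<open>Take \<open>G = 1\<close> in (A2) and apply (A1).\<close>

lemma A2_sum01_vanish:
  assumes "A1 N S L01" "A2 N S V L01" "F \<in> V" "(\<lambda>_. 1) \<in> V" "depends_on_sum01 N S F" "\<eta> \<in> configs N S"
  shows "L01 F \<eta> = 0"
proof -
  have "L01 F \<eta> = F \<eta> * L01 (\<lambda>_. 1) \<eta>"
    using assms(2)[unfolded A2_def, rule_format, of F "\<lambda>_. 1" \<eta>] assms by simp
  then show ?thesis using assms by (simp add: A1_def)
qed

text \<open>On a single site the neighbour of 0 is 0 itself, so every function depends on the sum
  alone. This rules out \<open>N = 1\<close>, where (A6.2) would be contradicted.\<close>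

lemma one_site_product_vanish:
  assumes "A1 1 S L01" "A2 1 S (polys 1 S 2) L01" "\<eta> \<in> configs 1 S"
  shows "L01 (\<lambda>\<eta>. \<eta> 0 * \<eta> (1 mod int 1)) \<eta> = 0"
proof (rule A2_sum01_vanish[OF assms(1,2) _ const_in_polys _ assms(3)])
  show "(\<lambda>\<eta>. \<eta> 0 * \<eta> (1 mod int 1)) \<in> polys 1 S 2"
    using quadratic_monomial_in_polys[of 0 1 0 S] by (simp add: sites_def)
  show "depends_on_sum01 1 S (\<lambda>\<eta>. \<eta> 0 * \<eta> (1 mod int 1))"
    by (auto simp: depends_on_sum01_def)
qed

text \<open>The sum of the squares differs from \<open>-2 * \<eta> 0 * \<eta> 1\<close> by a function of \<open>\<eta> 0 + \<eta> 1\<close> and the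
  other sites.\<close>

lemma L01_sum_squares:
  assumes N: "N \<ge> 2" and L: "linear_operator_on (configs N S) (polys N S 2) L01"
    and A: "A1 N S L01" "A2 N S (polys N S 2) L01" and \<eta>: "\<eta> \<in> configs N S"
  shows "L01 (\<lambda>\<eta>. \<Sum>z\<in>sites N. (\<eta> z)\<^sup>2) \<eta> = - 2 * L01 (\<lambda>\<eta>. \<eta> 0 * \<eta> (1 mod int N)) \<eta>"
proof -
  define g where "g = (\<lambda>\<eta>::config. \<eta> 0 * \<eta> (1 mod int N))"
  define F where "F = (\<lambda>\<eta>::config. 1 * (\<Sum>z\<in>sites N. (\<eta> z)\<^sup>2) + 2 * g \<eta>)"
  have m: "1 mod int N = 1" "0 \<in> sites N" "1 \<in> sites N" using N by (auto simp: sites_def)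
  have g: "g \<in> polys N S 2" unfolding g_def m using m by (intro quadratic_monomial_in_polys)
  have "(\<lambda>\<eta>. \<Sum>z\<in>sites N. (\<eta> z)\<^sup>2) \<in> polys N S 2"
    unfolding power2_eq_square by (intro polys_sum quadratic_monomial_in_polys) auto
  then have F: "F \<in> polys N S 2" unfolding F_def using g by (rule polys_linear_comb)
  have F': "F \<eta> = (\<eta> 0 + \<eta> 1)\<^sup>2 + (\<Sum>z\<in>sites N - {0, 1}. (\<eta> z)\<^sup>2)" for \<eta>
  proof -
    have "(\<Sum>z\<in>sites N. (\<eta> z)\<^sup>2) = (\<Sum>z\<in>{0,1}. (\<eta> z)\<^sup>2) + (\<Sum>z\<in>sites N - {0, 1}. (\<eta> z)\<^sup>2)"
      using m by (subst add.commute, intro sum.subset_diff) auto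
    then show ?thesis by (simp add: F_def g_def m power2_eq_square algebra_simps)
  qed
  have "depends_on_sum01 N S F"
    unfolding depends_on_sum01_def m
  proof (intro ballI impI)
    fix \<eta> \<zeta> :: config
    assume *: "(\<forall>y\<in>sites N - {0, 1}. \<eta> y = \<zeta> y) \<and> \<eta> 0 + \<eta> 1 = \<zeta> 0 + \<zeta> 1"
    then have "(\<Sum>z\<in>sites N - {0, 1}. (\<eta> z)\<^sup>2) = (\<Sum>z\<in>sites N - {0, 1}. (\<zeta> z)\<^sup>2)"
      by (intro sum.cong) auto
    then show "F \<eta> = F \<zeta>" using * unfolding F' by metis
  qed
  then have "L01 F \<eta> = 0" by (rule A2_sum01_vanish[OF A F const_in_polys _ \<eta>])
  moreover have "L01 (\<lambda>\<eta>. 1 * F \<eta> + (- 2) * g \<eta>) \<eta> = 1 * L01 F \<eta> + (- 2) * L01 g \<eta>"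
    using L F g \<eta> unfolding linear_operator_on_def by blast
  moreover have "(\<lambda>\<eta>. 1 * F \<eta> + (- 2) * g \<eta>) = (\<lambda>\<eta>. \<Sum>z\<in>sites N. (\<eta> z)\<^sup>2)"
    by (auto simp: F_def)
  ultimately show ?thesis by (simp add: g_def)
qed

lemma product_site_integrals:
  fixes \<mu> :: "real measure"
  assumes \<mu>: "prob_space \<mu>" and i1: "integrable \<mu> (\<lambda>s. s)" and i2: "integrable \<mu> (\<lambda>s. s\<^sup>2)"
    and x: "x \<in> sites N"
  shows "integrable (PiM (sites N) (\<lambda>_. \<mu>)) (\<lambda>\<eta>. \<eta> x)" "(\<integral>\<eta>. \<eta> x \<partial>PiM (sites N) (\<lambda>_. \<mu>)) = (\<integral>s. s \<partial>\<mu>)"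
    "integrable (PiM (sites N) (\<lambda>_. \<mu>)) (\<lambda>\<eta>. (\<eta> x)\<^sup>2)" "(\<integral>\<eta>. (\<eta> x)\<^sup>2 \<partial>PiM (sites N) (\<lambda>_. \<mu>)) = (\<integral>s. s\<^sup>2 \<partial>\<mu>)"
    "y \<in> sites N \<Longrightarrow> y \<noteq> x \<Longrightarrow> integrable (PiM (sites N) (\<lambda>_. \<mu>)) (\<lambda>\<eta>. \<eta> x * \<eta> y)"
    "y \<in> sites N \<Longrightarrow> y \<noteq> x \<Longrightarrow> (\<integral>\<eta>. \<eta> x * \<eta> y \<partial>PiM (sites N) (\<lambda>_. \<mu>)) = (\<integral>s. s \<partial>\<mu>)\<^sup>2"
proof -
  interpret \<mu>: prob_space \<mu> by fact
  interpret product_sigma_finite "\<lambda>_::int. \<mu>" by standard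
  let ?P = "PiM (sites N) (\<lambda>_. \<mu>)"
  have D: "distr ?P \<mu> (\<lambda>\<eta>. \<eta> x) = \<mu>" using distr_PiM_component[of "sites N" "\<lambda>_. \<mu>" x] \<mu> x by auto
  have meas: "(\<lambda>\<eta>. \<eta> x) \<in> measurable ?P \<mu>" using x by (rule measurable_component_singleton)
  have 1: "integrable ?P (\<lambda>\<eta>. f (\<eta> x)) \<and> (\<integral>\<eta>. f (\<eta> x) \<partial>?P) = (\<integral>s. f s \<partial>\<mu>)"
    if f: "integrable \<mu> f" for f :: "real \<Rightarrow> real"
  proof -
    have [measurable]: "f \<in> borel_measurable \<mu>" using f by simp
    have "integrable (distr ?P \<mu> (\<lambda>\<eta>. \<eta> x)) f" using f D by simp
    then have "integrable ?P (\<lambda>\<eta>. f (\<eta> x))" by (rule integrable_distr[OF meas])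
    moreover have "(\<integral>\<eta>. f (\<eta> x) \<partial>?P) = (\<integral>s. f s \<partial>distr ?P \<mu> (\<lambda>\<eta>. \<eta> x))"
      by (rule integral_distr[OF meas, symmetric]) simp
    ultimately show ?thesis using D by simp
  qed
  show "integrable ?P (\<lambda>\<eta>. \<eta> x)" "(\<integral>\<eta>. \<eta> x \<partial>?P) = (\<integral>s. s \<partial>\<mu>)" using 1[OF i1] by auto
  show "integrable ?P (\<lambda>\<eta>. (\<eta> x)\<^sup>2)" "(\<integral>\<eta>. (\<eta> x)\<^sup>2 \<partial>?P) = (\<integral>s. s\<^sup>2 \<partial>\<mu>)" using 1[OF i2] by auto
  assume y: "y \<in> sites N" "y \<noteq> x"
  \<comment> \<open>Identity at \<open>x\<close> and \<open>y\<close>, constant 1 elsewhere: the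
    product over all sites is then \<open>\<eta> x * \<eta> y\<close>, and independence
    applies.\<close>
  define f where "f = (\<lambda>z (s::real). (if z = x then s else 1) * (if z = y then s else 1))"
  have fx: "f x = (\<lambda>s. s)" "f y = (\<lambda>s. s)" using y by (auto simp: f_def)
  have fz: "f z = (\<lambda>s. 1)" if "z \<noteq> x" "z \<noteq> y" for z using that by (auto simp: f_def)
  have fi: "integrable \<mu> (f z)" for z
    using i1 fx fz[of z] by (cases "z = x"; cases "z = y") simp_all
  have fp: "(\<Prod>z\<in>sites N. f z (\<eta> z)) = \<eta> x * \<eta> y" for \<eta>
    using x y by (simp add: f_def prod.distrib prod.delta)
  show "integrable ?P (\<lambda>\<eta>. \<eta> x * \<eta> y)"
    using product_integrable_prod[of "sites N" f, OF finite_sites fi] unfolding fp .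
  have "(\<integral>\<eta>. \<eta> x * \<eta> y \<partial>?P) = (\<Prod>z\<in>sites N. \<integral>s. f z s \<partial>\<mu>)"
    using product_integral_prod[of "sites N" f, OF finite_sites fi] unfolding fp .
  also have "\<dots> = (\<Prod>z\<in>sites N. (if z = x then \<integral>s. s \<partial>\<mu> else 1) * (if z = y then \<integral>s. s \<partial>\<mu> else 1))"
  proof (intro prod.cong refl)
    fix z show "(\<integral>s. f z s \<partial>\<mu>) = (if z = x then \<integral>s. s \<partial>\<mu> else 1) * (if z = y then \<integral>s. s \<partial>\<mu> else 1)"
      using y fx fz[of z] by (cases "z = x"; cases "z = y") (simp_all add: \<mu>.prob_space)
  qed
  also have "\<dots> = (\<integral>s. s \<partial>\<mu>)\<^sup>2"
    using x y by (simp add: prod.distrib prod.delta power2_eq_square)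
  finally show "(\<integral>\<eta>. \<eta> x * \<eta> y \<partial>?P) = (\<integral>s. s \<partial>\<mu>)\<^sup>2" .
qed

lemma second_moment_identity:
  assumes N: "N \<ge> 2" and L: "linear_operator_on (configs N S) (polys N S 2) L01"
    and A: "A1 N S L01" "A2 N S (polys N S 2) L01"
    and prod: "\<And>\<eta>. \<eta> \<in> configs N S \<Longrightarrow> L01 (\<lambda>\<eta>. \<eta> 0 * \<eta> (1 mod int N)) \<eta> =
        a * ((\<eta> 0)\<^sup>2 + (\<eta> (1 mod int N))\<^sup>2) + b * (\<eta> 0 * \<eta> (1 mod int N)) +
        c * (\<eta> 0 + \<eta> (1 mod int N)) + d"
    and \<mu>: "prob_space \<mu>" "space \<mu> = S" "integrable \<mu> (\<lambda>s. s)" "integrable \<mu> (\<lambda>s. s\<^sup>2)"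
    and inv: "\<And>f. f \<in> polys N S 2 \<Longrightarrow> (\<integral>\<eta>. full_op N L01 f \<eta> \<partial>PiM (sites N) (\<lambda>_. \<mu>)) = 0"
  shows "2 * a * (\<integral>s. s\<^sup>2 \<partial>\<mu>) + b * (\<integral>s. s \<partial>\<mu>)\<^sup>2 + 2 * c * (\<integral>s. s \<partial>\<mu>) + d = 0"
proof -
  let ?P = "PiM (sites N) (\<lambda>_. \<mu>)"
  interpret P: prob_space ?P using \<mu>(1) by (intro prob_space_PiM)
  define f where "f = (\<lambda>\<eta>::config. \<Sum>z\<in>sites N. (\<eta> z)\<^sup>2)"
  have f: "f \<in> polys N S 2" unfolding f_def power2_eq_square
    by (intro polys_sum quadratic_monomial_in_polys) auto
  \<comment> \<open>The right neighbour; for \<open>N \<ge> 2\<close> it is a different site, so the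
    two coordinates are independent.\<close>
  define s where "s = (\<lambda>x. (x + 1) mod int N)"
  have s: "s x \<in> sites N" "s x \<noteq> x" if "x \<in> sites N" for x
  proof -
    show "s x \<in> sites N" using N by (simp add: s_def sites_def)
    show "s x \<noteq> x" using that N by (cases "x + 1 = int N") (auto simp: s_def sites_def)
  qed
  \<comment> \<open>The polynomial of (A6.2), moved to the bond from \<open>x\<close> to
    \<open>s x\<close>.\<close>
  define G where "G = (\<lambda>\<eta> x. a * ((\<eta> x)\<^sup>2 + (\<eta> (s x))\<^sup>2) + b * (\<eta> x * \<eta> (s x)) + c * (\<eta> x + \<eta> (s x)) + d)"
  have m: "1 mod int N = 1" "0 \<in> sites N" "1 \<in> sites N" using N by (auto simp: sites_def)
  have bond: "bond_op N L01 x f \<eta> = - 2 * G \<eta> x" if \<eta>: "\<eta> \<in> configs N S" and x: "x \<in> sites N" for \<eta> x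
  proof -
    have "bond_op N L01 x f \<eta> = L01 f (shift N x \<eta>)"
      by (rule bond_op_shift_invariant[OF L f _ \<eta>]) (use N in \<open>simp add: f_def sum_shift[where g = "\<lambda>u. u\<^sup>2"]\<close>)
    also have "\<dots> = - 2 * L01 (\<lambda>\<eta>. \<eta> 0 * \<eta> (1 mod int N)) (shift N x \<eta>)"
      unfolding f_def by (rule L01_sum_squares[OF N L A shift_in_configs[OF \<eta>]])
    also have "\<dots> = - 2 * G \<eta> x"
    proof -
      have "shift N x \<eta> 0 = \<eta> x" "shift N x \<eta> 1 = \<eta> (s x)"
        using x m by (auto simp: shift_def s_def sites_def add.commute)
      then show ?thesis unfolding prod[OF shift_in_configs[OF \<eta>]] by (simp add: G_def m)
    qed
    finally show ?thesis .
  qed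
  let ?m = "\<integral>s. s \<partial>\<mu>" and ?q = "\<integral>s. s\<^sup>2 \<partial>\<mu>"
  note I = product_site_integrals[OF \<mu>(1,3,4)]
  have sp: "space ?P = configs N S" by (simp add: space_PiM \<mu>(2) configs_def)
  have GI: "integrable ?P (\<lambda>\<eta>. G \<eta> x)" "(\<integral>\<eta>. G \<eta> x \<partial>?P) = 2 * a * ?q + b * ?m\<^sup>2 + 2 * c * ?m + d"
    if x: "x \<in> sites N" for x
    unfolding G_def using I(1-4)[OF x] I(5,6)[OF x s[OF x]] I(1-4)[OF s(1)[OF x]] by (simp_all add: P.prob_space)
  have "0 = (\<integral>\<eta>. full_op N L01 f \<eta> \<partial>?P)" using inv[OF f] by simp
  also have "\<dots> = (\<integral>\<eta>. (\<Sum>x\<in>sites N. - 2 * G \<eta> x) \<partial>?P)"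
    by (intro Bochner_Integration.integral_cong refl) (simp add: sp full_op_def bond)
  also have "\<dots> = (\<Sum>x\<in>sites N. - 2 * (2 * a * ?q + b * ?m\<^sup>2 + 2 * c * ?m + d))"
    by (subst Bochner_Integration.integral_sum) (use GI in \<open>auto intro!: sum.cong\<close>)
  \<comment> \<open>All bonds have the same expectation, so the sum is a nonzero multiple of the
    claimed expression.\<close>
  also have "\<dots> = - 2 * real N * (2 * a * ?q + b * ?m\<^sup>2 + 2 * c * ?m + d)"
    by (simp only: sum_constant mult.assoc) (simp add: sites_def mult.left_commute)
  finally show ?thesis using N by auto
qed

section \<open>Natural exponential families\<close>

locale exponential_family =
  fixes S :: "real set" and \<mu>0 :: "real measure"
  assumes S: "S \<in> sets borel" and base: "nef_base S \<mu>0"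
begin

sublocale \<mu>0: prob_space \<mu>0 using base by (simp add: nef_base_def)

lemma sets_base: "sets \<mu>0 = sets (restrict_space borel S)" using base by (simp add: nef_base_def)

lemma space_base: "space \<mu>0 = S"
  using sets_eq_imp_space_eq[OF sets_base] by (simp add: space_restrict_space)

lemma id_measurable [measurable]: "(\<lambda>s. s) \<in> borel_measurable \<mu>0"
  unfolding measurable_cong_sets[OF sets_base refl] by (rule measurable_restrict_space1) simp

lemma borel_measurable_base: "f \<in> borel_measurable borel \<Longrightarrow> f \<in> borel_measurable \<mu>0"
  using measurable_compose[OF id_measurable] by auto

lemma nef_dom_iff: "l \<in> nef_dom \<mu>0 \<longleftrightarrow> integrable \<mu>0 (\<lambda>s. exp (l * s))"
  by (simp add: nef_dom_def integrable_iff_bounded borel_measurable_base)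

lemma zero_in_nef_dom: "0 \<in> nef_dom \<mu>0" by (simp add: nef_dom_iff)

lemma convex_nef_dom: "convex (nef_dom \<mu>0)"
proof -
  have "y \<in> nef_dom \<mu>0" if x: "x \<in> nef_dom \<mu>0" and z: "z \<in> nef_dom \<mu>0" and "x \<le> y" "y \<le> z" for x y z
    unfolding nef_dom_iff
  proof (rule Bochner_Integration.integrable_bound)
    show "integrable \<mu>0 (\<lambda>s. exp (x * s) + exp (z * s))"
      using x z by (intro Bochner_Integration.integrable_add) (auto simp: nef_dom_iff)
    have "exp (y * s) \<le> exp (x * s) + exp (z * s)" for s
    proof (cases "s \<ge> 0")
      case True
      then have "exp (y * s) \<le> exp (z * s)" using that by (simp add: mult_right_mono)
      then show ?thesis by (simp add: add_increasing)
    next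
      case False
      then have "exp (y * s) \<le> exp (x * s)" using that by (simp add: mult_right_mono_neg)
      then show ?thesis by (simp add: add_increasing2)
    qed
    then show "AE s in \<mu>0. norm (exp (y * s)) \<le> norm (exp (x * s) + exp (z * s))"
      by (intro AE_I2) (simp add: add_nonneg_nonneg)
  qed (simp add: borel_measurable_base)
  then have "is_interval (nef_dom \<mu>0)" unfolding is_interval_1 by blast
  then show ?thesis by (simp only: is_interval_convex_1)
qed

text \<open>0 lies in the domain because \<open>\<mu>0\<close> is finite, and the domain is not a
  singleton, so by convexity it contains a whole segment.\<close>

lemma interior_nef_dom_nonempty: "interior (nef_dom \<mu>0) \<noteq> {}"
proof -
  have "nef_dom \<mu>0 \<noteq> {0}" using base unfolding nef_base_def is_singleton_def by blast
  then obtain l where l: "l \<in> nef_dom \<mu>0" "l \<noteq> 0" using zero_in_nef_dom by blast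
  have "{min 0 l<..<max 0 l} \<subseteq> nef_dom \<mu>0"
  proof
    fix y assume "y \<in> {min 0 l<..<max 0 l}"
    then have "y \<in> closed_segment 0 l" by (auto simp: closed_segment_eq_real_ivl min_def max_def split: if_splits)
    then show "y \<in> nef_dom \<mu>0"
      using closed_segment_subset[OF zero_in_nef_dom l(1) convex_nef_dom] by blast
  qed
  then have "{min 0 l<..<max 0 l} \<subseteq> interior (nef_dom \<mu>0)" by (intro interior_maximal) auto
  moreover have "(min 0 l + max 0 l) / 2 \<in> {min 0 l<..<max 0 l}" using l by auto
  ultimately show ?thesis by blast
qed

lemma convex_interior_nef_dom: "convex (interior (nef_dom \<mu>0))"
  by (rule convex_interior[OF convex_nef_dom])

lemma nef_Z_pos:
  assumes "l \<in> nef_dom \<mu>0"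
  shows "nef_Z \<mu>0 l > 0"
proof -
  have i: "integrable \<mu>0 (\<lambda>s. exp (l * s))" using assms by (simp add: nef_dom_iff)
  have "nef_Z \<mu>0 l \<noteq> 0"
  proof
    assume "nef_Z \<mu>0 l = 0"
    then have "AE s in \<mu>0. exp (l * s) = 0"
      unfolding nef_Z_def using integral_nonneg_eq_0_iff_AE[OF i] by simp
    then show False by (simp add: \<mu>0.AE_False)
  qed
  moreover have "nef_Z \<mu>0 l \<ge> 0" unfolding nef_Z_def by (rule Bochner_Integration.integral_nonneg) simp
  ultimately show ?thesis by simp
qed

lemma nef_integral:
  fixes f :: "real \<Rightarrow> real"
  assumes l: "l \<in> nef_dom \<mu>0" and f: "f \<in> borel_measurable \<mu>0"
  shows "integrable (nef \<mu>0 l) f \<longleftrightarrow> integrable \<mu>0 (\<lambda>s. f s * exp (l * s))"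
    and "(\<integral>s. f s \<partial>nef \<mu>0 l) = (\<integral>s. f s * exp (l * s) \<partial>\<mu>0) / nef_Z \<mu>0 l"
proof -
  note Z = nef_Z_pos[OF l]
  have m: "(\<lambda>s. exp (l * s) / nef_Z \<mu>0 l) \<in> borel_measurable \<mu>0" by (simp add: borel_measurable_base)
  have e: "(exp (l * s) / nef_Z \<mu>0 l) *\<^sub>R f s = (1 / nef_Z \<mu>0 l) * (f s * exp (l * s))" for s by simp
  have nn: "AE s in \<mu>0. 0 \<le> exp (l * s) / nef_Z \<mu>0 l" using Z by simp
  show "integrable (nef \<mu>0 l) f \<longleftrightarrow> integrable \<mu>0 (\<lambda>s. f s * exp (l * s))"
    unfolding nef_def integrable_density[OF f m nn] e using Z by (subst integrable_mult_left_iff) simp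
  show "(\<integral>s. f s \<partial>nef \<mu>0 l) = (\<integral>s. f s * exp (l * s) \<partial>\<mu>0) / nef_Z \<mu>0 l"
    unfolding nef_def integral_density[OF f m nn] e by (subst integral_mult_right_zero) simp
qed

lemma space_nef: "space (nef \<mu>0 l) = S" by (simp add: nef_def space_base)

lemma prob_space_nef:
  assumes l: "l \<in> nef_dom \<mu>0"
  shows "prob_space (nef \<mu>0 l)"
proof (rule prob_spaceI)
  have i: "integrable \<mu>0 (\<lambda>s. exp (l * s) / nef_Z \<mu>0 l)" using l by (simp add: nef_dom_iff)
  have "emeasure (nef \<mu>0 l) (space (nef \<mu>0 l)) = (\<integral>\<^sup>+s. ennreal (exp (l * s) / nef_Z \<mu>0 l) \<partial>\<mu>0)"
    unfolding nef_def by (subst emeasure_density) (auto intro!: nn_integral_cong simp: borel_measurable_base)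
  also have "\<dots> = ennreal (\<integral>s. exp (l * s) / nef_Z \<mu>0 l \<partial>\<mu>0)"
    using nef_Z_pos[OF l] by (intro nn_integral_eq_integral i) simp
  also have "(\<integral>s. exp (l * s) / nef_Z \<mu>0 l \<partial>\<mu>0) = 1"
    using nef_Z_pos[OF l] by (simp add: nef_Z_def)
  finally show "emeasure (nef \<mu>0 l) (space (nef \<mu>0 l)) = 1" by simp
qed

definition raw_moment :: "nat \<Rightarrow> real \<Rightarrow> real" where
  "raw_moment n l = (\<integral>s. s ^ n * exp (l * s) \<partial>\<mu>0)"

lemma interior_nef_domE:
  assumes "l \<in> interior (nef_dom \<mu>0)"
  obtains \<delta> where "\<delta> > 0" "\<And>h. \<bar>h\<bar> < \<delta> \<Longrightarrow> l + h \<in> interior (nef_dom \<mu>0)"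
proof -
  obtain \<delta> where \<delta>: "\<delta> > 0" "ball l \<delta> \<subseteq> interior (nef_dom \<mu>0)"
    using assms open_interior open_contains_ball by blast
  show ?thesis using \<delta> by (intro that[of \<delta>]) (auto simp: dist_real_def subset_iff)
qed

lemma raw_moment_derivative:
  assumes l: "l \<in> interior (nef_dom \<mu>0)"
  shows "integrable \<mu>0 (\<lambda>s. s ^ n * exp (l * s))"
    and "(raw_moment n has_real_derivative raw_moment (Suc n) l) (at l)"
proof -
  obtain \<delta> where \<delta>: "\<delta> > 0" "\<And>h. \<bar>h\<bar> < \<delta> \<Longrightarrow> l + h \<in> interior (nef_dom \<mu>0)"
    using interior_nef_domE[OF l] by blast
  have d: "\<delta> / 2 > 0" "l + \<delta> / 2 \<in> nef_dom \<mu>0" "l - \<delta> / 2 \<in> nef_dom \<mu>0"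
    using \<delta>(1) \<delta>(2)[of "\<delta> / 2"] \<delta>(2)[of "- \<delta> / 2"] interior_subset by auto
  have "integrable \<mu>0 (\<lambda>s. exp (\<delta> / 2 * \<bar>s\<bar>) * exp (l * s))"
    using d by (intro integrable_exp_abs) (auto simp: nef_dom_iff)
  then have i: "integrable \<mu>0 (\<lambda>s. exp (\<delta> / 2 * \<bar>s\<bar>) * norm (exp (l * of_real s)))" by simp
  show "integrable \<mu>0 (\<lambda>s. s ^ n * exp (l * s))"
    using laplace_moment_integrable[OF id_measurable d(1) i, of n] by simp
  show "(raw_moment n has_real_derivative raw_moment (Suc n) l) (at l)"
    using laplace_moment_derivative(2)[OF id_measurable d(1) i, of n] by (simp add: raw_moment_def[abs_def])
qed

lemma raw_moment_0: "raw_moment 0 = nef_Z \<mu>0" by (simp add: fun_eq_iff raw_moment_def nef_Z_def)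

section \<open>Mean and variance along the family\<close>

definition mean :: "real \<Rightarrow> real" where "mean l = (\<integral>s. s \<partial>nef \<mu>0 l)"

definition var :: "real \<Rightarrow> real" where "var l = (\<integral>s. s\<^sup>2 \<partial>nef \<mu>0 l) - (mean l)\<^sup>2"

lemma
  assumes l: "l \<in> interior (nef_dom \<mu>0)"
  shows nef_integrable: "integrable (nef \<mu>0 l) (\<lambda>s. s)" "integrable (nef \<mu>0 l) (\<lambda>s. s\<^sup>2)"
    and mean_eq: "mean l = raw_moment 1 l / nef_Z \<mu>0 l"
    and second_eq: "(\<integral>s. s\<^sup>2 \<partial>nef \<mu>0 l) = raw_moment 2 l / nef_Z \<mu>0 l"
proof -
  have l': "l \<in> nef_dom \<mu>0" using l interior_subset by blast
  show "integrable (nef \<mu>0 l) (\<lambda>s. s)"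
    using nef_integral(1)[OF l', of "\<lambda>s. s"] raw_moment_derivative(1)[OF l, of 1] by simp
  show "integrable (nef \<mu>0 l) (\<lambda>s. s\<^sup>2)"
    using nef_integral(1)[OF l', of "\<lambda>s. s\<^sup>2"] raw_moment_derivative(1)[OF l, of 2] by (simp add: borel_measurable_base)
  show "mean l = raw_moment 1 l / nef_Z \<mu>0 l"
    using nef_integral(2)[OF l', of "\<lambda>s. s"] by (simp add: mean_def raw_moment_def)
  show "(\<integral>s. s\<^sup>2 \<partial>nef \<mu>0 l) = raw_moment 2 l / nef_Z \<mu>0 l"
    using nef_integral(2)[OF l', of "\<lambda>s. s\<^sup>2"] by (simp add: raw_moment_def borel_measurable_base)
qed

lemma ln_Z_derivative:
  assumes l: "l \<in> interior (nef_dom \<mu>0)"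
  shows "((\<lambda>l. ln (nef_Z \<mu>0 l)) has_real_derivative mean l) (at l)"
proof -
  have Z: "nef_Z \<mu>0 l > 0" using l interior_subset nef_Z_pos by blast
  have "(nef_Z \<mu>0 has_real_derivative raw_moment 1 l) (at l)"
    using raw_moment_derivative(2)[OF l, of 0] by (simp add: raw_moment_0)
  then show ?thesis using Z by (auto intro!: derivative_eq_intros simp: mean_eq[OF l])
qed

text \<open>The variance is the second derivative of \<open>ln (nef_Z \<mu>0 l)\<close>, which is
  what turns a variance formula into a differential equation.\<close>

lemma mean_derivative:
  assumes l: "l \<in> interior (nef_dom \<mu>0)"
  shows "(mean has_real_derivative var l) (at l)"
proof -
  have Z: "nef_Z \<mu>0 l > 0" using l interior_subset nef_Z_pos by blast
  have D: "(nef_Z \<mu>0 has_real_derivative raw_moment 1 l) (at l)" "(raw_moment 1 has_real_derivative raw_moment 2 l) (at l)"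
    using raw_moment_derivative(2)[OF l, of 0] raw_moment_derivative(2)[OF l, of 1] by (simp_all add: raw_moment_0 numeral_2_eq_2)
  have "((\<lambda>l. raw_moment 1 l / nef_Z \<mu>0 l) has_real_derivative
      (raw_moment 2 l * nef_Z \<mu>0 l - raw_moment 1 l * raw_moment 1 l) / (nef_Z \<mu>0 l * nef_Z \<mu>0 l)) (at l)"
    using Z by (intro DERIV_divide D) simp
  also have "(raw_moment 2 l * nef_Z \<mu>0 l - raw_moment 1 l * raw_moment 1 l) / (nef_Z \<mu>0 l * nef_Z \<mu>0 l) = var l"
    unfolding var_def mean_eq[OF l] second_eq[OF l] using Z by (simp add: power2_eq_square field_simps)
  finally show ?thesis
    by (rule has_field_derivative_transform_within_open[OF _ open_interior l]) (simp add: mean_eq)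
qed

text \<open>The tilting density is positive, so zero variance would concentrate
  \<open>\<mu>0\<close> itself at one point, contrary to \<open>nef_base\<close>.\<close>

lemma var_pos:
  assumes l: "l \<in> interior (nef_dom \<mu>0)"
  shows "var l > 0"
proof -
  have l': "l \<in> nef_dom \<mu>0" using l interior_subset by blast
  interpret nef: prob_space "nef \<mu>0 l" by (rule prob_space_nef[OF l'])
  note I = nef_integrable[OF l]
  have v: "var l = (\<integral>s. (s - mean l)\<^sup>2 \<partial>nef \<mu>0 l)"
    using nef.variance_eq[OF I] by (simp add: var_def mean_def)
  have i: "integrable (nef \<mu>0 l) (\<lambda>s. (s - mean l)\<^sup>2)"
    using I by (simp add: power2_diff)
  have "var l \<noteq> 0"
  proof
    assume "var l = 0"
    then have "AE s in nef \<mu>0 l. (s - mean l)\<^sup>2 = 0"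
      unfolding v using integral_nonneg_eq_0_iff_AE[OF i] by simp
    then have "AE s in \<mu>0. 0 < exp (l * s) / nef_Z \<mu>0 l \<longrightarrow> s = mean l"
      unfolding nef_def by (subst (asm) AE_density) (auto simp: borel_measurable_base)
    then have ae: "AE s in \<mu>0. s = mean l" using nef_Z_pos[OF l'] by simp
    have "\<mu>0 = return (restrict_space borel S) (mean l)"
    proof (rule measure_eqI)
      show "sets \<mu>0 = sets (return (restrict_space borel S) (mean l))" by (simp add: sets_base)
      fix A assume A: "A \<in> sets \<mu>0"
      have A': "A \<in> sets (restrict_space borel S)" using A sets_base by simp
      show "emeasure \<mu>0 A = emeasure (return (restrict_space borel S) (mean l)) A"
      proof (cases "mean l \<in> A")
        case True
        then have "AE s in \<mu>0. s \<in> A" using ae by auto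
        then have "emeasure \<mu>0 A = 1" using A by (rule \<mu>0.emeasure_eq_1_AE[rotated])
        then show ?thesis using True A' by simp
      next
        case False
        then have "AE s in \<mu>0. s \<notin> A" using ae by auto
        then have "emeasure \<mu>0 A = 0" using A AE_iff_measurable[of A \<mu>0 "\<lambda>s. s \<notin> A"] sets.sets_into_space by blast
        then show ?thesis using False A' by simp
      qed
    qed
    \<comment> \<open>\<open>nef_base\<close> excludes point masses at points of \<open>S\<close>,
      so the atom has to be located in \<open>S\<close>.\<close>
    moreover have "mean l \<in> S"
    proof (rule ccontr)
      assume "mean l \<notin> S"
      from ae AE_space[of \<mu>0] have "AE s in \<mu>0. False"
        by eventually_elim (use \<open>mean l \<notin> S\<close> in \<open>auto simp: space_base\<close>)
      then show False by (simp add: \<mu>0.AE_False)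
    qed
    ultimately show False using base unfolding nef_base_def by blast
  qed
  moreover have "var l \<ge> 0" unfolding v by (rule Bochner_Integration.integral_nonneg) simp
  ultimately show ?thesis by simp
qed

lemma mean_strict_mono:
  assumes "l < l'" "l \<in> interior (nef_dom \<mu>0)" "l' \<in> interior (nef_dom \<mu>0)"
  shows "mean l < mean l'"
proof (rule DERIV_pos_imp_increasing[OF assms(1)])
  fix x assume "l \<le> x" "x \<le> l'"
  then have "x \<in> closed_segment l l'" using assms(1) by (simp add: closed_segment_eq_real_ivl)
  then have "x \<in> interior (nef_dom \<mu>0)"
    using closed_segment_subset[OF assms(2,3) convex_interior_nef_dom] by blast
  then show "\<exists>y. (mean has_real_derivative y) (at x) \<and> 0 < y" using mean_derivative var_pos by blast
qed

lemma mean_inj: "inj_on mean (interior (nef_dom \<mu>0))"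
  by (rule linorder_inj_onI') (use mean_strict_mono in force)

lemma connected_mean_image: "connected (mean ` interior (nef_dom \<mu>0))"
proof (rule connected_continuous_image)
  show "continuous_on (interior (nef_dom \<mu>0)) mean"
    using mean_derivative by (intro continuous_at_imp_continuous_on ballI) (blast intro: DERIV_isCont)
  show "connected (interior (nef_dom \<mu>0))" by (rule convex_connected[OF convex_interior_nef_dom])
qed

text \<open>The mean takes three distinct values near any interior parameter, too many zeros for a
  nonzero quadratic.\<close>

lemma quadratic_in_mean_zero:
  assumes "\<And>l. l \<in> interior (nef_dom \<mu>0) \<Longrightarrow> b * (mean l)\<^sup>2 + 2 * c * mean l + d = 0"
  shows "b = 0 \<and> c = 0 \<and> d = 0"
proof -
  obtain l where l: "l \<in> interior (nef_dom \<mu>0)" using interior_nef_dom_nonempty by blast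
  obtain \<delta> where \<delta>: "\<delta> > 0" "\<And>h. \<bar>h\<bar> < \<delta> \<Longrightarrow> l + h \<in> interior (nef_dom \<mu>0)"
    using interior_nef_domE[OF l] by blast
  define x y z where "x = mean (l - \<delta> / 2)" and "y = mean l" and "z = mean (l + \<delta> / 2)"
  have i: "l - \<delta> / 2 \<in> interior (nef_dom \<mu>0)" "l + \<delta> / 2 \<in> interior (nef_dom \<mu>0)"
    using \<delta>(1) \<delta>(2)[of "- \<delta> / 2"] \<delta>(2)[of "\<delta> / 2"] by auto
  have xyz: "x < y" "y < z"
    using mean_strict_mono[OF _ i(1) l] mean_strict_mono[OF _ l i(2)] \<delta>(1) by (auto simp: x_def y_def z_def)
  have e: "b * x\<^sup>2 + 2 * c * x + d = 0" "b * y\<^sup>2 + 2 * c * y + d = 0" "b * z\<^sup>2 + 2 * c * z + d = 0"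
    using assms i l by (auto simp: x_def y_def z_def)
  \<comment> \<open>First divided differences; subtracting one from the other isolates
    \<open>b\<close>.\<close>
  have "(y - x) * (b * (y + x) + 2 * c) = 0" "(z - y) * (b * (z + y) + 2 * c) = 0"
    using e by (simp_all add: power2_eq_square algebra_simps)
  then have f: "b * (y + x) + 2 * c = 0" "b * (z + y) + 2 * c = 0" using xyz by auto
  have "b * (z - x) = (b * (z + y) + 2 * c) - (b * (y + x) + 2 * c)" by (simp add: algebra_simps)
  then have "b * (z - x) = 0" unfolding f by simp
  then have "b = 0" using xyz by auto
  then show ?thesis using f e by auto
qed

text \<open>\<open>nef\<close> lives on the Borel sets of \<open>S\<close>; the push-forward places
  it on the whole real line, as \<open>real_distribution\<close> requires.\<close>

definition law :: "real \<Rightarrow> real measure" where "law l = distr (nef \<mu>0 l) borel (\<lambda>s. s)"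

text \<open>Tilting the member \<open>l\<close> by \<open>h\<close> gives the member
  \<open>l + h\<close>, so the cumulant function is
  \<open>ln (nef_Z \<mu>0 (l + h)) - ln (nef_Z \<mu>0 l)\<close> and its derivative is the mean at
  \<open>l + h\<close>. The variance formula along the family becomes the equation in
  \<open>h\<close>.\<close>

lemma quad_cumulant_law:
  assumes l: "l \<in> interior (nef_dom \<mu>0)"
    and Q: "\<And>l. l \<in> interior (nef_dom \<mu>0) \<Longrightarrow> var l = v2 * (mean l)\<^sup>2 + v1 * mean l + v0"
  shows "quad_cumulant (law l) v2 v1 v0 (mean l)"
proof -
  have l': "l \<in> nef_dom \<mu>0" using l interior_subset by blast
  interpret nef: prob_space "nef \<mu>0 l" by (rule prob_space_nef[OF l'])
  have m: "(\<lambda>s. s) \<in> borel_measurable (nef \<mu>0 l)" by (simp add: nef_def)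
  obtain \<delta> where \<delta>: "\<delta> > 0" "\<And>h. \<bar>h\<bar> < \<delta> \<Longrightarrow> l + h \<in> interior (nef_dom \<mu>0)"
    using interior_nef_domE[OF l] by blast
  show ?thesis unfolding quad_cumulant_def
  proof (intro conjI exI allI impI)
    show "real_distribution (law l)" unfolding law_def by (rule nef.real_distribution_distr[OF m])
    show "\<delta> > 0" by fact
    show "(\<lambda>h. mean (l + h)) 0 = mean l" by simp
    fix h assume h: "\<bar>h\<bar> < \<delta>"
    note lh = \<delta>(2)[OF h]
    have lh': "l + h \<in> nef_dom \<mu>0" using lh interior_subset by blast
    have em: "(\<lambda>s. exp (h * s)) \<in> borel_measurable \<mu>0" by (simp add: borel_measurable_base)
    have e: "exp (h * s) * exp (l * s) = exp ((l + h) * s)" for s by (simp add: exp_add[symmetric] algebra_simps)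
    have "integrable (nef \<mu>0 l) (\<lambda>s. exp (h * s))"
      unfolding nef_integral(1)[OF l' em] e using lh' by (simp add: nef_dom_iff)
    then show "integrable (law l) (\<lambda>x. exp (h * x))"
      unfolding law_def by (subst integrable_distr_eq[OF m]) simp_all
    have "(\<integral>x. exp (h * x) \<partial>law l) = (\<integral>s. exp (h * s) \<partial>nef \<mu>0 l)"
      unfolding law_def by (rule integral_distr[OF m]) simp
    also have "\<dots> = nef_Z \<mu>0 (l + h) / nef_Z \<mu>0 l"
      unfolding nef_integral(2)[OF l' em] e by (simp add: nef_Z_def)
    also have "\<dots> = exp (ln (nef_Z \<mu>0 (l + h)) - ln (nef_Z \<mu>0 l))"
      using nef_Z_pos[OF l'] nef_Z_pos[OF lh'] by (simp add: exp_diff)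
    finally show "(\<integral>x. exp (h * x) \<partial>law l) = exp ((\<lambda>h. ln (nef_Z \<mu>0 (l + h)) - ln (nef_Z \<mu>0 l)) h)" .
    have "((\<lambda>h. ln (nef_Z \<mu>0 (l + h))) has_real_derivative mean (l + h)) (at h)"
      using DERIV_shift[of "\<lambda>l. ln (nef_Z \<mu>0 l)" "mean (l + h)" h l] ln_Z_derivative[OF lh]
      by (simp add: add.commute)
    from DERIV_diff[OF this DERIV_const]
    show "((\<lambda>h. ln (nef_Z \<mu>0 (l + h)) - ln (nef_Z \<mu>0 l)) has_real_derivative mean (l + h)) (at h)"
      by simp
    show "((\<lambda>h. mean (l + h)) has_real_derivative v2 * (mean (l + h))\<^sup>2 + v1 * mean (l + h) + v0) (at h)"
      using DERIV_shift[of mean "var (l + h)" h l] mean_derivative[OF lh] Q[OF lh]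
      by (simp add: add.commute)
  qed
qed

end

theorem theorem2p5:
  fixes N :: nat and S :: "real set" and \<mu>0 :: "real measure"
    and D :: "(config \<Rightarrow> real) set" and L01 :: "(config \<Rightarrow> real) \<Rightarrow> (config \<Rightarrow> real)"
    and \<Omega> :: "'w measure" and P :: "config \<Rightarrow> 'w measure" and Y :: "real \<Rightarrow> 'w \<Rightarrow> config"
    and p q r a b c d :: real
  assumes "N \<ge> 1" and "S \<in> sets borel" and "locally compact S"
    and "local_operator N S D L01"
    and "feller_process N S \<Omega> P Y"
    and "has_generator N S P Y D (full_op N L01)"
    and "basic_assumptions N S \<mu>0 D L01 P Y"
    and "basic_assumptions_polys N S \<mu>0 L01"
    and "A6_1 N S L01 \<Omega> P Y p q r"
    and "A6_2 N S L01 \<Omega> P Y a b c d"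
  shows "a \<noteq> 0 \<and>
    (\<exists>v0 v1 v2.
      (\<forall>\<rho>\<in>mean_dom N \<mu>0. prob_space.variance (nu N \<mu>0 \<rho>) (\<lambda>\<eta>. \<eta> 0) = v2 * \<rho>\<^sup>2 + v1 * \<rho> + v0) \<and>
      v2 = - b / (2 * a) - 1 \<and> v1 = - c / a \<and> v0 = - d / (2 * a)) \<and>
    (\<exists>A B w0 w1 w2. A \<noteq> 0 \<and>
      quadratic_variance (mean_dom N \<mu>0) (affine_marginal N \<mu>0 A B) w2 w1 w0 \<and>
      six_families (mean_dom N \<mu>0) (affine_marginal N \<mu>0 A B) w2 w1 w0)"
proof -
  have base: "nef_base S \<mu>0"
    using assms(7) by (simp add: basic_assumptions_def A4_def)
  have L: "linear_operator_on (configs N S) (polys N S 2) L01"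
    using assms(4) by (simp add: local_operator_def)
  have A: "A1 N S L01" "A2 N S (polys N S 2) L01"
    and inv: "\<And>l f. l \<in> interior (nef_dom \<mu>0) \<Longrightarrow> f \<in> polys N S 2 \<Longrightarrow>
        (\<integral>\<eta>. full_op N L01 f \<eta> \<partial>nu_bar N \<mu>0 l) = 0"
    using assms(8) by (simp_all add: basic_assumptions_polys_def)
  have prod: "\<And>\<eta>. \<eta> \<in> configs N S \<Longrightarrow> L01 (\<lambda>\<eta>. \<eta> 0 * \<eta> (1 mod int N)) \<eta> =
        a * ((\<eta> 0)\<^sup>2 + (\<eta> (1 mod int N))\<^sup>2) + b * (\<eta> 0 * \<eta> (1 mod int N)) +
        c * (\<eta> 0 + \<eta> (1 mod int N)) + d"
    and nonzero: "\<exists>\<eta>\<in>configs N S. L01 (\<lambda>\<eta>. \<eta> 0 * \<eta> (1 mod int N)) \<eta> \<noteq> 0"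
    using assms(10) unfolding A6_2_def by auto
  have N: "N \<ge> 2"
  proof (rule ccontr)
    assume "\<not> N \<ge> 2"
    then have "N = 1" using assms(1) by simp
    then show False using one_site_product_vanish A nonzero by blast
  qed
  interpret exponential_family S \<mu>0 by (rule exponential_family.intro) fact+
  define J where "J = interior (nef_dom \<mu>0)"
  have J_dom: "l \<in> nef_dom \<mu>0" if "l \<in> J" for l using that interior_subset unfolding J_def by blast
  have s0: "0 \<in> sites N" using N by (simp add: sites_def)
  have id: "2 * a * (\<integral>s. s\<^sup>2 \<partial>nef \<mu>0 l) + b * (mean l)\<^sup>2 + 2 * c * mean l + d = 0" if l: "l \<in> J" for l
    unfolding mean_def
  proof (rule second_moment_identity[OF N L A prod prob_space_nef[OF J_dom[OF l]] space_nef])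
    show "integrable (nef \<mu>0 l) (\<lambda>s. s)" "integrable (nef \<mu>0 l) (\<lambda>s. s\<^sup>2)"
      using nef_integrable l by (auto simp: J_def)
    show "(\<integral>\<eta>. full_op N L01 f \<eta> \<partial>Pi\<^sub>M (sites N) (\<lambda>_. nef \<mu>0 l)) = 0" if "f \<in> polys N S 2" for f
      using inv[OF _ that, of l] l by (simp add: J_def nu_bar_def)
  qed
  \<comment> \<open>With \<open>a = 0\<close> the second moment drops out and a quadratic in the
    mean vanishes identically; then \<open>L01\<close> annihilates the product of the neighbours,
    which (A6.2) excludes.\<close>
  have a: "a \<noteq> 0"
  proof
    assume "a = 0"
    then have "b = 0 \<and> c = 0 \<and> d = 0" using id by (intro quadratic_in_mean_zero) (simp add: J_def)
    then show False using nonzero prod \<open>a = 0\<close> by auto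
  qed
  define v2 v1 v0 where "v2 = - b / (2 * a) - 1" and "v1 = - c / a" and "v0 = - d / (2 * a)"
  have Q: "var l = v2 * (mean l)\<^sup>2 + v1 * mean l + v0" if l: "l \<in> J" for l
  proof -
    \<comment> \<open>The second moment is \<open>var l + (mean l)\<^sup>2\<close>; the square of
      the mean accounts for the summand \<open>- 1\<close> in \<open>v2\<close>.\<close>
    have "2 * a * (var l - (v2 * (mean l)\<^sup>2 + v1 * mean l + v0)) =
        2 * a * (\<integral>s. s\<^sup>2 \<partial>nef \<mu>0 l) + b * (mean l)\<^sup>2 + 2 * c * mean l + d"
      using a by (simp add: var_def v2_def v1_def v0_def field_simps)
    then show ?thesis using id[OF l] a by simp
  qed
  have marginal: "integrable (nu_bar N \<mu>0 l) (\<lambda>\<eta>. \<eta> 0)" "(\<integral>\<eta>. \<eta> 0 \<partial>nu_bar N \<mu>0 l) = mean l"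
    "integrable (nu_bar N \<mu>0 l) (\<lambda>\<eta>. (\<eta> 0)\<^sup>2)" "(\<integral>\<eta>. (\<eta> 0)\<^sup>2 \<partial>nu_bar N \<mu>0 l) = (\<integral>s. s\<^sup>2 \<partial>nef \<mu>0 l)"
    "prob_space (nu_bar N \<mu>0 l)"
    if l: "l \<in> J" for l
    using product_site_integrals(1-4)[OF prob_space_nef[OF J_dom[OF l]] nef_integrable s0] l
      prob_space_PiM[of "sites N" "\<lambda>_. nef \<mu>0 l"] prob_space_nef[OF J_dom[OF l]]
    unfolding nu_bar_def mean_def J_def by blast+
  have rho: "rho_bar N \<mu>0 l = mean l" if "l \<in> J" for l using marginal(2)[OF that] by (simp add: rho_bar_def)
  have dom: "mean_dom N \<mu>0 = mean ` J"
    unfolding mean_dom_def J_def using rho by (intro image_cong) (auto simp: J_def)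
  have nu: "nu N \<mu>0 (mean l) = nu_bar N \<mu>0 l" if l: "l \<in> J" for l
  proof -
    have "lambda_of N \<mu>0 (mean l) = l"
      unfolding lambda_of_def using mean_inj rho l by (intro the_equality) (auto simp: J_def[symmetric] inj_on_def)
    then show ?thesis by (simp add: nu_def)
  qed
  have variance: "prob_space.variance (nu N \<mu>0 (mean l)) (\<lambda>\<eta>. \<eta> 0) = var l" if l: "l \<in> J" for l
  proof -
    interpret nu: prob_space "nu_bar N \<mu>0 l" by (rule marginal(5)[OF l])
    show ?thesis unfolding nu[OF l] using nu.variance_eq[OF marginal(1,3)[OF l]] marginal(2,4)[OF l] by (simp add: var_def)
  qed
  have affine: "affine_marginal N \<mu>0 A B (mean l) = distr (law l) borel (\<lambda>x. A * x + B)" if l: "l \<in> J" for l A B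
  proof -
    have m: "(\<lambda>s. s) \<in> borel_measurable (nef \<mu>0 l)" by (simp add: nef_def)
    have "distr (nu_bar N \<mu>0 l) (nef \<mu>0 l) (\<lambda>\<eta>. \<eta> 0) = nef \<mu>0 l"
      unfolding nu_bar_def by (rule distr_PiM_component[OF prob_space_nef[OF J_dom[OF l]] s0])
    then have "law l = distr (distr (nu_bar N \<mu>0 l) (nef \<mu>0 l) (\<lambda>\<eta>. \<eta> 0)) borel (\<lambda>s. s)" by (simp add: law_def)
    also have "\<dots> = distr (nu_bar N \<mu>0 l) borel (\<lambda>\<eta>. \<eta> 0)"
      by (subst distr_distr[OF m]) (auto simp: comp_def nu_bar_def s0 intro!: measurable_component_singleton)
    finally have law: "law l = distr (nu_bar N \<mu>0 l) borel (\<lambda>\<eta>. \<eta> 0)" .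
    have m0: "(\<lambda>\<eta>. \<eta> 0) \<in> borel_measurable (nu_bar N \<mu>0 l)" using marginal(1)[OF l] by simp
    show ?thesis unfolding law affine_marginal_def nu[OF l]
      by (subst distr_distr[OF _ m0]) (simp_all add: comp_def)
  qed
  \<comment> \<open>The classification indexes laws by their mean, the exponential family by its
    parameter; \<open>inv_into J mean\<close> translates.\<close>
  have inv_mean: "inv_into J mean (mean l) = l" if "l \<in> J" for l
    using mean_inj that by (simp add: J_def)
  obtain A B where AB: "A \<noteq> 0"
    "six_families (mean_dom N \<mu>0) (\<lambda>m. distr (law (inv_into J mean m)) borel (\<lambda>x. A * x + B)) v2
       (A * v1 - 2 * v2 * B) (A\<^sup>2 * v0 - A * v1 * B + v2 * B\<^sup>2)"
  proof -
    have "\<exists>A B. A \<noteq> 0 \<and> six_families (mean_dom N \<mu>0) (\<lambda>m. distr (law (inv_into J mean m)) borel (\<lambda>x. A * x + B)) v2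
       (A * v1 - 2 * v2 * B) (A\<^sup>2 * v0 - A * v1 * B + v2 * B\<^sup>2)"
    proof (rule morris_classification)
      show "connected (mean_dom N \<mu>0)" unfolding dom J_def by (rule connected_mean_image)
      show "mean_dom N \<mu>0 \<noteq> {}" unfolding dom using interior_nef_dom_nonempty by (simp add: J_def)
      fix m assume "m \<in> mean_dom N \<mu>0"
      then obtain l where l: "l \<in> J" "m = mean l" unfolding dom by blast
      show "quad_cumulant (law (inv_into J mean m)) v2 v1 v0 m"
        unfolding l(2) inv_mean[OF l(1)] using quad_cumulant_law[of l v2 v1 v0] l(1) Q by (simp add: J_def)
      show "v2 * m\<^sup>2 + v1 * m + v0 > 0"
        using var_pos[of l] Q[OF l(1)] l by (simp add: J_def)
    qed
    then show ?thesis using that by blast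
  qed
  have "six_families (mean_dom N \<mu>0) (affine_marginal N \<mu>0 A B) v2
       (A * v1 - 2 * v2 * B) (A\<^sup>2 * v0 - A * v1 * B + v2 * B\<^sup>2)"
  proof -
    have "affine_marginal N \<mu>0 A B m = distr (law (inv_into J mean m)) borel (\<lambda>x. A * x + B)"
      if "m \<in> mean_dom N \<mu>0" for m
      using that unfolding dom by (auto simp: affine inv_mean)
    then show ?thesis using AB(2) unfolding six_families_def by simp
  qed
  moreover have "quadratic_variance (mean_dom N \<mu>0) (affine_marginal N \<mu>0 A B) v2
       (A * v1 - 2 * v2 * B) (A\<^sup>2 * v0 - A * v1 * B + v2 * B\<^sup>2)"
    unfolding quadratic_variance_def dom
  proof (rule ballI, elim imageE, hypsubst)
    fix l assume l: "l \<in> J"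
    interpret nu: prob_space "nu_bar N \<mu>0 l" by (rule marginal(5)[OF l])
    have m0: "(\<lambda>\<eta>. A * \<eta> 0 + B) \<in> borel_measurable (nu_bar N \<mu>0 l)" using marginal(1)[OF l] by simp
    let ?M = "affine_marginal N \<mu>0 A B (mean l)"
    have E: "(\<integral>x. x \<partial>?M) = A * mean l + B"
      unfolding affine_marginal_def nu[OF l] using marginal(1,2)[OF l]
      by (subst integral_distr[OF m0]) (simp_all add: nu.prob_space)
    have "(\<integral>x. (x - (A * mean l + B))\<^sup>2 \<partial>?M) = (\<integral>\<eta>. A\<^sup>2 * (\<eta> 0 - mean l)\<^sup>2 \<partial>nu_bar N \<mu>0 l)"
      unfolding affine_marginal_def nu[OF l]
      by (subst integral_distr[OF m0])
         (auto intro!: Bochner_Integration.integral_cong simp: power2_eq_square algebra_simps)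
    also have "\<dots> = A\<^sup>2 * var l"
      using variance[OF l] unfolding nu[OF l] marginal(2)[OF l] by simp
    finally show "(\<integral>x. (x - (\<integral>x. x \<partial>?M))\<^sup>2 \<partial>?M) = v2 * (\<integral>x. x \<partial>?M)\<^sup>2 +
        (A * v1 - 2 * v2 * B) * (\<integral>x. x \<partial>?M) + (A\<^sup>2 * v0 - A * v1 * B + v2 * B\<^sup>2)"
      unfolding E Q[OF l] by (simp add: power2_eq_square algebra_simps)
  qed
  moreover have "\<forall>\<rho>\<in>mean_dom N \<mu>0. prob_space.variance (nu N \<mu>0 \<rho>) (\<lambda>\<eta>. \<eta> 0) = v2 * \<rho>\<^sup>2 + v1 * \<rho> + v0"
    unfolding dom using variance Q by auto
  ultimately show ?thesis
    using a AB(1) unfolding v2_def v1_def v0_def by blast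
qed

end
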